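(* Let $n\geqslant 0$ be an integer. If $(\mathcal K ,\lambda )\in {\mathcal P}_n$ is a cuspidal type, then $m_{n,\lambda} =1$.
   Context: $F$ is a non-Archimedean non-discrete locally compact field with odd residue characteristic, $\mathfrak o$ its valuation ring, $\mathfrak p$ the maximal ideal; $G=\mathrm{PGL}(2,F)$. Representations are complex and smooth. A pair $(\mathcal K,\lambda)$ ($\mathcal K$ a compact open subgroup of $G$, $\lambda$ an irreducible smooth representation of $\mathcal K$) is a type (Bushnell-Kutzko) for a Bernstein component $\mathcal R$ of the category of smooth representations of $G$ if an irreducible smooth representation of $G$ contains $\lambda$ on restriction to $\mathcal K$ exactly when it belongs to $\mathcal R$. It is a cuspidal type if it is a type for a component whose irreducible objects are supercuspidal. $X$ is the Bruhat-Tits tree of $G$: vertices are homothety classes $[L]$ of full $\mathfrak o$-lattices in $F^2$; $[L],[M]$ are adjacent iff, for some basis $(e_1,e_2)$ of $F^2$, up to homothety $L=\mathfrak o e_1\oplus\mathfrak o e_2$ and $M=\mathfrak o e_1\oplus\mathfrak p e_2$. For $k\in\mathbb Z$ let $s_k=[\mathfrak o\oplus\mathfrak p^k]$. $\mathcal K_0$ is the stabilizer in $G$ of the vertex $s_0$ and $\mathcal K_1$ is the (global) stabilizer of the edge $[s_0,s_1]$. An oriented $k$-path in $X$ ($k\geqslant 1$) is an injective sequence of $k+1$ vertices of $X$ in which consecutive vertices are adjacent. For $n\geqslant 1$, $\tilde X_n$ is the directed graph whose vertices are the oriented $n$-paths and whose edges are the oriented $(n+1)$-paths; the edge $a=(x_0,\dots,x_{n+1})$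 has tail $a^-=(x_0,\dots,x_n)$ and head $a^+=(x_1,\dots,x_{n+1})$. $\tilde X_0$ is the directed graph whose vertices are the vertices of $X$ and whose edges are the oriented edges $[s,t]$ of $X$ (tail $s$, head $t$), so that each edge of $X$ gives two edges of $\tilde X_0$. $G$ acts on each $\tilde X_n$ preserving the directed graph structure. For a finite directed graph $\Sigma$, $H^1(\Sigma,\mathbb C)$ is the cokernel of $d:C^0\to C^1$, where $C^0$ (resp. $C^1$) is the space of complex functions on the vertex set (resp. on the set of directed edges) and $df(a)=f(a^+)-f(a^-)$; this is the usual cohomology of the geometric realization. Groups acting on $\Sigma$ by directed graph automorphisms act on it. If $n$ is even, $p_n:\tilde X_n\to X$ is the $G$-equivariant graph map sending a vertex (oriented $n$-path) to its middle vertex and an edge (oriented $(n+1)$-path) to its middle edge (for $n=0$: identity on vertices, $[s,t]\mapsto\{s,t\}$ on edges); put $\Sigma_n=p_n^{-1}([s_0,s_1])$. If $n$ is odd, $p_n$ is the $G$-equivariant map, defined after passing to first barycentric subdivisions, sending a vertex (oriented $n$-path) to the midpoint of its middle edge and the midpoint of an edge (oriented $(n+1)$-path) to the middle vertex of that path; put $\Sigma_n=p_n^{-1}(S(s_0,1/2))$, where $S(s_0,1/2)$ is the set of points of the geometric realization of $X$ at distance $\leqslant 1/2$ from $s_0$ (edges having length $1$). $\Sigma_n$ is a finite graph acted on by $\mathcal K_1$ if $n$ is even and by $\mathcal K_0$ if $n$ is odd. $\mathcal P_n$ is the finite set of pairs $(\mathcal K,\lambda)$, with $\mathcal K\in\{\mathcal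 K_0,\mathcal K_1\}$ and $\lambda$ an irreducible smooth representation of $\mathcal K$ (up to isomorphism), such that for some $k\in\{0,1,\dots,n\}$, $\mathcal K=\mathcal K_1$ if $k$ is even, $\mathcal K=\mathcal K_0$ if $k$ is odd, and $\lambda$ is an irreducible constituent of the representation $H^1(\Sigma_k,\mathbb C)$ of $\mathcal K$. For $(\mathcal K,\lambda)\in\mathcal P_n$ and $0\leqslant k\leqslant n$, $m_\lambda^k$ is the multiplicity of $\lambda$ in $H^1(\Sigma_k,\mathbb C)$ (taken to be $0$ when $\mathcal K$ is not the group attached to the parity of $k$), and $m_{n,\lambda}=m_\lambda^0+\cdots+m_\lambda^n$. *)

theory Defs
  imports
    "HOL-Analysis.Analysis"
    "HOL-Algebra.Algebra"
    "HOL-Algebra.Algebraic_Closure_Type"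
    "Jordan_Normal_Form.Missing_VectorSpace"
    "Graph_Theory.Digraph"
begin

section \<open>Non-Archimedean local fields\<close>

text \<open>The absolute value is \<open>\<bar>x\<bar> = dist x 0\<close>; it need not be the normalised one. Non-discreteness
  is the class \<^class>\<open>perfect_space\<close>.\<close>

class nonarch_local_field = field + metric_space + perfect_space +
  assumes dist_translate: "dist (x + z) (y + z) = dist x y"
    and dist_mult_zero: "dist (x * y) 0 = dist x 0 * dist y 0"
    and dist_ultrametric: "dist x z \<le> max (dist x y) (dist y z)"
    and locally_compact: "\<exists>r>0. compact {y. dist x y \<le> r}"

definition valuation_ring :: "'a::nonarch_local_field set" where
  "valuation_ring = {x. dist x 0 \<le> 1}"

definition maximal_ideal :: "'a::nonarch_local_field set" where
  "maximal_ideal = {x. dist x 0 < 1}"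

text \<open>The characteristic of the residue field: \<open>p \<cdot> 1 = 0\<close> in the quotient of the valuation ring by
  its maximal ideal means that \<open>p \<cdot> 1\<close> lies in the maximal ideal. The residue field being finite,
  such a \<open>p > 0\<close> exists.\<close>

definition residue_char :: "'a::nonarch_local_field itself \<Rightarrow> nat" where
  "residue_char _ = (LEAST p. p > 0 \<and> (of_nat p :: 'a) \<in> maximal_ideal)"


section \<open>The topological group \<open>PGL(2,F)\<close>\<close>

definition GL2 :: "('a::field^2^2) monoid" where
  "GL2 = \<lparr>carrier = {A. invertible A}, monoid.mult = (**), one = mat 1\<rparr>"

definition scalars :: "('a::field^2^2) set" where
  "scalars = {mat c |c. c \<noteq> 0}"

type_synonym 'a pgl = "('a^2^2) set"

definition PGL2 :: "'a::field pgl monoid" where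
  "PGL2 = GL2 Mod scalars"

definition proj :: "'a::field^2^2 \<Rightarrow> 'a pgl" where
  "proj A = scalars #>\<^bsub>GL2\<^esub> A"

text \<open>The quotient topology.\<close>

definition PGL2_top :: "'a::nonarch_local_field pgl topology" where
  "PGL2_top = topology (\<lambda>U. U \<subseteq> carrier PGL2 \<and>
     openin (top_of_set (carrier GL2)) {A \<in> carrier GL2. proj A \<in> U})"

lemma openin_PGL2_top:
  fixes U :: "'a::nonarch_local_field pgl set"
  shows "openin PGL2_top U \<longleftrightarrow> U \<subseteq> carrier PGL2 \<and>
     openin (top_of_set (carrier GL2)) {A \<in> carrier GL2. proj A \<in> U}"
proof -
  have "istopology (\<lambda>U :: 'a pgl set. U \<subseteq> carrier PGL2 \<and>
     openin (top_of_set (carrier GL2)) {A \<in> carrier GL2. proj A \<in> U})"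
    (is "istopology ?P")
    unfolding istopology_def
  proof (intro conjI allI impI)
    fix S T :: "'a pgl set"
    assume S: "?P S" and T: "?P T"
    have "{A \<in> carrier GL2. proj A \<in> S \<inter> T} =
        {A \<in> carrier GL2. proj A \<in> S} \<inter> {A \<in> carrier GL2. proj A \<in> T}" by auto
    then show "openin (top_of_set (carrier GL2)) {A \<in> carrier GL2. proj A \<in> S \<inter> T}"
      using S T by (simp add: openin_Int)
  next
    fix \<K> :: "'a pgl set set"
    assume *: "\<forall>S\<in>\<K>. ?P S"
    have "{A \<in> carrier GL2. proj A \<in> \<Union>\<K>} = \<Union>((\<lambda>S. {A \<in> carrier GL2. proj A \<in> S}) ` \<K>)" by auto
    then show "openin (top_of_set (carrier GL2)) {A \<in> carrier GL2. proj A \<in> \<Union>\<K>}"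
      using * by (simp only:) (rule openin_Union, auto)
  qed auto
  then show ?thesis
    unfolding PGL2_top_def by simp
qed


section \<open>Smooth representations\<close>

text \<open>A representation is a complex vector space together with an action of the group; the groups
  occurring below are \<^const>\<open>PGL2\<close> and its subgroups \<open>PGL2\<lparr>carrier := K\<rparr>\<close>, so that restriction to \<open>K\<close>
  is just a change of the group argument.\<close>

record ('g, 'v) rep = "(complex, 'v) module" +
  act :: "'g \<Rightarrow> 'v \<Rightarrow> 'v"

abbreviation complex_field :: "complex ring" where
  "complex_field \<equiv> ring_of_type_algebra"

definition representation :: "('g, 'b) monoid_scheme \<Rightarrow> ('g, 'v) rep \<Rightarrow> bool" where
  "representation H \<pi> \<longleftrightarrow> vectorspace complex_field \<pi> \<and>
     (\<forall>g\<in>carrier H. act \<pi> g \<in> LinearCombinations.module_hom complex_field \<pi> \<pi>) \<and>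
     (\<forall>v\<in>carrier \<pi>. act \<pi> \<one>\<^bsub>H\<^esub> v = v) \<and>
     (\<forall>g\<in>carrier H. \<forall>h\<in>carrier H. \<forall>v\<in>carrier \<pi>. act \<pi> (g \<otimes>\<^bsub>H\<^esub> h) v = act \<pi> g (act \<pi> h v))"

definition smooth_rep :: "'g topology \<Rightarrow> ('g, 'b) monoid_scheme \<Rightarrow> ('g, 'v) rep \<Rightarrow> bool" where
  "smooth_rep T H \<pi> \<longleftrightarrow> representation H \<pi> \<and>
     (\<forall>v\<in>carrier \<pi>. openin (subtopology T (carrier H)) {g \<in> carrier H. act \<pi> g v = v})"

definition invariant_subspace :: "('g, 'b) monoid_scheme \<Rightarrow> 'v set \<Rightarrow> ('g, 'v) rep \<Rightarrow> bool" where
  "invariant_subspace H W \<pi> \<longleftrightarrow> VectorSpace.subspace complex_field W \<pi> \<and>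
     (\<forall>g\<in>carrier H. \<forall>w\<in>W. act \<pi> g w \<in> W)"

definition irreducible_smooth ::
  "'g topology \<Rightarrow> ('g, 'b) monoid_scheme \<Rightarrow> ('g, 'v) rep \<Rightarrow> bool" where
  "irreducible_smooth T H \<pi> \<longleftrightarrow> smooth_rep T H \<pi> \<and> carrier \<pi> \<noteq> {\<zero>\<^bsub>\<pi>\<^esub>} \<and>
     (\<forall>W. invariant_subspace H W \<pi> \<longrightarrow> W = {\<zero>\<^bsub>\<pi>\<^esub>} \<or> W = carrier \<pi>)"

definition intertwiners ::
  "('g, 'b) monoid_scheme \<Rightarrow> ('g, 'v) rep \<Rightarrow> ('g, 'w) rep \<Rightarrow> ('v \<Rightarrow> 'w) set" where
  "intertwiners H \<pi> \<sigma> = {f \<in> LinearCombinations.module_hom complex_field \<pi> \<sigma>.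
     \<forall>g\<in>carrier H. \<forall>v\<in>carrier \<pi>. f (act \<pi> g v) = act \<sigma> g (f v)}"

definition isomorphic :: "('g, 'b) monoid_scheme \<Rightarrow> ('g, 'v) rep \<Rightarrow> ('g, 'w) rep \<Rightarrow> bool" where
  "isomorphic H \<pi> \<sigma> \<longleftrightarrow> (\<exists>f\<in>intertwiners H \<pi> \<sigma>. bij_betw f (carrier \<pi>) (carrier \<sigma>))"

definition contained_in :: "('g, 'b) monoid_scheme \<Rightarrow> ('g, 'v) rep \<Rightarrow> ('g, 'w) rep \<Rightarrow> bool" where
  "contained_in H \<pi> \<sigma> \<longleftrightarrow> (\<exists>f\<in>intertwiners H \<pi> \<sigma>. inj_on f (carrier \<pi>))"

text \<open>\<open>\<pi>\<close> is isomorphic to a subquotient of \<open>\<sigma>\<close>, i.e. to a quotient of a subrepresentation.\<close>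

definition subquotient_of :: "('g, 'b) monoid_scheme \<Rightarrow> ('g, 'v) rep \<Rightarrow> ('g, 'w) rep \<Rightarrow> bool" where
  "subquotient_of H \<pi> \<sigma> \<longleftrightarrow> (\<exists>W. invariant_subspace H W \<sigma> \<and>
     (\<exists>f\<in>intertwiners H (\<sigma>\<lparr>carrier := W\<rparr>) \<pi>. f ` W = carrier \<pi>))"

definition hom_space ::
  "('g, 'b) monoid_scheme \<Rightarrow> ('g, 'v) rep \<Rightarrow> ('g, 'w) rep \<Rightarrow> (complex, 'v \<Rightarrow> 'w) module" where
  "hom_space H \<pi> \<sigma> = \<lparr>carrier = intertwiners H \<pi> \<sigma> \<inter> extensional (carrier \<pi>),
     monoid.mult = undefined, one = undefined,
     ring.zero = (\<lambda>v\<in>carrier \<pi>. \<zero>\<^bsub>\<sigma>\<^esub>),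
     add = (\<lambda>f g. \<lambda>v\<in>carrier \<pi>. f v \<oplus>\<^bsub>\<sigma>\<^esub> g v),
     smult = (\<lambda>c f. \<lambda>v\<in>carrier \<pi>. c \<odot>\<^bsub>\<sigma>\<^esub> f v)\<rparr>"

text \<open>The multiplicity of an irreducible \<open>\<pi>\<close> in a finite-dimensional semisimple \<open>\<sigma>\<close>.\<close>

definition multiplicity_in :: "('g, 'b) monoid_scheme \<Rightarrow> ('g, 'v) rep \<Rightarrow> ('g, 'w) rep \<Rightarrow> nat" where
  "multiplicity_in H \<pi> \<sigma> = vectorspace.dim complex_field (hom_space H \<pi> \<sigma>)"

definition smooth_character ::
  "'g topology \<Rightarrow> ('g, 'b) monoid_scheme \<Rightarrow> ('g \<Rightarrow> complex) \<Rightarrow> bool" where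
  "smooth_character T H \<theta> \<longleftrightarrow> (\<forall>g\<in>carrier H. \<theta> g \<noteq> 0) \<and>
     (\<forall>g\<in>carrier H. \<forall>h\<in>carrier H. \<theta> (g \<otimes>\<^bsub>H\<^esub> h) = \<theta> g * \<theta> h) \<and>
     openin (subtopology T (carrier H)) {g \<in> carrier H. \<theta> g = 1}"

text \<open>For a reductive group, the intersection of the kernels of the unramified characters is the
  subgroup generated by all compact subgroups.\<close>

definition unramified_character ::
  "'g topology \<Rightarrow> ('g, 'b) monoid_scheme \<Rightarrow> ('g \<Rightarrow> complex) \<Rightarrow> bool" where
  "unramified_character T H \<omega> \<longleftrightarrow> smooth_character T H \<omega> \<and>
     (\<forall>C. subgroup C H \<and> compactin T C \<longrightarrow> (\<forall>c\<in>C. \<omega> c = 1))"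

definition twist :: "('g, 'v) rep \<Rightarrow> ('g \<Rightarrow> complex) \<Rightarrow> ('g, 'v) rep" where
  "twist \<pi> \<omega> = \<pi>\<lparr>act := (\<lambda>g v. \<omega> g \<odot>\<^bsub>\<pi>\<^esub> act \<pi> g v)\<rparr>"


section \<open>Bernstein components and types\<close>

text \<open>The diagonal torus and the unipotent radical of the upper triangular Borel subgroup. Up to
  conjugacy, the Levi subgroups of \<^const>\<open>PGL2\<close> are \<^const>\<open>PGL2\<close> itself and the torus.\<close>

definition torus :: "'a::field pgl set" where
  "torus = proj ` {A \<in> carrier GL2. A$1$2 = 0 \<and> A$2$1 = 0}"

definition unipotent :: "'a::field pgl set" where
  "unipotent = proj ` {A \<in> carrier GL2. A$1$1 = 1 \<and> A$2$1 = 0 \<and> A$2$2 = 1}"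

text \<open>Every irreducible smooth representation of \<open>PGL(2,F)\<close> is isomorphic to one whose underlying set
  lies in the following type: a nonzero linear form \<open>l\<close> embeds it equivariantly into the functions
  on the group by \<open>v \<mapsto> (g \<mapsto> l (g v))\<close>. Quantifying over this type thus loses no isomorphism class;
  the vector space structure and the action are arbitrary.\<close>

type_synonym 'a pgl_rep = "('a pgl, 'a pgl \<Rightarrow> complex) rep"

text \<open>The smooth induction, from the Borel subgroup, of a character of the torus. The modulus
  character being unramified, normalising the induction would not affect the components below.\<close>

definition parabolic_induction ::
  "('a::nonarch_local_field pgl \<Rightarrow> complex) \<Rightarrow> 'a pgl_rep" where
  "parabolic_induction \<theta> = \<lparr>
     carrier = {f. (\<forall>g. g \<notin> carrier PGL2 \<longrightarrow> f g = 0) \<and>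
       (\<forall>t\<in>torus. \<forall>u\<in>unipotent. \<forall>g\<in>carrier PGL2.
          f (t \<otimes>\<^bsub>PGL2\<^esub> u \<otimes>\<^bsub>PGL2\<^esub> g) = \<theta> t * f g) \<and>
       (\<exists>U. subgroup U PGL2 \<and> openin PGL2_top U \<and>
          (\<forall>g\<in>carrier PGL2. \<forall>u\<in>U. f (g \<otimes>\<^bsub>PGL2\<^esub> u) = f g))},
     monoid.mult = undefined, one = undefined,
     ring.zero = (\<lambda>g. 0),
     add = (\<lambda>f f' g. f g + f' g),
     smult = (\<lambda>c f g. c * f g),
     act = (\<lambda>h f g. if g \<in> carrier PGL2 then f (g \<otimes>\<^bsub>PGL2\<^esub> h) else 0)\<rparr>"

definition torus_character :: "('a::nonarch_local_field pgl \<Rightarrow> complex) \<Rightarrow> bool" where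
  "torus_character = smooth_character PGL2_top (PGL2\<lparr>carrier := torus\<rparr>)"

definition supercuspidal :: "('a::nonarch_local_field pgl, 'v) rep \<Rightarrow> bool" where
  "supercuspidal \<pi> \<longleftrightarrow> irreducible_smooth PGL2_top PGL2 \<pi> \<and>
     (\<forall>\<theta>. torus_character \<theta> \<longrightarrow> \<not> subquotient_of PGL2 \<pi> (parabolic_induction \<theta>))"

text \<open>A Bernstein component, represented by its irreducible objects, is attached to the inertial class
  of a pair \<open>(M, \<sigma>)\<close> with \<open>M\<close> a Levi subgroup and \<open>\<sigma>\<close> a supercuspidal representation of \<open>M\<close>: it
  consists of the irreducible subquotients of the representations parabolically induced from the
  unramified twists of \<open>\<sigma>\<close>.\<close>

definition group_component ::
  "'a::nonarch_local_field pgl_rep \<Rightarrow> 'a pgl_rep set" where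
  "group_component \<sigma> = {\<pi>. irreducible_smooth PGL2_top PGL2 \<pi> \<and>
     (\<exists>\<omega>. unramified_character PGL2_top PGL2 \<omega> \<and> isomorphic PGL2 \<pi> (twist \<sigma> \<omega>))}"

definition torus_component ::
  "('a::nonarch_local_field pgl \<Rightarrow> complex) \<Rightarrow> 'a pgl_rep set" where
  "torus_component \<theta> = {\<pi>. irreducible_smooth PGL2_top PGL2 \<pi> \<and>
     (\<exists>\<omega>. unramified_character PGL2_top (PGL2\<lparr>carrier := torus\<rparr>) \<omega> \<and>
        subquotient_of PGL2 \<pi> (parabolic_induction (\<lambda>t. \<theta> t * \<omega> t)))}"

definition bernstein_components :: "'a::nonarch_local_field pgl_rep set set" where
  "bernstein_components =
     {group_component \<sigma> |\<sigma>. supercuspidal \<sigma>} \<union> {torus_component \<theta> |\<theta>. torus_character \<theta>}"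

definition type_for ::
  "'a::nonarch_local_field pgl set \<Rightarrow> ('a pgl, 'v) rep \<Rightarrow> 'a pgl_rep set \<Rightarrow> bool" where
  "type_for K \<tau> R \<longleftrightarrow>
     subgroup K PGL2 \<and> openin PGL2_top K \<and> compactin PGL2_top K \<and>
     irreducible_smooth PGL2_top (PGL2\<lparr>carrier := K\<rparr>) \<tau> \<and>
     (\<forall>\<pi> :: 'a pgl_rep. irreducible_smooth PGL2_top PGL2 \<pi> \<longrightarrow>
        (contained_in (PGL2\<lparr>carrier := K\<rparr>) \<tau> \<pi> \<longleftrightarrow> \<pi> \<in> R))"

definition cuspidal_type ::
  "'a::nonarch_local_field pgl set \<Rightarrow> ('a pgl, 'v) rep \<Rightarrow> bool" where
  "cuspidal_type K \<tau> \<longleftrightarrow>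
     (\<exists>R\<in>bernstein_components. (\<forall>\<pi>\<in>R. supercuspidal \<pi>) \<and> type_for K \<tau> R)"


section \<open>The Bruhat--Tits tree\<close>

definition basis2 :: "'a::field^2 \<Rightarrow> 'a^2 \<Rightarrow> bool" where
  "basis2 e1 e2 \<longleftrightarrow> e1 \<noteq> e2 \<and> vec.independent {e1, e2} \<and> vec.span {e1, e2} = UNIV"

definition lattice_sum :: "'a::field set \<Rightarrow> 'a^2 \<Rightarrow> 'a set \<Rightarrow> 'a^2 \<Rightarrow> ('a^2) set" where
  "lattice_sum I e1 J e2 = {a *s e1 + b *s e2 |a b. a \<in> I \<and> b \<in> J}"

definition full_lattice :: "('a::nonarch_local_field^2) set \<Rightarrow> bool" where
  "full_lattice L \<longleftrightarrow>
     (\<exists>e1 e2. basis2 e1 e2 \<and> L = lattice_sum valuation_ring e1 valuation_ring e2)"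

type_synonym 'a vertex = "('a^2) set set"

definition homothety_class :: "('a::field^2) set \<Rightarrow> 'a vertex" where
  "homothety_class L = {(\<lambda>v. c *s v) ` L |c. c \<noteq> 0}"

definition vertices :: "'a::nonarch_local_field vertex set" where
  "vertices = homothety_class ` Collect full_lattice"

definition adjacent :: "'a::nonarch_local_field vertex \<Rightarrow> 'a vertex \<Rightarrow> bool" where
  "adjacent s t \<longleftrightarrow> (\<exists>e1 e2. basis2 e1 e2 \<and>
     s = homothety_class (lattice_sum valuation_ring e1 valuation_ring e2) \<and>
     t = homothety_class (lattice_sum valuation_ring e1 maximal_ideal e2))"

definition s0 :: "'a::nonarch_local_field vertex" where
  "s0 = homothety_class (lattice_sum valuation_ring (axis 1 1) valuation_ring (axis 2 1))"

definition s1 :: "'a::nonarch_local_field vertex" where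
  "s1 = homothety_class (lattice_sum valuation_ring (axis 1 1) maximal_ideal (axis 2 1))"

definition act_vertex :: "'a::field pgl \<Rightarrow> 'a vertex \<Rightarrow> 'a vertex" where
  "act_vertex g x = {(\<lambda>v. A *v v) ` L |A L. A \<in> g \<and> L \<in> x}"

definition K0 :: "'a::nonarch_local_field pgl set" where
  "K0 = {g \<in> carrier PGL2. act_vertex g s0 = s0}"

definition K1 :: "'a::nonarch_local_field pgl set" where
  "K1 = {g \<in> carrier PGL2. act_vertex g ` {s0, s1} = {s0, s1}}"


section \<open>Cohomology of directed graphs\<close>

definition C0 :: "('v, 'e) pre_digraph \<Rightarrow> (complex, 'v \<Rightarrow> complex) module" where
  "C0 \<Sigma> = ring.func_space complex_field (verts \<Sigma>)"

definition C1 :: "('v, 'e) pre_digraph \<Rightarrow> (complex, 'e \<Rightarrow> complex) module" where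
  "C1 \<Sigma> = ring.func_space complex_field (arcs \<Sigma>)"

definition coboundary :: "('v, 'e) pre_digraph \<Rightarrow> ('v \<Rightarrow> complex) \<Rightarrow> ('e \<Rightarrow> complex)" where
  "coboundary \<Sigma> f = (\<lambda>a\<in>arcs \<Sigma>. f (head \<Sigma> a) - f (tail \<Sigma> a))"

definition coboundaries :: "('v, 'e) pre_digraph \<Rightarrow> ('e \<Rightarrow> complex) set" where
  "coboundaries \<Sigma> = coboundary \<Sigma> ` carrier (C0 \<Sigma>)"

text \<open>The cokernel of the coboundary map, with elements the cosets, as a representation of a group
  \<open>G\<close> acting on the arcs by \<open>\<alpha>\<close>.\<close>

definition H1 :: "('g, 'b) monoid_scheme \<Rightarrow> ('g \<Rightarrow> 'e \<Rightarrow> 'e) \<Rightarrow> ('v, 'e) pre_digraph \<Rightarrow>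
    ('g, ('e \<Rightarrow> complex) set) rep" where
  "H1 G \<alpha> \<Sigma> = \<lparr>
     carrier = a_rcosets\<^bsub>C1 \<Sigma>\<^esub> coboundaries \<Sigma>,
     monoid.mult = undefined, one = undefined,
     ring.zero = coboundaries \<Sigma>,
     add = set_add (C1 \<Sigma>),
     smult = (\<lambda>c Y. set_add (C1 \<Sigma>) (coboundaries \<Sigma>) ((\<lambda>f. c \<odot>\<^bsub>C1 \<Sigma>\<^esub> f) ` Y)),
     act = (\<lambda>g Y. (\<lambda>f. \<lambda>a\<in>arcs \<Sigma>. f (\<alpha> (inv\<^bsub>G\<^esub> g) a)) ` Y)\<rparr>"


section \<open>The graphs of oriented paths\<close>

definition paths :: "nat \<Rightarrow> 'a::nonarch_local_field vertex list set" where
  "paths k = {x. length x = Suc k \<and> distinct x \<and> set x \<subseteq> vertices \<and>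
     (\<forall>i<k. adjacent (x ! i) (x ! Suc i))}"

text \<open>For \<open>n = 0\<close> the vertices are the one-element lists, identified with the vertices of the tree.\<close>

definition path_graph ::
  "nat \<Rightarrow> ('a::nonarch_local_field vertex list, 'a vertex list) pre_digraph" where
  "path_graph n = \<lparr>verts = paths n, arcs = paths (Suc n), tail = butlast, head = tl\<rparr>"

text \<open>The middle vertex (as a singleton) or the middle edge of an oriented \<open>k\<close>-path.\<close>

definition middle :: "'a vertex list \<Rightarrow> 'a vertex set" where
  "middle x = (let k = length x - 1 in
     if even k then {x ! (k div 2)} else {x ! (k div 2), x ! Suc (k div 2)})"

text \<open>For even \<open>n\<close>, the preimage of the closed edge \<open>[s0, s1]\<close>: the simplices of that edge are the
  nonempty subsets of \<open>{s0, s1}\<close>. For odd \<open>n\<close>, the preimage of the ball \<open>S(s0, 1/2)\<close>: the vertices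
  of the barycentric subdivision in that ball are the barycentres of the simplices containing \<open>s0\<close>;
  a vertex of the path graph, resp. the midpoint of an arc, is sent to the barycentre of its middle
  simplex. An arc meeting the preimage in an end point only does not belong to it.\<close>

definition Sigma_graph ::
  "nat \<Rightarrow> ('a::nonarch_local_field vertex list, 'a vertex list) pre_digraph" where
  "Sigma_graph n = (let P = (\<lambda>x. if even n then middle x \<subseteq> {s0, s1} else s0 \<in> middle x) in
     (path_graph n)\<lparr>verts := {x \<in> paths n. P x}, arcs := {a \<in> paths (Suc n). P a}\<rparr>)"

definition K_parity :: "nat \<Rightarrow> 'a::nonarch_local_field pgl set" where
  "K_parity k = (if even k then K1 else K0)"

definition H1_Sigma ::
  "nat \<Rightarrow> ('a::nonarch_local_field pgl, ('a vertex list \<Rightarrow> complex) set) rep" where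
  "H1_Sigma k = H1 PGL2 (\<lambda>g. map (act_vertex g)) (Sigma_graph k)"

definition in_P :: "nat \<Rightarrow> 'a::nonarch_local_field pgl set \<Rightarrow> ('a pgl, 'v) rep \<Rightarrow> bool" where
  "in_P n K \<tau> \<longleftrightarrow> K \<in> {K0, K1} \<and> irreducible_smooth PGL2_top (PGL2\<lparr>carrier := K\<rparr>) \<tau> \<and>
     (\<exists>k\<le>n. K = K_parity k \<and> subquotient_of (PGL2\<lparr>carrier := K\<rparr>) \<tau> (H1_Sigma k))"

definition mult_level :: "nat \<Rightarrow> 'a::nonarch_local_field pgl set \<Rightarrow> ('a pgl, 'v) rep \<Rightarrow> nat" where
  "mult_level k K \<tau> =
     (if K = K_parity k then multiplicity_in (PGL2\<lparr>carrier := K\<rparr>) \<tau> (H1_Sigma k) else 0)"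

definition mult_total :: "nat \<Rightarrow> 'a::nonarch_local_field pgl set \<Rightarrow> ('a pgl, 'v) rep \<Rightarrow> nat" where
  "mult_total n K \<tau> = (\<Sum>k\<le>n. mult_level k K \<tau>)"

end

theory Submission
  imports Defs
begin

text \<open>Write \<open>K\<close> for the group acting on \<open>\<Sigma>\<^sub>k\<close>. An arc of \<open>\<Sigma>\<^sub>k\<close> is an oriented \<open>(k+1)\<close>-path centred at
  \<open>s0\<close> or at the edge \<open>[s0, s1]\<close>, and \<open>K\<close> permutes the arcs transitively. A cohomology class has
  exactly one representative orthogonal to the coboundaries; for \<open>k \<ge> 1\<close> these harmonic functions sum
  to zero over the arcs with a given tail and over the arcs with a given head. The multiplicity of
  \<open>\<tau>\<close> in \<open>H\<^sup>1(\<Sigma>\<^sub>k)\<close> is therefore the dimension of the space of \<open>K\<close>-maps from \<open>\<tau>\<close> to the harmonic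
  functions. The total is \<open>1\<close> because this dimension is at most \<open>1\<close> for each \<open>k\<close>, because it is
  nonzero for at most one \<open>k\<close> of the parity given by \<open>K\<close>, and because the constituent \<open>\<tau>\<close> is also a
  subrepresentation (\<open>harm_map_of_subquotient\<close>).

  At most \<open>1\<close> for each \<open>k\<close> is a form of Gelfand's trick: every \<open>K\<close>-invariant kernel \<open>f x y\<close> on pairs
  of arcs that is harmonic in \<open>y\<close> is symmetric (\<open>harmonic_kernel_symmetric\<close>). The algebra of
  \<open>K\<close>-endomorphisms of the harmonic functions is then fixed by transposition, hence commutative
  (\<open>harm_maps_proportional\<close>). For the symmetry let \<open>b\<close> be the arc cut out of the standard apartment
  and \<open>b'\<close> the same path traversed backwards. By a Bruhat decomposition every arc is \<open>h b\<close> or \<open>h b'\<close>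
  with \<open>h\<close> the matrix with rows \<open>(1, t)\<close> and \<open>(s, 1)\<close>. The matrix \<open>diag(1,-1)\<close> fixes \<open>b\<close> and \<open>b'\<close>
  and conjugates \<open>h\<close> to a multiple of its inverse, so \<open>(b, h b)\<close> and \<open>(h b, b)\<close> lie in one orbit. For
  the other arcs, \<open>(h b', b)\<close> lies in the orbit of \<open>(b, \<iota>(h b'))\<close>, where \<open>\<iota>\<close> reverses an arc and
  reflects it; on the coordinates \<open>(s, t)\<close> it interchanges the two entries, up to scaling. If the
  scaled entries have equal absolute value, the diagonal torus carries \<open>h b'\<close> to \<open>\<iota>(h b')\<close>. If not,
  one may assume that \<open>t\<close> is the larger one, applying \<open>\<iota>\<close> if necessary, and that \<open>h b'\<close> is not \<open>b'\<close>;
  then every arc with the same tail as \<open>h b'\<close> is \<open>b'\<close> or a translate of \<open>h b'\<close> under the torus. The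
  function \<open>y \<mapsto> f b y - f b (\<iota> y)\<close> is invariant under the torus, vanishes at \<open>b'\<close> and sums to zero
  over these arcs; so it vanishes at \<open>h b'\<close>.

  The level \<open>k\<close> is determined by \<open>\<tau>\<close>, because lower unipotent matrices that act trivially on the arcs
  of level \<open>k\<close> permute transitively the arcs of level \<open>l > k\<close> with the same tail as \<open>b\<close>
  (\<open>harm_map_separation\<close>).\<close>

section \<open>Spaces of functions on a finite set\<close>

definition function_space :: "'e set \<Rightarrow> ('e \<Rightarrow> complex) set \<Rightarrow> bool" where
  "function_space E S \<longleftrightarrow> (\<lambda>_. 0) \<in> S \<and> (\<forall>f\<in>S. \<forall>g\<in>S. (\<lambda>x. f x + g x) \<in> S) \<and>
     (\<forall>c. \<forall>f\<in>S. (\<lambda>x. c * f x) \<in> S) \<and> (\<forall>f\<in>S. \<forall>x. x \<notin> E \<longrightarrow> f x = 0)"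

lemma function_spaceD:
  assumes "function_space E S"
  shows "(\<lambda>_. 0) \<in> S"
    and "f \<in> S \<Longrightarrow> g \<in> S \<Longrightarrow> (\<lambda>x. f x + g x) \<in> S"
    and "f \<in> S \<Longrightarrow> (\<lambda>x. c * f x) \<in> S"
    and "f \<in> S \<Longrightarrow> x \<notin> E \<Longrightarrow> f x = 0"
  using assms unfolding function_space_def by blast+

lemma function_space_diff:
  assumes "function_space E S" "f \<in> S" "g \<in> S"
  shows "(\<lambda>x. f x - g x) \<in> S"
proof -
  have "(\<lambda>x. f x + (-1) * g x) \<in> S"
    using function_spaceD(2)[OF assms(1,2) function_spaceD(3)[OF assms(1,3)]] .
  then show ?thesis by simp
qed

lemma function_space_sum:
  assumes "function_space E S" "finite I" "\<And>i. i \<in> I \<Longrightarrow> f i \<in> S"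
  shows "(\<lambda>x. \<Sum>i\<in>I. f i x) \<in> S"
  using assms(2,3)
proof (induction I rule: finite_induct)
  case empty
  then show ?case using function_spaceD(1)[OF assms(1)] by simp
next
  case (insert i I)
  then show ?case using function_spaceD(2)[OF assms(1), of "f i" "\<lambda>x. \<Sum>i\<in>I. f i x"] by simp
qed

definition inner_on :: "'e set \<Rightarrow> ('e \<Rightarrow> complex) \<Rightarrow> ('e \<Rightarrow> complex) \<Rightarrow> complex" where
  "inner_on E f g = (\<Sum>x\<in>E. f x * cnj (g x))"

lemma inner_on_linear:
  "inner_on E (\<lambda>x. f x + g x) h = inner_on E f h + inner_on E g h"
  "inner_on E (\<lambda>x. f x - g x) h = inner_on E f h - inner_on E g h"
  "inner_on E (\<lambda>x. c * f x) h = c * inner_on E f h"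
  "inner_on E h (\<lambda>x. f x + g x) = inner_on E h f + inner_on E h g"
  "inner_on E h (\<lambda>x. f x - g x) = inner_on E h f - inner_on E h g"
  "inner_on E h (\<lambda>x. c * f x) = cnj c * inner_on E h f"
  "inner_on E (\<lambda>x. 0) h = 0" "inner_on E h (\<lambda>x. 0) = 0"
  unfolding inner_on_def
  by (simp_all only: distrib_right distrib_left left_diff_distrib right_diff_distrib complex_cnj_add
      complex_cnj_diff complex_cnj_mult sum.distrib sum_subtractf sum_distrib_left mult.assoc mult.left_commute
      complex_cnj_zero mult_zero_left mult_zero_right sum.neutral_const)

lemma inner_on_commute: "inner_on E g f = cnj (inner_on E f g)"
  unfolding inner_on_def by (simp add: mult.commute)

lemma inner_on_self:
  assumes "finite E"
  shows "inner_on E f f = 0 \<longleftrightarrow> (\<forall>x\<in>E. f x = 0)"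
proof -
  have "inner_on E f f = of_real (\<Sum>x\<in>E. (cmod (f x))\<^sup>2)"
    unfolding inner_on_def by (simp only: complex_norm_square[symmetric] of_real_sum)
  then have "inner_on E f f = 0 \<longleftrightarrow> (\<Sum>x\<in>E. (cmod (f x))\<^sup>2) = 0"
    by (simp only: of_real_eq_0_iff)
  then show ?thesis
    using assms by (simp add: sum_nonneg_eq_0_iff)
qed

text \<open>Induction on the set where the functions of \<open>S\<close> may be nonzero: adding a point \<open>e\<close> enlarges
  \<open>S\<close> by at most one dimension, spanned by a vector orthogonal to the functions vanishing at \<open>e\<close>.\<close>

lemma orthogonal_projection_exists:
  assumes "finite A" "finite E" "E \<subseteq> A" "function_space E S"
  shows "\<exists>g\<in>S. \<forall>s\<in>S. inner_on A (\<lambda>x. f x - g x) s = 0"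
  using assms(2,3,4)
proof (induction E arbitrary: S f rule: finite_induct)
  case empty
  have "s = (\<lambda>_. 0)" if "s \<in> S" for s
    using function_spaceD(4)[OF empty(2) that] by auto
  then show ?case
    using function_spaceD(1)[OF empty(2)] by (metis inner_on_linear(8))
next
  case (insert e E)
  define S0 where "S0 = {s \<in> S. s e = 0}"
  note SD = function_spaceD[OF insert.prems(2)]
  have S0: "function_space E S0"
    unfolding function_space_def S0_def using SD by auto (metis)
  have EA: "E \<subseteq> A" using insert by auto
  show ?case
  proof (cases "S = S0")
    case True
    then show ?thesis using insert.IH[OF EA S0] by simp
  next
    case False
    then obtain s1 where s1: "s1 \<in> S" "s1 e \<noteq> 0" unfolding S0_def by auto
    obtain p where p: "p \<in> S0" "\<forall>s\<in>S0. inner_on A (\<lambda>x. s1 x - p x) s = 0"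
      using insert.IH[OF EA S0] by blast
    obtain q where q: "q \<in> S0" "\<forall>s\<in>S0. inner_on A (\<lambda>x. f x - q x) s = 0"
      using insert.IH[OF EA S0] by blast
    define u where "u = (\<lambda>x. s1 x - p x)"
    have uS: "u \<in> S"
      unfolding u_def using function_space_diff[OF insert.prems(2)] s1 p S0_def by auto
    have ue: "u e \<noteq> 0" using s1 p unfolding u_def S0_def by auto
    have u0: "inner_on A u s = 0" if "s \<in> S0" for s using p that unfolding u_def by blast
    have uu: "inner_on A u u \<noteq> 0"
      using ue insert.prems(1) inner_on_self[OF assms(1)] by auto
    define c where "c = inner_on A f u / inner_on A u u"
    define g where "g = (\<lambda>x. q x + c * u x)"
    have "g \<in> S" unfolding g_def using SD(2) SD(3)[OF uS] q S0_def by auto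
    moreover have "inner_on A (\<lambda>x. f x - g x) s = 0" if "s \<in> S" for s
    proof -
      have eq: "(\<lambda>x. f x - g x) = (\<lambda>x. (f x - q x) - c * u x)" unfolding g_def by auto
      define r where "r = (\<lambda>x. s x - (s e / u e) * u x)"
      have "r \<in> S" unfolding r_def by (intro function_space_diff[OF insert.prems(2)] that SD(3) uS)
      then have r: "r \<in> S0" using ue unfolding S0_def r_def by simp
      have s: "s = (\<lambda>x. r x + (s e / u e) * u x)" unfolding r_def by auto
      have 1: "inner_on A (\<lambda>x. f x - g x) r = 0"
        unfolding eq using q r u0 by (simp add: inner_on_linear)
      have "inner_on A q u = 0" using u0[OF q(1)] inner_on_commute[of A q u] by simp
      then have "inner_on A (\<lambda>x. f x - g x) u = inner_on A f u - c * inner_on A u u"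
        unfolding eq by (simp add: inner_on_linear)
      then have 2: "inner_on A (\<lambda>x. f x - g x) u = 0" using uu by (simp add: c_def)
      show ?thesis by (subst s) (simp only: inner_on_linear(4,6) 1 2, simp)
    qed
    ultimately show ?thesis by blast
  qed
qed

definition proj_on :: "'e set \<Rightarrow> ('e \<Rightarrow> complex) set \<Rightarrow> ('e \<Rightarrow> complex) \<Rightarrow> ('e \<Rightarrow> complex)" where
  "proj_on E S f = (SOME g. g \<in> S \<and> (\<forall>s\<in>S. inner_on E (\<lambda>x. f x - g x) s = 0))"

lemma proj_on:
  assumes "finite E" "function_space E S"
  shows "proj_on E S f \<in> S" "s \<in> S \<Longrightarrow> inner_on E (\<lambda>x. f x - proj_on E S f x) s = 0"
proof -
  have "\<exists>g. g \<in> S \<and> (\<forall>s\<in>S. inner_on E (\<lambda>x. f x - g x) s = 0)"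
    using orthogonal_projection_exists[OF assms(1,1) subset_refl assms(2)] by blast
  from someI_ex[OF this, folded proj_on_def]
  show "proj_on E S f \<in> S" "s \<in> S \<Longrightarrow> inner_on E (\<lambda>x. f x - proj_on E S f x) s = 0" by auto
qed

lemma proj_on_unique:
  assumes "finite E" "function_space E S" "g \<in> S" "\<And>s. s \<in> S \<Longrightarrow> inner_on E (\<lambda>x. f x - g x) s = 0"
  shows "proj_on E S f = g"
proof -
  let ?d = "\<lambda>x. proj_on E S f x - g x"
  have d: "?d \<in> S" by (intro function_space_diff[OF assms(2)] proj_on[OF assms(1,2)] assms)
  have "?d = (\<lambda>x. (f x - g x) - (f x - proj_on E S f x))" by auto
  then have "inner_on E ?d ?d = inner_on E (\<lambda>x. f x - g x) ?d - inner_on E (\<lambda>x. f x - proj_on E S f x) ?d"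
    by (metis inner_on_linear(2))
  also have "\<dots> = 0" using assms(4)[OF d] proj_on(2)[OF assms(1,2) d, of f] by simp
  finally have "\<forall>x\<in>E. ?d x = 0" by (rule iffD1[OF inner_on_self[OF assms(1)]])
  then have "proj_on E S f x = g x" for x
    using function_spaceD(4)[OF assms(2) assms(3), of x] function_spaceD(4)[OF assms(2) proj_on(1)[OF assms(1,2)], of x f]
    by (cases "x \<in> E") auto
  then show ?thesis by auto
qed

lemma proj_on_linear:
  assumes "finite E" "function_space E S"
  shows "proj_on E S (\<lambda>x. f x + g x) = (\<lambda>x. proj_on E S f x + proj_on E S g x)"
    and "proj_on E S (\<lambda>x. c * f x) = (\<lambda>x. c * proj_on E S f x)"
proof -
  note P = proj_on[OF assms] and D = function_spaceD[OF assms(2)]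
  show "proj_on E S (\<lambda>x. f x + g x) = (\<lambda>x. proj_on E S f x + proj_on E S g x)"
  proof (rule proj_on_unique[OF assms])
    show "(\<lambda>x. proj_on E S f x + proj_on E S g x) \<in> S" by (intro D P)
    fix s assume "s \<in> S"
    then show "inner_on E (\<lambda>x. f x + g x - (proj_on E S f x + proj_on E S g x)) s = 0"
      using P(2)[of s f] P(2)[of s g] by (simp add: inner_on_linear)
  qed
  show "proj_on E S (\<lambda>x. c * f x) = (\<lambda>x. c * proj_on E S f x)"
  proof (rule proj_on_unique[OF assms])
    show "(\<lambda>x. c * proj_on E S f x) \<in> S" by (intro D P)
    fix s assume "s \<in> S"
    then show "inner_on E (\<lambda>x. c * f x - c * proj_on E S f x) s = 0"
      using P(2)[of s f] by (simp add: inner_on_linear)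
  qed
qed

lemma proj_on_id:
  assumes "finite E" "function_space E S" "f \<in> S"
  shows "proj_on E S f = f"
  by (rule proj_on_unique[OF assms]) (simp add: inner_on_linear)

lemma proj_on_eq_0:
  assumes "finite E" "function_space E S" "\<And>s. s \<in> S \<Longrightarrow> inner_on E f s = 0"
  shows "proj_on E S f = (\<lambda>_. 0)"
  by (rule proj_on_unique[OF assms(1,2)]) (use assms function_spaceD(1) in auto)

text \<open>Elimination of one coordinate at a time.\<close>

lemma linear_dependence:
  fixes u :: "'i \<Rightarrow> 'e \<Rightarrow> complex"
  assumes "finite E" "finite I" "card E < card I" "\<And>i x. i \<in> I \<Longrightarrow> x \<notin> E \<Longrightarrow> u i x = 0"
  shows "\<exists>c. (\<exists>i\<in>I. c i \<noteq> 0) \<and> (\<forall>x. (\<Sum>i\<in>I. c i * u i x) = 0)"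
  using assms
proof (induction E arbitrary: I u rule: finite_induct)
  case empty
  then obtain i where "i \<in> I" by fastforce
  then show ?case using empty by (intro exI[of _ "\<lambda>_. 1"]) auto
next
  case (insert e E)
  show ?case
  proof (cases "\<forall>i\<in>I. u i e = 0")
    case True
    have "card E < card I" using insert by simp
    moreover have "u i x = 0" if "i \<in> I" "x \<notin> E" for i x
      using True that insert.prems(3)[of i x] by (cases "x = e") auto
    ultimately show ?thesis using insert.IH[of I u] insert.prems by blast
  next
    case False
    then obtain j where j: "j \<in> I" "u j e \<noteq> 0" by auto
    define v where "v = (\<lambda>i x. u i x - (u i e / u j e) * u j x)"
    define J where "J = I - {j}"
    have "card E < card J" using insert j unfolding J_def by simp
    moreover have "finite J" unfolding J_def using insert by simp
    moreover have "v i x = 0" if "i \<in> J" "x \<notin> E" for i x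
      using that insert.prems(3)[of i x] insert.prems(3)[of j x] j
      unfolding v_def J_def by (cases "x = e") auto
    ultimately obtain c where c: "\<exists>i\<in>J. c i \<noteq> 0" "\<And>x. (\<Sum>i\<in>J. c i * v i x) = 0"
      using insert.IH[of J v] by blast
    define d where "d = c(j := - (\<Sum>i\<in>J. c i * u i e) / u j e)"
    have I: "I = insert j J" "j \<notin> J" "finite J" using j insert unfolding J_def by auto
    have "(\<Sum>i\<in>I. d i * u i x) = 0" for x
    proof -
      have "(\<Sum>i\<in>J. d i * u i x) = (\<Sum>i\<in>J. c i * u i x)"
        by (rule sum.cong) (auto simp: d_def I)
      moreover have "(\<Sum>i\<in>J. c i * v i x) = (\<Sum>i\<in>J. c i * u i x) - (\<Sum>i\<in>J. c i * u i e) * (u j x / u j e)"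
        unfolding v_def by (simp add: right_diff_distrib sum_subtractf sum_distrib_right sum_divide_distrib mult.assoc)
      ultimately show ?thesis using c(2)[of x] I by (simp add: d_def)
    qed
    moreover have "\<exists>i\<in>I. d i \<noteq> 0" using c(1) I by (auto simp: d_def)
    ultimately show ?thesis by blast
  qed
qed

text \<open>A nonzero polynomial of least degree annihilating a vector \<open>f\<close> has a root \<open>c\<close>; dividing out
  the corresponding linear factor gives an eigenvector.\<close>

lemma eigenvector_exists:
  fixes T :: "('e \<Rightarrow> complex) \<Rightarrow> ('e \<Rightarrow> complex)"
  assumes E: "finite E" and W: "function_space E W" and f: "f \<in> W" "f \<noteq> (\<lambda>_. 0)"
    and TW: "\<And>w. w \<in> W \<Longrightarrow> T w \<in> W"
    and Tadd: "\<And>v w. v \<in> W \<Longrightarrow> w \<in> W \<Longrightarrow> T (\<lambda>x. v x + w x) = (\<lambda>x. T v x + T w x)"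
    and Tmult: "\<And>c w. w \<in> W \<Longrightarrow> T (\<lambda>x. c * w x) = (\<lambda>x. c * T w x)"
  shows "\<exists>c. \<exists>w\<in>W. w \<noteq> (\<lambda>_. 0) \<and> T w = (\<lambda>x. c * w x)"
proof -
  define u where "u i = (T ^^ i) f" for i
  have uW: "u i \<in> W" for i unfolding u_def by (induction i) (auto simp: f TW)
  have uS: "T (u i) = u (Suc i)" for i unfolding u_def by simp
  define ev where "ev p = (\<lambda>x. \<Sum>i\<le>Polynomial.degree p. poly.coeff p i * u i x)" for p :: "complex poly"
  have ev: "ev p = (\<lambda>x. \<Sum>i\<le>n. poly.coeff p i * u i x)" if "Polynomial.degree p \<le> n" for p n
  proof
    fix x
    show "ev p x = (\<Sum>i\<le>n. poly.coeff p i * u i x)"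
      unfolding ev_def by (rule sum.mono_neutral_left) (use that coeff_eq_0[of p] in \<open>auto simp: not_le\<close>)
  qed
  have evW: "ev p \<in> W" for p
    unfolding ev_def by (intro function_space_sum[OF W] function_spaceD(3)[OF W] uW) auto
  have Tsum: "T (\<lambda>x. \<Sum>i\<in>I. c i * u i x) = (\<lambda>x. \<Sum>i\<in>I. c i * u (Suc i) x)" if "finite I" for I :: "nat set" and c
    using that
  proof (induction I rule: finite_induct)
    case empty
    then show ?case using Tmult[of f 0] f by simp
  next
    case (insert j I)
    have "(\<lambda>x. \<Sum>i\<in>I. c i * u i x) \<in> W"
      by (intro function_space_sum[OF W] function_spaceD(3)[OF W] uW insert)
    then show ?case
      using insert Tadd[of "\<lambda>x. c j * u j x" "\<lambda>x. \<Sum>i\<in>I. c i * u i x"]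
      by (simp add: function_spaceD(3)[OF W] uW Tmult uS)
  qed
  have ev_factor: "ev ([:- c, 1:] * q) = (\<lambda>x. T (ev q) x - c * ev q x)" for c q
  proof
    fix x
    define n where "n = Polynomial.degree q"
    have d: "Polynomial.degree ([:- c, 1:] * q) \<le> Suc n"
      unfolding n_def using degree_mult_le[of "[:- c, 1:]" q] by simp
    have e: "[:- c, 1:] * q = pCons 0 q - Polynomial.smult c q" by simp
    have "ev ([:- c, 1:] * q) x = (\<Sum>i\<le>Suc n. poly.coeff (pCons 0 q) i * u i x) - (\<Sum>i\<le>Suc n. c * poly.coeff q i * u i x)"
      unfolding ev[OF d] unfolding e by (simp only: coeff_diff coeff_smult left_diff_distrib sum_subtractf)
    moreover have "(\<Sum>i\<le>Suc n. poly.coeff (pCons 0 q) i * u i x) = (\<Sum>i\<le>n. poly.coeff q i * u (Suc i) x)"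
      by (subst sum.atMost_Suc_shift) simp
    moreover have "(\<Sum>i\<le>Suc n. c * poly.coeff q i * u i x) = c * ev q x"
    proof -
      have "Polynomial.degree q \<le> Suc n" by (simp add: n_def)
      from ev[OF this] show ?thesis by (simp only: sum_distrib_left mult.assoc)
    qed
    moreover have "(\<Sum>i\<le>n. poly.coeff q i * u (Suc i) x) = T (ev q) x"
      unfolding ev_def n_def by (subst Tsum) auto
    ultimately show "ev ([:- c, 1:] * q) x = T (ev q) x - c * ev q x" by (simp only:)
  qed
  have "\<exists>p. p \<noteq> 0 \<and> ev p = (\<lambda>_. 0)"
  proof -
    obtain a where a: "\<exists>i\<in>{..card E}. a i \<noteq> 0" "\<And>x. (\<Sum>i\<in>{..card E}. a i * u i x) = 0"
      using linear_dependence[OF E, of "{..card E}" u] function_spaceD(4)[OF W uW] by auto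
    define p where "p = (\<Sum>i\<le>card E. Polynomial.monom (a i) i)"
    have co: "poly.coeff p i = (if i \<le> card E then a i else 0)" for i
      unfolding p_def by (auto simp: coeff_sum)
    have "Polynomial.degree p \<le> card E" by (rule degree_le) (auto simp: co)
    then have "ev p = (\<lambda>_. 0)" using a(2) by (subst ev) (auto simp: co)
    moreover have "p \<noteq> 0"
    proof
      assume "p = 0"
      then have "a i = 0" if "i \<le> card E" for i using co[of i] that by simp
      then show False using a(1) by auto
    qed
    ultimately show ?thesis by blast
  qed
  then obtain p0 where "p0 \<noteq> 0 \<and> ev p0 = (\<lambda>_. 0)" ..
  from ex_has_least_nat[of "\<lambda>p. p \<noteq> 0 \<and> ev p = (\<lambda>_. 0)", OF this, of Polynomial.degree]
  obtain p where p: "p \<noteq> 0" "ev p = (\<lambda>_. 0)"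
    and min: "\<And>q. q \<noteq> 0 \<Longrightarrow> ev q = (\<lambda>_. 0) \<Longrightarrow> Polynomial.degree p \<le> Polynomial.degree q"
    by metis
  have "Polynomial.degree p \<noteq> 0"
  proof
    assume d: "Polynomial.degree p = 0"
    then have "ev p = (\<lambda>x. poly.coeff p 0 * f x)" by (simp add: ev_def u_def)
    moreover have "poly.coeff p 0 \<noteq> 0" using leading_coeff_neq_0[OF p(1)] d by simp
    ultimately
    show False using p(2) f(2) by (auto simp: fun_eq_iff)
  qed
  then obtain c where "poly p c = 0"
    using fundamental_theorem_of_algebra[of p] constant_degree[of p] by metis
  then obtain q where q: "p = [:- c, 1:] * q" using poly_eq_0_iff_dvd[of p c] unfolding dvd_def by blast
  have q0: "q \<noteq> 0"
  proof
    assume "q = 0"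
    then have "p = [:- c, 1:] * 0" using q by metis
    then show False using p(1) by (simp only: mult_zero_right not_True_eq_False)
  qed
  have "Polynomial.degree ([:- c, 1:] * q) = Polynomial.degree [:- c, 1:] + Polynomial.degree q"
    by (rule degree_mult_eq) (use q0 in simp_all)
  then have "Polynomial.degree p = Suc (Polynomial.degree q)" unfolding q[symmetric] by simp
  then have "\<not> Polynomial.degree p \<le> Polynomial.degree q" by simp
  then have ne: "ev q \<noteq> (\<lambda>_. 0)" using min[OF q0] by (rule contrapos_nn)
  have eig: "T (ev q) = (\<lambda>x. c * ev q x)"
  proof
    fix x
    have "ev p x = T (ev q) x - c * ev q x" by (subst q, subst ev_factor) (rule refl)
    then show "T (ev q) x = c * ev q x" using p(2) by simp
  qed
  show ?thesis by (rule exI[of _ c], rule bexI[of _ "ev q"]) (intro conjI ne eig evW)+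
qed

section \<open>The absolute value of a local field\<close>

abbreviation nv :: "'a::nonarch_local_field \<Rightarrow> real" where
  "nv x \<equiv> dist x 0"

lemma dist_nv: "dist x y = nv (x - y)" for x y :: "'a::nonarch_local_field"
  using dist_translate[of "x - y" y 0] by simp

lemma nv_1 [simp]: "nv (1::'a::nonarch_local_field) = 1"
  using dist_mult_zero[of "1::'a" 1] by simp

lemma nv_minus [simp]: "nv (- x) = nv x" for x :: "'a::nonarch_local_field"
  using dist_nv[of 0 x] by (simp add: dist_commute)

lemma nv_diff_commute: "nv (x - y) = nv (y - x)" for x y :: "'a::nonarch_local_field"
  using nv_minus[of "x - y"] by simp

lemma nv_mult: "nv (x * y) = nv x * nv y" for x y :: "'a::nonarch_local_field"
  by (rule dist_mult_zero)

lemma nv_inverse: "nv (inverse x) = inverse (nv x)" for x :: "'a::nonarch_local_field"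
proof (cases "x = 0")
  case False
  then show ?thesis using nv_mult[of x "inverse x"] by (simp add: inverse_eq_divide field_simps)
qed simp

lemma nv_divide: "nv (x / y) = nv x / nv y" for x y :: "'a::nonarch_local_field"
  by (simp add: divide_inverse nv_mult nv_inverse)

lemma nv_power: "nv (x ^ n) = nv x ^ n" for x :: "'a::nonarch_local_field"
  by (induction n) (auto simp: nv_mult)

lemma nv_power_int: "nv (x powi n) = nv x powi n" for x :: "'a::nonarch_local_field"
  by (cases "n \<ge> 0") (auto simp: power_int_def nv_power nv_inverse)

lemma nv_add: "nv (x + y) \<le> max (nv x) (nv y)" for x y :: "'a::nonarch_local_field"
  using dist_ultrametric[of "x + y" 0 y] dist_nv[of "x + y" y] by simp

lemma nv_add_le: "nv x \<le> r \<Longrightarrow> nv y \<le> r \<Longrightarrow> nv (x + y) \<le> r" for x y :: "'a::nonarch_local_field"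
  using nv_add[of x y] by linarith

lemma nv_diff_le: "nv x \<le> r \<Longrightarrow> nv y \<le> r \<Longrightarrow> nv (x - y) \<le> r" for x y :: "'a::nonarch_local_field"
  using nv_add_le[of x r "- y"] by simp

lemma nv_add_less: "nv x < r \<Longrightarrow> nv y < r \<Longrightarrow> nv (x + y) < r" for x y :: "'a::nonarch_local_field"
  using nv_add[of x y] by linarith

lemma nv_add_eq: "nv y < nv x \<Longrightarrow> nv (x + y) = nv x" for x y :: "'a::nonarch_local_field"
  using nv_add[of x y] nv_add[of "x + y" "- y"] by simp

lemma nv_mult_le1: "nv x \<le> 1 \<Longrightarrow> nv y \<le> 1 \<Longrightarrow> nv (x * y) \<le> 1" for x y :: "'a::nonarch_local_field"
  by (simp add: nv_mult mult_le_one)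

lemma nv_mult_eq_1:
  fixes x y :: "'a::nonarch_local_field"
  assumes "nv x \<le> 1" "nv y \<le> 1"
  shows "nv (x * y) = 1 \<longleftrightarrow> nv x = 1 \<and> nv y = 1"
proof -
  have "nv x * nv y \<le> nv x" "nv x * nv y \<le> nv y"
    using assms by (simp_all add: mult_left_le mult_left_le_one_le)
  then have "nv x = 1 \<and> nv y = 1" if "nv x * nv y = 1" using assms that by linarith
  then show ?thesis unfolding nv_mult by auto
qed

lemma nv_mult_le_left: "nv x \<le> 1 \<Longrightarrow> nv y \<le> r \<Longrightarrow> nv (x * y) \<le> r" for x y :: "'a::nonarch_local_field"
  using mult_mono[of "nv x" 1 "nv y" r] by (simp add: nv_mult)

lemma nv_mult_le_right: "nv x \<le> r \<Longrightarrow> nv y \<le> 1 \<Longrightarrow> nv (x * y) \<le> r" for x y :: "'a::nonarch_local_field"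
  using nv_mult_le_left[of y x r] by (simp add: mult.commute)

lemma continuous_on_mult_const: "continuous_on S (\<lambda>x::'a::nonarch_local_field. c * x)"
proof (cases "c = 0")
  case False
  have D: "dist (c * y) (c * x) = nv c * dist y x" for x y :: 'a
    unfolding dist_nv[of "c * y"] dist_nv[of y x] right_diff_distrib[symmetric] by (rule nv_mult)
  show ?thesis
    unfolding continuous_on_iff
  proof (intro ballI allI impI)
    fix x e assume "(0::real) < e"
    then show "\<exists>d>0. \<forall>x'\<in>S. dist x' x < d \<longrightarrow> dist (c * x') (c * x) < e"
      using False by (intro exI[of _ "e / nv c"])
        (simp add: D pos_less_divide_eq mult.commute[of "nv c"])
  qed
qed simp

lemma exists_small: "\<exists>a::'a::nonarch_local_field. 0 < nv a \<and> nv a < 1"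
proof -
  have "\<not> open {0::'a}" by (rule not_open_singleton)
  then have "ball (0::'a) 1 \<noteq> {0}"
    using open_ball[of "0::'a" 1] by metis
  moreover have "0 \<in> ball (0::'a) 1" by simp
  ultimately have "\<not> ball (0::'a) 1 \<subseteq> {0}" by blast
  then show ?thesis by (auto simp: dist_commute)
qed

text \<open>Local compactness provides a compact ball of some radius; multiplication by a nonzero scalar of
  small absolute value embeds the valuation ring into it as a closed subset.\<close>

lemma compact_valuation_ring: "compact (valuation_ring :: 'a::nonarch_local_field set)"
proof -
  obtain r where r: "r > 0" "compact {y::'a. dist 0 y \<le> r}" using locally_compact by blast
  obtain a :: 'a where a: "0 < nv a" "nv a < 1" using exists_small by blast
  obtain n where n: "nv a ^ n < r" using real_arch_pow_inv[OF r(1) a(2)] by blast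
  define b where "b = a ^ n"
  have b: "b \<noteq> 0" "nv b \<le> r" using a n by (auto simp: b_def nv_power)
  have "valuation_ring = (\<lambda>x. inverse b * x) ` {y. nv y \<le> nv b}"
  proof (intro equalityI subsetI)
    fix x :: 'a assume "x \<in> valuation_ring"
    then show "x \<in> (\<lambda>x. inverse b * x) ` {y. nv y \<le> nv b}"
      using b by (intro image_eqI[of _ _ "b * x"]) (auto simp: valuation_ring_def nv_mult mult_left_le)
  next
    fix x assume "x \<in> (\<lambda>x. inverse b * x) ` {y. nv y \<le> nv b}"
    then obtain y where "nv y \<le> nv b" "x = y / b" by (auto simp: field_simps)
    moreover have "0 < nv b" using b by simp
    ultimately show "x \<in> valuation_ring"
      by (simp add: valuation_ring_def nv_divide)
  qed
  moreover have "compact {y::'a. nv y \<le> nv b}"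
  proof -
    have "closed {y::'a. nv y \<le> nv b}" by (intro closed_Collect_le continuous_intros)
    moreover have "{y::'a. dist 0 y \<le> r} \<inter> {y. nv y \<le> nv b} = {y. nv y \<le> nv b}"
      using b by (auto simp: dist_commute)
    ultimately show ?thesis using compact_Int_closed[OF r(2)] by metis
  qed
  ultimately show ?thesis
    using compact_continuous_image[OF continuous_on_mult_const] by metis
qed

definition uniformizer :: "'a::nonarch_local_field" where
  "uniformizer = (SOME p. p \<noteq> 0 \<and> nv p < 1 \<and> (\<forall>x::'a. nv x < 1 \<longrightarrow> nv x \<le> nv p))"

text \<open>The maximal ideal is compact, being closed, so the absolute value attains its maximum there.\<close>

lemma uniformizer:
  "(uniformizer :: 'a::nonarch_local_field) \<noteq> 0" "nv (uniformizer :: 'a) < 1" "nv (x :: 'a) < 1 \<Longrightarrow> nv x \<le> nv (uniformizer :: 'a)"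
proof -
  let ?m = "{x::'a. nv x < 1}"
  have "- ?m = (\<Union>x\<in>- ?m. ball x 1)"
  proof (intro equalityI subsetI)
    fix y assume "y \<in> (\<Union>x\<in>- ?m. ball x 1)"
    then obtain x where x: "\<not> nv x < 1" "nv (x - y) < 1" by (auto simp: dist_nv[of _ y])
    then show "y \<in> - ?m" using nv_add_less[of "x - y" 1 y] by auto
  next
    fix y assume "y \<in> - ?m"
    then show "y \<in> (\<Union>x\<in>- ?m. ball x 1)" by (intro UN_I[of y]) auto
  qed
  then have "open (- ?m)" by (metis open_UN open_ball)
  then have "closed ?m" by (simp add: closed_def)
  moreover have "valuation_ring \<inter> ?m = ?m" by (auto simp: valuation_ring_def)
  ultimately have "compact ?m" using compact_Int_closed[OF compact_valuation_ring] by metis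
  moreover have "0 \<in> ?m" by simp
  moreover have "continuous_on ?m nv" by (intro continuous_intros)
  ultimately obtain p where p: "p \<in> ?m" "\<forall>x\<in>?m. nv x \<le> nv p"
    using continuous_attains_sup[of ?m nv] by blast
  obtain a :: 'a where a: "0 < nv a" "nv a < 1" using exists_small by blast
  have "p \<noteq> 0 \<and> nv p < 1 \<and> (\<forall>x::'a. nv x < 1 \<longrightarrow> nv x \<le> nv p)" using p a by force
  from someI[of "\<lambda>p. p \<noteq> 0 \<and> nv p < 1 \<and> (\<forall>x::'a. nv x < 1 \<longrightarrow> nv x \<le> nv p)", OF this, folded uniformizer_def]
  show "(uniformizer :: 'a) \<noteq> 0" "nv (uniformizer :: 'a) < 1" "nv (x :: 'a) < 1 \<Longrightarrow> nv x \<le> nv (uniformizer :: 'a)" by auto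
qed

text \<open>Compactness makes the valuation ring finite modulo each power of its maximal ideal; this is the
  source of all finiteness below.\<close>

lemma finite_residues:
  fixes r :: real
  assumes "r > 0"
  shows "\<exists>R::'a::nonarch_local_field set. finite R \<and> R \<subseteq> valuation_ring \<and>
    (\<forall>x\<in>valuation_ring. \<exists>y\<in>R. nv (x - y) \<le> r)"
proof -
  have "(valuation_ring :: 'a set) \<subseteq> (\<Union>y\<in>valuation_ring. ball y r)" using assms by (auto intro: UN_I)
  then obtain R :: "'a set" where "R \<subseteq> valuation_ring" "finite R" "valuation_ring \<subseteq> (\<Union>y\<in>R. ball y r)"
    using compactE_image[OF compact_valuation_ring, of valuation_ring "\<lambda>y. ball y r"] by auto
  moreover have "\<exists>y\<in>R. nv (x - y) \<le> r" if x: "x \<in> valuation_ring" for x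
  proof -
    obtain y where "y \<in> R" "dist y x < r" using x \<open>valuation_ring \<subseteq> (\<Union>y\<in>R. ball y r)\<close> by auto
    then show ?thesis using dist_nv[of y x] nv_diff_commute[of x y] by (intro bexI[of _ y]) auto
  qed
  ultimately show ?thesis by blast
qed

lemma nv_unif: "0 < nv (uniformizer::'a::nonarch_local_field)" "nv (uniformizer::'a) < 1"
  using uniformizer[where ?'a = 'a] by auto

text \<open>The quotient \<open>x / y\<close> lies in the maximal ideal: the absolute value is discrete.\<close>

lemma nv_gap: "nv x < nv y \<Longrightarrow> nv x \<le> nv (uniformizer :: 'a) * nv y" for x y :: "'a::nonarch_local_field"
proof -
  assume a: "nv x < nv y"
  then have y: "0 < nv y" using zero_le_dist[of x 0] by linarith
  then have "nv (x / y) < 1" using a by (simp add: nv_divide)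
  then have "nv (x / y) \<le> nv (uniformizer::'a)" by (rule uniformizer(3))
  then show ?thesis using y by (simp add: nv_divide pos_divide_le_eq)
qed

section \<open>Two by two matrices and the group\<close>

definition M2 :: "'a \<Rightarrow> 'a \<Rightarrow> 'a \<Rightarrow> 'a \<Rightarrow> 'a::field^2^2" where
  "M2 a b c d = vector [vector [a, b], vector [c, d]]"

lemma M2_nth [simp]:
  "M2 a b c d $ 1 $ 1 = a" "M2 a b c d $ 1 $ 2 = b" "M2 a b c d $ 2 $ 1 = c" "M2 a b c d $ 2 $ 2 = d"
  by (simp_all add: M2_def)

lemma M2_eta: "A = M2 (A$1$1) (A$1$2) (A$2$1) (A$2$2)"
  by (simp add: vec_eq_iff forall_2)

lemma M2_cases: obtains a b c d where "A = M2 a b c d"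
  using M2_eta by blast

lemma M2_eq_iff [simp]: "M2 a b c d = M2 a' b' c' d' \<longleftrightarrow> a = a' \<and> b = b' \<and> c = c' \<and> d = d'"
  by (auto simp: vec_eq_iff forall_2)

lemma M2_mult [simp]:
  "M2 a b c d ** M2 a' b' c' d' = M2 (a * a' + b * c') (a * b' + b * d') (c * a' + d * c') (c * b' + d * d')"
  by (simp add: vec_eq_iff forall_2 matrix_matrix_mult_def sum_2)

lemma mat_M2: "mat k = M2 k 0 0 k"
  by (simp add: vec_eq_iff forall_2 mat_def)

lemma M2_mult_vec: "(M2 a b c d *v v) $ 1 = a * v$1 + b * v$2" "(M2 a b c d *v v) $ 2 = c * v$1 + d * v$2"
  by (simp_all add: matrix_vector_mult_def sum_2)

lemma invertible_M2: "invertible (M2 a b c d) \<longleftrightarrow> a * d - b * c \<noteq> 0"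
  by (simp add: invertible_det_nz det_2)

lemma invertible_mat: "k \<noteq> 0 \<Longrightarrow> invertible (mat k :: 'a::field^2^2)"
  by (simp add: mat_M2 invertible_M2)

lemma invertible_inv:
  assumes "invertible (A :: 'a::field^'n^'n)"
  shows "invertible (matrix_inv A)" "matrix_inv A ** A = mat 1" "A ** matrix_inv A = mat 1"
proof -
  have "\<exists>B. A ** B = mat 1 \<and> B ** A = mat 1" using assms unfolding invertible_def .
  from someI_ex[OF this, folded matrix_inv_def]
  show "invertible (matrix_inv A)" "matrix_inv A ** A = mat 1" "A ** matrix_inv A = mat 1"
    unfolding invertible_def by blast+
qed

lemma mat_commute: "mat k ** A = A ** mat k" for A :: "'a::field^2^2"
  by (cases A rule: M2_cases) (simp add: mat_M2 mult.commute)

lemma GL2_simps [simp]: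
  "carrier GL2 = {A. invertible A}" "monoid.mult GL2 = (**)" "one GL2 = mat 1"
  by (simp_all add: GL2_def)

lemma group_GL2: "group (GL2 :: ('a::field^2^2) monoid)"
proof (rule groupI)
  fix A :: "'a^2^2" assume "A \<in> carrier GL2"
  then show "\<exists>B\<in>carrier GL2. B \<otimes>\<^bsub>GL2\<^esub> A = \<one>\<^bsub>GL2\<^esub>"
    using invertible_inv[of A] by (intro bexI[of _ "matrix_inv A"]) auto
qed (auto simp: invertible_mult matrix_mul_assoc invertible_mat)

lemma normal_scalars: "scalars \<lhd> (GL2 :: ('a::field^2^2) monoid)"
proof -
  interpret group "GL2 :: ('a^2^2) monoid" by (rule group_GL2)
  have inv: "inv\<^bsub>GL2\<^esub> (mat k) = mat (inverse k)" if "k \<noteq> 0" for k :: 'a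
    using that by (intro inv_equality) (simp_all add: mat_M2 invertible_M2)
  have sub: "subgroup scalars (GL2 :: ('a^2^2) monoid)"
  proof
    fix x y :: "'a^2^2" assume "x \<in> scalars" "y \<in> scalars"
    then obtain k l where "x = mat k" "y = mat l" "k \<noteq> 0" "l \<noteq> 0" unfolding scalars_def by auto
    then show "x \<otimes>\<^bsub>GL2\<^esub> y \<in> scalars" unfolding scalars_def
      by (auto intro!: exI[of _ "k * l"] simp: mat_M2)
  next
    fix x :: "'a^2^2" assume "x \<in> scalars"
    then obtain k where "x = mat k" "k \<noteq> 0" unfolding scalars_def by auto
    then show "inv\<^bsub>GL2\<^esub> x \<in> scalars" unfolding scalars_def using inv by auto
  qed (auto simp: scalars_def invertible_mat intro: exI[of _ 1])
  show ?thesis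
  proof (rule normalI[OF sub], intro ballI)
    fix x :: "'a^2^2"
    show "scalars #>\<^bsub>GL2\<^esub> x = x <#\<^bsub>GL2\<^esub> scalars"
      unfolding r_coset_def l_coset_def scalars_def by (auto simp: mat_commute)
  qed
qed

lemma group_PGL2: "group (PGL2 :: 'a::field pgl monoid)"
  unfolding PGL2_def by (rule normal.factorgroup_is_group[OF normal_scalars])

lemma in_proj: "B \<in> proj A \<longleftrightarrow> (\<exists>k\<noteq>0. B = mat k ** A)"
  unfolding proj_def r_coset_def scalars_def by auto

lemma carrier_PGL2: "carrier PGL2 = proj ` {A :: 'a::field^2^2. invertible A}"
  unfolding PGL2_def FactGroup_def RCOSETS_def proj_def by auto

lemma proj_closed: "invertible A \<Longrightarrow> proj A \<in> carrier PGL2"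
  unfolding carrier_PGL2 by blast

lemma proj_mult: "invertible A \<Longrightarrow> invertible B \<Longrightarrow> proj A \<otimes>\<^bsub>PGL2\<^esub> proj B = proj (A ** B)"
  for A B :: "'a::field^2^2"
  unfolding PGL2_def FactGroup_def proj_def
  using normal.rcos_sum[OF normal_scalars, of A B] by simp

lemma proj_one: "\<one>\<^bsub>PGL2\<^esub> = proj (mat 1 :: 'a::field^2^2)"
proof -
  interpret group "GL2 :: ('a^2^2) monoid" by (rule group_GL2)
  have "scalars #>\<^bsub>GL2\<^esub> (mat 1) = (scalars :: ('a^2^2) set)"
    using coset_mult_one[of scalars] normal_imp_subgroup[OF normal_scalars] subgroup.subset by fastforce
  then show ?thesis by (simp add: PGL2_def FactGroup_def proj_def)
qed

lemma proj_inv: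
  fixes A :: "'a::field^2^2"
  assumes "invertible A"
  shows "inv\<^bsub>PGL2\<^esub> (proj A) = proj (matrix_inv A)"
proof -
  interpret group "PGL2 :: 'a pgl monoid" by (rule group_PGL2)
  show ?thesis
    using assms invertible_inv[OF assms] by (intro inv_equality) (auto simp: proj_mult proj_one proj_closed)
qed

lemma proj_scalar: "k \<noteq> 0 \<Longrightarrow> proj (mat k ** A) = proj A" for A :: "'a::field^2^2"
proof -
  assume k: "k \<noteq> 0"
  have *: "mat l ** (mat k ** A) = mat (l * k) ** A" for l k :: 'a
    by (cases A rule: M2_cases) (simp add: mat_M2 algebra_simps)
  show ?thesis
  proof (intro equalityI subsetI)
    fix B assume "B \<in> proj (mat k ** A)"
    then show "B \<in> proj A" using k unfolding in_proj * by (metis mult_eq_0_iff)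
  next
    fix B assume "B \<in> proj A"
    then obtain l where "l \<noteq> 0" "B = mat l ** A" unfolding in_proj by blast
    then have "l / k \<noteq> 0" "B = mat (l / k * k) ** A" using k by auto
    then show "B \<in> proj (mat k ** A)" unfolding in_proj * by blast
  qed
qed

section \<open>Vertices of the tree as cosets\<close>

text \<open>The lattice \<open>o \<oplus> o\<close>. A vertex is the class of a translate of it by some \<open>A\<close>, so that vertices are
  the cosets of \<open>GL(2,F)\<close> by the scalars times \<open>GL(2,o)\<close>.\<close>

definition std_lattice :: "('a::nonarch_local_field^2) set" where
  "std_lattice = {v. nv (v$1) \<le> 1 \<and> nv (v$2) \<le> 1}"

definition vtx :: "'a::nonarch_local_field^2^2 \<Rightarrow> 'a vertex" where
  "vtx A = homothety_class ((*v) A ` std_lattice)"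

abbreviation mact :: "'a::nonarch_local_field^2^2 \<Rightarrow> 'a vertex \<Rightarrow> 'a vertex" where
  "mact A \<equiv> act_vertex (proj A)"

lemma mat_mult_vec: "mat k *v v = k *s v" for v :: "'a::field^2"
  by (simp add: vec_eq_iff forall_2 mat_M2 M2_mult_vec)

lemma scale_image: "(\<lambda>v. k *s v) ` ((*v) A ` L) = (*v) (mat k ** A) ` L" for A :: "'a::field^2^2"
  by (simp add: image_image mat_mult_vec[symmetric] matrix_vector_mul_assoc)

lemma in_vtx: "L \<in> vtx A \<longleftrightarrow> (\<exists>k\<noteq>0. L = (*v) (mat k ** A) ` std_lattice)"
  unfolding vtx_def homothety_class_def scale_image by auto

lemma mact_vtx: "mact A (vtx B) = vtx (A ** B)"
proof -
  have *: "(*v) (mat k ** A) ` ((*v) (mat l ** B) ` std_lattice) = (*v) (mat (k * l) ** (A ** B)) ` std_lattice" for k l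
  proof -
    have "(mat k ** A) ** (mat l ** B) = mat (k * l) ** (A ** B)"
      by (cases A rule: M2_cases, cases B rule: M2_cases) (simp add: mat_M2 algebra_simps)
    then show ?thesis by (simp add: image_image matrix_vector_mul_assoc)
  qed
  show ?thesis
  proof (intro equalityI subsetI)
    fix L assume "L \<in> mact A (vtx B)"
    then obtain k l where "k \<noteq> 0" "l \<noteq> 0" "L = (*v) (mat k ** A) ` ((*v) (mat l ** B) ` std_lattice)"
      unfolding act_vertex_def in_proj in_vtx by auto
    then show "L \<in> vtx (A ** B)" unfolding * in_vtx by (metis mult_eq_0_iff)
  next
    fix L assume "L \<in> vtx (A ** B)"
    then obtain k where k: "k \<noteq> 0" "L = (*v) (mat k ** (A ** B)) ` std_lattice" unfolding in_vtx by blast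
    then have "L = (*v) (mat k ** A) ` ((*v) (mat 1 ** B) ` std_lattice)" unfolding * by simp
    moreover have "(*v) (mat 1 ** B) ` std_lattice \<in> vtx B" unfolding in_vtx by (metis one_neq_zero)
    moreover have "mat k ** A \<in> proj A" unfolding in_proj using k by blast
    ultimately show "L \<in> mact A (vtx B)" unfolding act_vertex_def by blast
  qed
qed

definition integral_GL2 :: "('a::nonarch_local_field^2^2) set" where
  "integral_GL2 = {A. (\<forall>i j. nv (A$i$j) \<le> 1) \<and> nv (det A) = 1}"

lemma M2_integral: "M2 a b c d \<in> integral_GL2 \<longleftrightarrow>
    nv a \<le> 1 \<and> nv b \<le> 1 \<and> nv c \<le> 1 \<and> nv d \<le> 1 \<and> nv (a * d - b * c) = 1"
  by (auto simp: integral_GL2_def forall_2 det_2)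

lemma std_lattice_integral:
  assumes "A \<in> integral_GL2"
  shows "(*v) A ` std_lattice = std_lattice"
proof -
  obtain a b c d where A: "A = M2 a b c d" by (rule M2_cases)
  have e: "nv a \<le> 1" "nv b \<le> 1" "nv c \<le> 1" "nv d \<le> 1" "nv (a * d - b * c) = 1"
    using assms unfolding A M2_integral by auto
  have sub: "(*v) (M2 a b c d) ` std_lattice \<subseteq> std_lattice"
    if "nv a \<le> 1" "nv b \<le> 1" "nv c \<le> 1" "nv d \<le> 1" for a b c d :: 'a
    using that by (auto simp: std_lattice_def M2_mult_vec intro!: nv_add_le nv_mult_le1)
  define D where "D = a * d - b * c"
  have D: "D \<noteq> 0" "nv (inverse D) = 1" using e by (auto simp: D_def nv_inverse)
  define B where "B = M2 (inverse D * d) (inverse D * (- b)) (inverse D * (- c)) (inverse D * a)"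
  have "A ** B = mat 1"
    using D(1) by (simp add: A B_def mat_M2 field_simps) (simp add: D_def algebra_simps)
  then have "std_lattice = (*v) A ` ((*v) B ` std_lattice)"
    by (simp add: image_image matrix_vector_mul_assoc)
  also have "\<dots> \<subseteq> (*v) A ` std_lattice"
    unfolding B_def by (intro image_mono sub) (simp_all add: nv_mult D e)
  finally show ?thesis using sub[of a b c d] e unfolding A by blast
qed

lemma vtx_eqI:
  assumes "k \<noteq> 0" "C \<in> integral_GL2" "A = mat k ** (B ** C)"
  shows "vtx A = vtx B"
proof -
  have "(*v) (mat l ** A) ` std_lattice = (*v) (mat (l * k) ** B) ` std_lattice" for l
  proof -
    have "mat l ** A = (mat (l * k) ** B) ** C"
      unfolding assms(3) by (cases B rule: M2_cases, cases C rule: M2_cases) (simp add: mat_M2 algebra_simps)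
    then have "(*v) (mat l ** A) ` std_lattice = (*v) (mat (l * k) ** B) ` ((*v) C ` std_lattice)"
      by (simp add: image_image matrix_vector_mul_assoc)
    then show ?thesis by (simp add: std_lattice_integral[OF assms(2)])
  qed
  note * = this
  show ?thesis
  proof (intro equalityI subsetI)
    fix L assume "L \<in> vtx A"
    then show "L \<in> vtx B" unfolding in_vtx * using assms(1) by (metis mult_eq_0_iff)
  next
    fix L assume "L \<in> vtx B"
    then obtain l where "l \<noteq> 0" "L = (*v) (mat l ** B) ` std_lattice" unfolding in_vtx by blast
    then have "l / k \<noteq> 0" "L = (*v) (mat (l / k * k) ** B) ` std_lattice" using assms(1) by auto
    then show "L \<in> vtx A" unfolding in_vtx * by blast
  qed
qed

lemma integral_entries:
  assumes "(*v) (M2 a b c d) ` std_lattice \<subseteq> std_lattice"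
  shows "nv a \<le> 1 \<and> nv b \<le> 1 \<and> nv c \<le> 1 \<and> nv d \<le> 1"
proof -
  have "M2 a b c d *v axis 1 1 \<in> std_lattice" "M2 a b c d *v axis 2 1 \<in> std_lattice"
    using assms by (auto simp: std_lattice_def axis_def image_subset_iff)
  then show ?thesis by (simp add: std_lattice_def M2_mult_vec axis_def)
qed

text \<open>If the lattices of \<open>A\<close> and \<open>B\<close> are homothetic, some \<open>C\<close> maps the standard lattice onto itself; the
  entries of \<open>C\<close> and of its inverse are then integral, and the two determinants, whose product is
  \<open>1\<close>, are units.\<close>

lemma vtx_eqD:
  assumes eq: "vtx A = vtx B" and B: "invertible B" and A: "invertible A"
  obtains k C where "k \<noteq> 0" "C \<in> integral_GL2" "A = mat k ** (B ** C)"
proof -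
  have "(*v) (mat 1 ** A) ` std_lattice \<in> vtx A" unfolding in_vtx by (metis one_neq_zero)
  then obtain k where k: "k \<noteq> 0" "(*v) A ` std_lattice = (*v) (mat k ** B) ` std_lattice"
    unfolding eq in_vtx by auto
  define C where "C = matrix_inv (mat k ** B) ** A"
  have kB: "invertible (mat k ** B)" using k B invertible_mat invertible_mult by blast
  have Ceq: "A = mat k ** (B ** C)"
    unfolding C_def matrix_mul_assoc using invertible_inv[OF kB] by (simp add: matrix_mul_assoc)
  have Cinv: "invertible C" unfolding C_def using invertible_inv[OF kB] A invertible_mult by blast
  have "(*v) C ` std_lattice = (*v) (matrix_inv (mat k ** B)) ` ((*v) (mat k ** B) ` std_lattice)"
    unfolding k(2)[symmetric] by (simp add: C_def image_image matrix_vector_mul_assoc)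
  also have "\<dots> = std_lattice" by (simp add: image_image matrix_vector_mul_assoc invertible_inv[OF kB])
  finally have CO: "(*v) C ` std_lattice = std_lattice" .
  have "(*v) (matrix_inv C) ` std_lattice = (*v) (matrix_inv C) ` ((*v) C ` std_lattice)" by (simp add: CO)
  also have "\<dots> = std_lattice" by (simp add: image_image matrix_vector_mul_assoc invertible_inv[OF Cinv])
  finally have CO': "(*v) (matrix_inv C) ` std_lattice = std_lattice" .
  obtain a b c d where C: "C = M2 a b c d" by (rule M2_cases)
  obtain a' b' c' d' where C': "matrix_inv C = M2 a' b' c' d'" by (rule M2_cases)
  have e: "nv a \<le> 1 \<and> nv b \<le> 1 \<and> nv c \<le> 1 \<and> nv d \<le> 1"
    using CO unfolding C by (intro integral_entries) simp
  have e': "nv a' \<le> 1 \<and> nv b' \<le> 1 \<and> nv c' \<le> 1 \<and> nv d' \<le> 1"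
    using CO' unfolding C' by (intro integral_entries) simp
  have "det C * det (matrix_inv C) = 1" by (metis det_mul det_I invertible_inv(3)[OF Cinv])
  then have 1: "nv (a * d - b * c) * nv (a' * d' - b' * c') = 1"
    unfolding C' unfolding C det_2 M2_nth by (metis nv_mult nv_1)
  have "nv (a * d - b * c) \<le> 1" "nv (a' * d' - b' * c') \<le> 1"
    using e e' by (auto intro!: nv_diff_le nv_mult_le1)
  then have "nv (a * d - b * c) = 1"
    using 1 mult_left_le[of "nv (a' * d' - b' * c')" "nv (a * d - b * c)"] by force
  then have "C \<in> integral_GL2" using e unfolding C M2_integral by simp
  then show thesis using that k(1) Ceq by blast
qed

subsection \<open>The given vertices and adjacency in these terms\<close>

definition cols :: "'a::field^2 \<Rightarrow> 'a^2 \<Rightarrow> 'a^2^2" where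
  "cols e f = M2 (e$1) (f$1) (e$2) (f$2)"

lemma cols_mult_vec: "cols e f *v v = v$1 *s e + v$2 *s f"
  by (simp add: cols_def vec_eq_iff forall_2 M2_mult_vec mult.commute)

lemma basis2_iff: "basis2 e f \<longleftrightarrow> invertible (cols e f)"
proof -
  have columns: "columns (cols e f) = {e, f}"
  proof -
    have "column 1 (cols e f) = e" "column 2 (cols e f) = f"
      by (simp_all add: column_def cols_def vec_eq_iff forall_2)
    moreover have "columns A = {column 1 A, column 2 A}" for A :: "'a^2^2"
      unfolding columns_def by (auto intro: exI[of _ 1] exI[of _ 2]) (metis exhaust_2)
    ultimately show ?thesis by simp
  qed
  have span: "invertible (cols e f) \<longleftrightarrow> vec.span {e, f} = UNIV"
    unfolding columns[symmetric] matrix_right_invertible_span_columns[symmetric]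
    by (rule invertible_right_inverse)
  show ?thesis
  proof
    assume "basis2 e f"
    then show "invertible (cols e f)" unfolding span basis2_def by blast
  next
    assume inv: "invertible (cols e f)"
    then have ne: "e \<noteq> f" by (auto simp: cols_def invertible_M2)
    have "vec.independent {e, f}"
      by (rule vec.card_le_dim_spanning[of _ UNIV]) (use inv ne in \<open>auto simp: span vec.dim_UNIV card_cart_basis\<close>)
    then show "basis2 e f" unfolding basis2_def using ne inv span by blast
  qed
qed

lemma lattice_sum_cols: "lattice_sum I e J f = (*v) (cols e f) ` {v. v$1 \<in> I \<and> v$2 \<in> J}"
proof (intro equalityI subsetI)
  fix x assume "x \<in> lattice_sum I e J f"
  then obtain a b where "x = a *s e + b *s f" "a \<in> I" "b \<in> J" unfolding lattice_sum_def by blast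
  then show "x \<in> (*v) (cols e f) ` {v. v$1 \<in> I \<and> v$2 \<in> J}"
    by (intro image_eqI[of _ _ "vector [a, b]"]) (auto simp: cols_mult_vec)
qed (auto simp: lattice_sum_def cols_mult_vec)

lemma cols_surj: "\<exists>e f. A = cols e f"
  by (rule exI[of _ "vector [A$1$1, A$2$1]"], rule exI[of _ "vector [A$1$2, A$2$2]"])
    (simp add: cols_def M2_eta[symmetric])

lemma vertices_vtx: "vertices = vtx ` {A :: 'a::nonarch_local_field^2^2. invertible A}"
proof -
  have "{v :: 'a^2. v$1 \<in> valuation_ring \<and> v$2 \<in> valuation_ring} = std_lattice"
    by (simp add: valuation_ring_def std_lattice_def)
  then have "full_lattice L \<longleftrightarrow> (\<exists>A. invertible A \<and> L = (*v) A ` std_lattice)" for L :: "('a^2) set"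
    unfolding full_lattice_def basis2_iff lattice_sum_cols using cols_surj by metis
  then show ?thesis unfolding vertices_def vtx_def by auto
qed

text \<open>\<open>diag(1, uniformizer\<^sup>j)\<close>, which translates the standard apartment by \<open>j\<close>; the vertices of the
  apartment are those called \<open>s\<^sub>j = [o \<oplus> p\<^sup>j]\<close> in the literature.\<close>

definition dg :: "int \<Rightarrow> 'a::nonarch_local_field^2^2" where
  "dg j = M2 1 0 0 (uniformizer powi j)"

definition apt_vertex :: "int \<Rightarrow> 'a::nonarch_local_field vertex" where
  "apt_vertex j = vtx (dg j)"

declare uniformizer(1) [simp]

lemma invertible_dg [simp]: "invertible (dg j)"
  by (simp add: dg_def invertible_M2)

lemma dg_mult: "dg i ** dg j = (dg (i + j) :: 'a::nonarch_local_field^2^2)"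
  by (simp add: dg_def power_int_add uniformizer(1)[where ?'a = 'a])

lemma ideal_lattice:
  "{v :: 'a::nonarch_local_field^2. v$1 \<in> valuation_ring \<and> v$2 \<in> maximal_ideal} = (*v) (dg 1) ` std_lattice"
proof (intro equalityI subsetI)
  fix v :: "'a^2" assume "v \<in> {v. v$1 \<in> valuation_ring \<and> v$2 \<in> maximal_ideal}"
  then have v: "nv (v$1) \<le> 1" "nv (v$2) < 1" by (auto simp: valuation_ring_def maximal_ideal_def)
  have "nv (v$2 / uniformizer) \<le> 1"
    using uniformizer(3)[OF v(2)] nv_unif[where ?'a = 'a] by (simp add: nv_divide)
  then show "v \<in> (*v) (dg 1) ` std_lattice"
    using v uniformizer(1)[where ?'a = 'a]
    by (intro image_eqI[of _ _ "vector [v$1, v$2 / uniformizer]"])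
      (auto simp: std_lattice_def dg_def vec_eq_iff forall_2 M2_mult_vec)
next
  fix v :: "'a^2" assume "v \<in> (*v) (dg 1) ` std_lattice"
  then obtain u :: "'a^2" where u: "nv (u$1) \<le> 1" "nv (u$2) \<le> 1" "v = dg 1 *v u" by (auto simp: std_lattice_def)
  have "nv (uniformizer :: 'a) * nv (u$2) < 1"
    using nv_unif[where ?'a = 'a] u(2) by (intro le_less_trans[OF mult_left_le]) auto
  then show "v \<in> {v. v$1 \<in> valuation_ring \<and> v$2 \<in> maximal_ideal}"
    using u by (simp add: valuation_ring_def maximal_ideal_def dg_def M2_mult_vec nv_mult)
qed

lemma lattice_sums_vtx:
  "homothety_class (lattice_sum valuation_ring e valuation_ring f) = vtx (cols e f)"
  "homothety_class (lattice_sum valuation_ring e maximal_ideal f) = vtx (cols e f ** dg 1)"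
proof -
  have "{v :: 'a^2. v$1 \<in> valuation_ring \<and> v$2 \<in> valuation_ring} = std_lattice"
    by (simp add: valuation_ring_def std_lattice_def)
  then show "homothety_class (lattice_sum valuation_ring e valuation_ring f) = vtx (cols e f)"
    unfolding lattice_sum_cols vtx_def by simp
  show "homothety_class (lattice_sum valuation_ring e maximal_ideal f) = vtx (cols e f ** dg 1)"
    unfolding lattice_sum_cols ideal_lattice vtx_def by (simp add: image_image matrix_vector_mul_assoc)
qed

lemma adjacent_vtx: "adjacent s t \<longleftrightarrow> (\<exists>A. invertible A \<and> s = vtx A \<and> t = vtx (A ** dg 1))"
  unfolding adjacent_def basis2_iff lattice_sums_vtx using cols_surj by metis

lemma cols_axis: "cols (axis 1 1) (axis 2 1) = (mat 1 :: 'a::field^2^2)"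
  by (simp add: cols_def axis_def mat_M2)

lemma dg_0: "dg 0 = mat 1"
  by (simp add: dg_def mat_M2)

lemma s0_apt: "s0 = apt_vertex 0"
  unfolding s0_def lattice_sums_vtx cols_axis apt_vertex_def dg_0 ..

lemma s1_apt: "s1 = apt_vertex 1"
  unfolding s1_def lattice_sums_vtx cols_axis apt_vertex_def by simp

section \<open>Oriented paths as translates of segments of the standard apartment\<close>

lemma mact_mult: "x \<in> vertices \<Longrightarrow> mact A (mact B x) = mact (A ** B) x"
  unfolding vertices_vtx by (auto simp: mact_vtx matrix_mul_assoc)

lemma mact_one: "x \<in> vertices \<Longrightarrow> mact (mat 1) x = x"
  unfolding vertices_vtx by (auto simp: mact_vtx)

lemma mact_vertices: "invertible A \<Longrightarrow> x \<in> vertices \<Longrightarrow> mact A x \<in> vertices"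
  unfolding vertices_vtx by (auto simp: mact_vtx invertible_mult)

lemma mact_inv:
  assumes "invertible A" "x \<in> vertices"
  shows "mact (matrix_inv A) (mact A x) = x" "mact A (mact (matrix_inv A) x) = x"
  using assms invertible_inv[OF assms(1)] by (simp_all add: mact_mult mact_one)

lemma mact_inj: "invertible A \<Longrightarrow> x \<in> vertices \<Longrightarrow> y \<in> vertices \<Longrightarrow> mact A x = mact A y \<longleftrightarrow> x = y"
  using mact_inv(1) by metis

lemma adjacent_vertices: "adjacent s t \<Longrightarrow> s \<in> vertices \<and> t \<in> vertices"
  unfolding adjacent_vtx vertices_vtx using invertible_mult invertible_dg by blast

lemma adjacent_mact: "invertible A \<Longrightarrow> adjacent s t \<Longrightarrow> adjacent (mact A s) (mact A t)"
  unfolding adjacent_vtx by (auto simp: mact_vtx matrix_mul_assoc) (metis invertible_mult matrix_mul_assoc)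

lemma apt_vertices [simp]: "apt_vertex j \<in> vertices"
  unfolding apt_vertex_def vertices_vtx by simp

lemma mact_dg: "mact (dg i) (apt_vertex j) = apt_vertex (i + j)"
  by (simp add: apt_vertex_def mact_vtx dg_mult)

lemma mact_apt_fix:
  assumes "nv a \<le> 1" "nv d \<le> 1" "nv (b * uniformizer powi j) \<le> 1" "nv (c * uniformizer powi (- j)) \<le> 1"
    and "nv (a * d - b * c) = 1"
  shows "mact (M2 a b c d) (apt_vertex j) = apt_vertex j"
  unfolding apt_vertex_def mact_vtx
proof (rule vtx_eqI[of 1])
  show "M2 a (b * uniformizer powi j) (c * uniformizer powi (- j)) d \<in> integral_GL2"
  proof -
    have "b * uniformizer powi j * (c * uniformizer powi (- j)) = b * c" by (simp add: power_int_minus)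
    then show ?thesis using assms by (simp only: M2_integral)
  qed
qed (simp_all add: dg_def mat_M2 power_int_minus)

lemma mact_antidiag:
  "mact (M2 0 1 (uniformizer powi e) 0) (apt_vertex j) = apt_vertex (e - j)"
  unfolding apt_vertex_def mact_vtx
proof (rule vtx_eqI[of "uniformizer powi j"])
  show "M2 0 1 1 0 \<in> integral_GL2" by (simp add: M2_integral)
qed (simp_all add: dg_def mat_M2 power_int_diff)

lemma apt_vertex_inj: "(apt_vertex i :: 'a::nonarch_local_field vertex) = apt_vertex j \<longleftrightarrow> i = j"
proof
  assume "(apt_vertex i :: 'a vertex) = apt_vertex j"
  then obtain k and C :: "'a^2^2" where kC: "k \<noteq> 0" "C \<in> integral_GL2" "dg i = mat k ** (dg j ** C)"
    unfolding apt_vertex_def by (metis vtx_eqD invertible_dg)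
  obtain a b c d where C: "C = M2 a b c d" by (rule M2_cases)
  have e: "k * a = 1" "k * b = 0" "k * (uniformizer powi j * c) = 0" "k * (uniformizer powi j * d) = uniformizer powi i"
    using kC(3) unfolding C dg_def mat_M2 by auto
  then have "b = 0" "c = 0" using kC(1) by auto
  then have "nv a \<le> 1" "nv d \<le> 1" "nv a * nv d = 1" using kC(2) unfolding C M2_integral by (auto simp: nv_mult)
  then have "nv a = 1" "nv d = 1"
    using mult_left_le[of "nv d" "nv a"] mult_left_le[of "nv a" "nv d"] by (auto simp: mult.commute)
  moreover have "nv k * nv a = 1" using e(1) by (metis nv_mult nv_1)
  ultimately have "nv k = 1" by simp
  have "nv k * (nv (uniformizer powi j :: 'a) * nv d) = nv (uniformizer powi i :: 'a)"
    unfolding e(4)[symmetric] by (simp add: nv_mult)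
  then have "nv (uniformizer :: 'a) powi j = nv (uniformizer :: 'a) powi i"
    using \<open>nv k = 1\<close> \<open>nv d = 1\<close> by (simp add: nv_power_int)
  then show "i = j"
    using power_int_strict_decreasing[of i j "nv (uniformizer :: 'a)"]
      power_int_strict_decreasing[of j i "nv (uniformizer :: 'a)"] nv_unif[where ?'a = 'a]
    by (metis less_irrefl not_less_iff_gr_or_eq)
qed simp

lemma stabilizer_s0:
  assumes "invertible A" "mact A (apt_vertex 0) = apt_vertex 0"
  obtains a b c d where "M2 a b c d \<in> integral_GL2" "proj A = proj (M2 a b c d)"
proof -
  have "vtx A = vtx (mat 1)" using assms(2) by (simp add: apt_vertex_def mact_vtx dg_0)
  then obtain k C where "k \<noteq> 0" "C \<in> integral_GL2" "A = mat k ** (mat 1 ** C)"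
    using vtx_eqD[of A "mat 1"] assms(1) invertible_mat[of 1] by auto
  then show thesis using that proj_scalar[of k C] by (cases C rule: M2_cases) auto
qed

lemma stabilizer_s0_s1:
  assumes "invertible A" "mact A (apt_vertex 0) = apt_vertex 0" "mact A (apt_vertex 1) = apt_vertex 1"
  obtains a b c d where "M2 a b c d \<in> integral_GL2" "proj A = proj (M2 a b c d)" "nv c < 1"
proof -
  obtain a b c d where M: "M2 a b c d \<in> integral_GL2" "proj A = proj (M2 a b c d)"
    using stabilizer_s0[OF assms(1,2)] by blast
  have inv: "invertible (M2 a b c d)" using M(1) by (auto simp: M2_integral invertible_M2)
  have "vtx (M2 a b c d ** dg 1) = vtx (dg 1)" using assms(3) M(2) by (simp add: apt_vertex_def mact_vtx)
  then obtain k C where kC: "k \<noteq> 0" "C \<in> integral_GL2" "M2 a b c d ** dg 1 = mat k ** (dg 1 ** C)"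
    using vtx_eqD[of "M2 a b c d ** dg 1" "dg 1"] inv invertible_mult by (metis invertible_dg)
  obtain a' b' c' d' where C: "C = M2 a' b' c' d'" by (rule M2_cases)
  have e: "a = k * a'" "b * uniformizer = k * b'" "c = k * (uniformizer * c')" "d * uniformizer = k * (uniformizer * d')"
    using kC(3) unfolding C dg_def mat_M2 by auto
  have e': "d = k * d'" using e(4) uniformizer(1) by (simp add: mult.left_commute) 
  have "(a * d - b * c) * uniformizer = k * k * (a' * d' - b' * c') * uniformizer"
    using e e' by (simp add: algebra_simps)
  then have "a * d - b * c = k * k * (a' * d' - b' * c')" using uniformizer(1) by simp
  then have "nv k * nv k = 1"
    using M(1) kC(2) unfolding C M2_integral by (metis nv_mult mult.right_neutral)
  then have "nv k = 1" using power2_eq_1_iff[of "nv k"] zero_le_dist[of k 0] by (simp add: power2_eq_square) 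
  then have "nv c = nv (uniformizer * c')" using e(3) by (simp add: nv_mult)
  also have "\<dots> < 1" using kC(2) nv_unif[where ?'a = 'a] unfolding C M2_integral nv_mult
    by (intro le_less_trans[OF mult_left_le]) auto
  finally show thesis using that M by blast
qed

text \<open>A neighbour of \<open>s0\<close> is given by the first column \<open>(a, c)\<close> of a matrix in \<open>GL(2,o)\<close>, up to scalars and
  modulo the maximal ideal. It is the neighbour at \<open>-1\<close> when \<open>a\<close> is no unit; in all other cases
  the column can be scaled to \<open>(1, c / a)\<close>.\<close>

lemma neighbour_0:
  assumes "adjacent (apt_vertex 0) z" "z \<noteq> apt_vertex (-1)"
  obtains \<gamma> where "nv \<gamma> \<le> 1" "z = mact (M2 1 0 \<gamma> 1) (apt_vertex 1)"
proof -
  obtain A where A: "invertible A" "apt_vertex 0 = vtx A" "z = vtx (A ** dg 1)"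
    using assms(1) unfolding adjacent_vtx by blast
  have "mact A (apt_vertex 0) = apt_vertex 0" 
    using A(2)[symmetric] by (simp only: apt_vertex_def mact_vtx dg_0 matrix_mul_rid)
  then obtain a b c d where M: "M2 a b c d \<in> integral_GL2" "proj A = proj (M2 a b c d)"
    using stabilizer_s0[OF A(1)] by blast
  have z: "z = vtx (M2 a b c d ** dg 1)"
    using A(3) M(2) mact_vtx[of A "dg 1"] mact_vtx[of "M2 a b c d" "dg 1"] by simp
  have e: "nv a \<le> 1" "nv b \<le> 1" "nv c \<le> 1" "nv d \<le> 1" "nv (a * d - b * c) = 1"
    using M(1) unfolding M2_integral by auto
  have "nv a = 1"
  proof (rule ccontr)
    assume "nv a \<noteq> 1"
    then have "nv (a / uniformizer) \<le> 1"
      using e(1) uniformizer(3)[of a] nv_unif[where ?'a = 'a] by (simp add: nv_divide)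
    moreover have "nv (d * uniformizer) \<le> 1" using e(4) nv_unif[where ?'a = 'a] by (intro nv_mult_le1) auto
    ultimately have "M2 (a / uniformizer) b c (d * uniformizer) \<in> integral_GL2"
      using e by (simp add: M2_integral)
    then have "z = apt_vertex (-1)"
      unfolding z apt_vertex_def by (rule vtx_eqI[of uniformizer, rotated]) (simp_all add: dg_def mat_M2 power_int_minus)
    then show False using assms(2) by blast
  qed
  define \<gamma> where "\<gamma> = c / a"
  have g: "nv \<gamma> \<le> 1" "\<gamma> * a = c" using e(3) \<open>nv a = 1\<close> unfolding \<gamma>_def by (auto simp: nv_divide)
  have "M2 a (b * uniformizer) 0 (d - \<gamma> * b) \<in> integral_GL2"
    using e g nv_unif[where ?'a = 'a] nv_mult_le1[OF g(1) e(2)]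
    unfolding M2_integral by (auto intro: nv_mult_le1 nv_diff_le simp: right_diff_distrib mult.assoc[symmetric] mult.commute[of a \<gamma>] mult.commute[of c b])
  then have "z = mact (M2 1 0 \<gamma> 1) (apt_vertex 1)"
    unfolding z apt_vertex_def mact_vtx
    by (rule vtx_eqI[of 1, rotated]) (use g in \<open>auto simp: dg_def mat_M2 algebra_simps\<close>)
  then show thesis using that g(1) by blast
qed

lemma neighbour:
  assumes "adjacent (apt_vertex j) z" "z \<noteq> apt_vertex (j - 1)"
  obtains \<gamma> where "nv \<gamma> \<le> nv (uniformizer powi j :: 'a)" "z = mact (M2 1 0 \<gamma> 1) (apt_vertex (j + 1) :: 'a::nonarch_local_field vertex)"
proof -
  have zv: "z \<in> vertices" using assms(1) adjacent_vertices by blast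
  define y where "y = mact (dg (- j)) z"
  have zy: "z = mact (dg j) y" unfolding y_def by (simp add: mact_mult zv dg_mult dg_0 mact_one)
  have "adjacent (apt_vertex 0) y"
    using adjacent_mact[OF invertible_dg assms(1), of "- j"] by (simp add: mact_dg y_def)
  moreover have "y \<noteq> apt_vertex (-1)" using assms(2) unfolding zy by (auto simp: mact_dg)
  ultimately obtain \<gamma> where g: "nv \<gamma> \<le> 1" "y = mact (M2 1 0 \<gamma> 1) (apt_vertex 1)" using neighbour_0 by blast
  have "M2 1 0 (\<gamma> * uniformizer powi j) 1 ** dg j = dg j ** M2 1 0 \<gamma> (1::'a)" by (simp add: dg_def mult.commute)
  then have "z = mact (M2 1 0 (\<gamma> * uniformizer powi j) 1) (mact (dg j) (apt_vertex 1))"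
    unfolding zy g(2) by (simp add: mact_mult)
  then have "z = mact (M2 1 0 (\<gamma> * uniformizer powi j) 1) (apt_vertex (j + 1))" by (simp add: mact_dg)
  moreover have "nv (\<gamma> * uniformizer powi j) \<le> nv (uniformizer powi j :: 'a)" using g(1) by (intro nv_mult_le_left) auto
  ultimately show thesis using that by blast
qed

definition apt_path :: "int \<Rightarrow> nat \<Rightarrow> 'a::nonarch_local_field vertex list" where
  "apt_path i n = map (\<lambda>k. apt_vertex (i + int k)) [0..<n]"

abbreviation lact :: "'a::nonarch_local_field^2^2 \<Rightarrow> 'a vertex list \<Rightarrow> 'a vertex list" where
  "lact A \<equiv> map (mact A)"

lemma apt_path_length [simp]: "length (apt_path i n) = n"
  by (simp add: apt_path_def)

lemma apt_path_nth [simp]: "k < n \<Longrightarrow> apt_path i n ! k = apt_vertex (i + int k)"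
  by (simp add: apt_path_def)

lemma apt_path_Suc: "apt_path i (Suc n) = apt_path i n @ [apt_vertex (i + int n)]"
  by (simp add: apt_path_def)

lemma set_apt_path: "set (apt_path i n) = apt_vertex ` {i..<i + int n}"
proof -
  have "(\<lambda>k. i + int k) ` {0..<n} = {i..<i + int n}"
  proof (intro equalityI subsetI)
    fix j assume "j \<in> {i..<i + int n}"
    then show "j \<in> (\<lambda>k. i + int k) ` {0..<n}" by (intro image_eqI[of _ _ "nat (j - i)"]) auto
  qed auto
  moreover have "set (apt_path i n) = apt_vertex ` ((\<lambda>k. i + int k) ` {0..<n})"
    unfolding apt_path_def by (simp add: image_image)
  ultimately show ?thesis by simp
qed

lemma lact_dg: "lact (dg i) (apt_path j n) = apt_path (i + j) n"
  by (simp add: apt_path_def mact_dg add.assoc)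

lemma lact_mult: "set x \<subseteq> vertices \<Longrightarrow> lact A (lact B x) = lact (A ** B) x"
  by (auto simp: mact_mult)

lemma lact_one: "set x \<subseteq> vertices \<Longrightarrow> lact (mat 1) x = x"
  by (induction x) (auto simp: mact_one)

lemma lact_vertices: "invertible A \<Longrightarrow> set x \<subseteq> vertices \<Longrightarrow> set (lact A x) \<subseteq> vertices"
  by (auto simp: mact_vertices)

lemma paths_lact:
  assumes "invertible A" "x \<in> paths r"
  shows "lact A x \<in> paths r"
proof -
  have v: "set x \<subseteq> vertices" "distinct x" "length x = Suc r" and adj: "\<And>i. i < r \<Longrightarrow> adjacent (x ! i) (x ! Suc i)"
    using assms(2) unfolding paths_def by auto
  have "inj_on (mact A) (set x)" using v mact_inj[OF assms(1)] by (meson inj_onI subsetD)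
  then show ?thesis
    using v adj lact_vertices[OF assms(1) v(1)] adjacent_mact[OF assms(1)]
    unfolding paths_def by (auto simp: distinct_map)
qed

lemma paths_snoc:
  assumes "x @ [z] \<in> paths (Suc r)"
  shows "x \<in> paths r" "adjacent (x ! r) z" "z \<notin> set x"
proof -
  have l: "length x = Suc r" and adj: "\<And>i. i < Suc r \<Longrightarrow> adjacent ((x @ [z]) ! i) ((x @ [z]) ! Suc i)"
    using assms unfolding paths_def by auto
  have "adjacent (x ! i) (x ! Suc i)" if "i < r" for i using adj[of i] that l by (simp add: nth_append)
  then show "x \<in> paths r" using assms l unfolding paths_def by auto
  show "adjacent (x ! r) z" using adj[of r] l by (simp add: nth_append)
  show "z \<notin> set x" using assms unfolding paths_def by auto
qed

text \<open>Once all but the last vertex have been moved into the apartment, a lower unipotent matrix fixing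
  these moves the last one.\<close>

lemma paths_transitive:
  assumes "x \<in> paths r"
  shows "\<exists>A. invertible A \<and> x = lact A (apt_path 0 (Suc r))"
  using assms
proof (induction r arbitrary: x)
  case 0
  then obtain v where v: "x = [v]" "v \<in> vertices" unfolding paths_def by (auto simp: length_Suc_conv)
  then obtain A where "invertible A" "v = vtx A" unfolding vertices_vtx by blast
  then show ?case using v by (intro exI[of _ A]) (auto simp: apt_path_def apt_vertex_def mact_vtx dg_0)
next
  case (Suc r)
  have "x \<noteq> []" using Suc.prems unfolding paths_def by auto
  then obtain xs z where x: "x = xs @ [z]" by (metis rev_exhaust)
  note xs = paths_snoc[OF Suc.prems[unfolded x]]
  obtain A where A: "invertible A" "xs = lact A (apt_path 0 (Suc r))" using Suc.IH[OF xs(1)] by blast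
  have zv: "z \<in> vertices" using xs(2) adjacent_vertices by blast
  define y where "y = mact (matrix_inv A) z"
  have zy: "z = mact A y" unfolding y_def using mact_inv[OF A(1) zv] by simp
  have yv: "y \<in> vertices" unfolding y_def using zv invertible_inv[OF A(1)] mact_vertices by blast
  have "xs ! r = mact A (apt_vertex (int r))" unfolding A(2) by simp
  then have "adjacent (apt_vertex (int r)) y"
    using adjacent_mact[OF invertible_inv(1)[OF A(1)] xs(2)] mact_inv[OF A(1) apt_vertices] by (simp add: y_def)
  moreover have "y \<notin> set (apt_path 0 (Suc r))"
    using xs(3) mact_inj[OF A(1) yv] unfolding zy A(2) by auto
  ultimately have "\<exists>B. invertible B \<and> y = mact B (apt_vertex (int r + 1)) \<and> (\<forall>i\<in>{0..int r}. mact B (apt_vertex i) = apt_vertex i)"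
  proof (cases "r = 0")
    case True
    assume "adjacent (apt_vertex (int r)) y"
    then obtain B where "invertible B" "apt_vertex 0 = vtx B" "y = vtx (B ** dg 1)"
      using True unfolding adjacent_vtx by auto
    note B = this
    have "mact B (apt_vertex 0) = apt_vertex 0" "mact B (apt_vertex 1) = y"
      using B(2)[symmetric] B(3) by (simp_all only: apt_vertex_def mact_vtx dg_0 matrix_mul_rid)
    then show ?thesis using True B(1) by (intro exI[of _ B]) auto
  next
    case False
    assume a: "adjacent (apt_vertex (int r)) y" "y \<notin> set (apt_path 0 (Suc r))"
    have "y \<noteq> apt_vertex (int r - 1)" using a(2) False unfolding set_apt_path by auto
    then obtain \<gamma> where g: "nv \<gamma> \<le> nv (uniformizer powi (int r) :: 'a)" "y = mact (M2 1 0 \<gamma> 1) (apt_vertex (int r + 1))"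
      using neighbour[OF a(1)] by blast
    have "mact (M2 1 0 \<gamma> 1) (apt_vertex i) = apt_vertex i" if "i \<in> {0..int r}" for i
    proof (rule mact_apt_fix)
      have "nv (\<gamma> * uniformizer powi (- i)) \<le> nv (uniformizer powi (int r) :: 'a) * nv (uniformizer powi (- i) :: 'a)"
        unfolding nv_mult using g(1) by (intro mult_right_mono) auto
      also have "\<dots> = nv (uniformizer :: 'a) powi (int r - i)"
        unfolding nv_power_int using nv_unif[where ?'a = 'a] by (subst power_int_add[symmetric]) auto
      also have "\<dots> \<le> 1"
        using that nv_unif[where ?'a = 'a] power_int_decreasing[of 0 "int r - i" "nv (uniformizer :: 'a)"] by simp
      finally show "nv (\<gamma> * uniformizer powi (- i)) \<le> 1" .
    qed auto
    then show ?thesis using g by (intro exI[of _ "M2 1 0 \<gamma> 1"]) (auto simp: invertible_M2)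
  qed
  then obtain B where B: "invertible B" "y = mact B (apt_vertex (int r + 1))" "\<And>i. i \<in> {0..int r} \<Longrightarrow> mact B (apt_vertex i) = apt_vertex i"
    by blast
  have "xs = lact (A ** B) (apt_path 0 (Suc r))"
    unfolding A(2) by (rule map_cong[OF refl]) (auto simp: set_apt_path B(3) mact_mult[symmetric])
  moreover have "z = mact (A ** B) (apt_vertex (int r + 1))" unfolding zy B(2) by (simp add: mact_mult)
  ultimately show ?case
    unfolding x using A(1) B(1) invertible_mult by (intro exI[of _ "A ** B"]) (simp add: apt_path_Suc[of 0 "Suc r"] add.commute)
qed

section \<open>The arcs of \<open>\<Sigma>\<^sub>k\<close>\<close>

text \<open>The base arc of level \<open>k\<close> is the segment of the apartment from \<open>- behind k\<close> to \<open>ahead k\<close>, which is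
  centred at \<open>s0\<close> for odd \<open>k\<close> and at the edge \<open>[s0, s1]\<close> for even \<open>k\<close>. The reflection of the
  apartment preserving it is \<open>j \<mapsto> parity_shift k - j\<close>.\<close>

definition behind :: "nat \<Rightarrow> int" where "behind k = int ((k + 1) div 2)"
definition ahead :: "nat \<Rightarrow> int" where "ahead k = int (k div 2 + 1)"
definition parity_shift :: "nat \<Rightarrow> int" where "parity_shift k = (if even k then 1 else 0)"

definition base_arc :: "nat \<Rightarrow> 'a::nonarch_local_field vertex list" where
  "base_arc k = apt_path (- behind k) (k + 2)"

definition rev_base_arc :: "nat \<Rightarrow> 'a::nonarch_local_field vertex list" where
  "rev_base_arc k = rev (base_arc k)"

text \<open>Matrices instead of their classes, so that computations can be made with entries.\<close>

definition stab :: "nat \<Rightarrow> ('a::nonarch_local_field^2^2) set" where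
  "stab k = {A. invertible A \<and> proj A \<in> K_parity k}"

abbreviation pw :: "int \<Rightarrow> 'a::nonarch_local_field" where
  "pw j \<equiv> uniformizer powi j"

lemma behind_ahead: "ahead k = behind k + parity_shift k" "behind k + ahead k = int k + 1" "0 \<le> behind k" "1 \<le> ahead k" "0 \<le> parity_shift k"
  unfolding behind_def ahead_def parity_shift_def by (auto elim!: evenE oddE)

lemma set_base_arc: "set (base_arc k) = apt_vertex ` {- behind k..ahead k}" "set (rev_base_arc k) = apt_vertex ` {- behind k..ahead k}"
proof -
  have "{- behind k..< - behind k + int (k + 2)} = {- behind k..ahead k}" using behind_ahead(2)[of k] by auto
  then show "set (base_arc k) = apt_vertex ` {- behind k..ahead k}" unfolding base_arc_def set_apt_path by simp
  then show "set (rev_base_arc k) = apt_vertex ` {- behind k..ahead k}" unfolding rev_base_arc_def by simp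
qed

lemma base_vertices: "set (base_arc k) \<subseteq> vertices" "set (rev_base_arc k) \<subseteq> vertices"
  by (auto simp: set_base_arc)

lemma pw_mono: "i \<le> j \<Longrightarrow> nv (pw j :: 'a) \<le> nv (pw i :: 'a::nonarch_local_field)"
  unfolding nv_power_int using nv_unif[where ?'a = 'a] by (intro power_int_decreasing) auto

lemma pw_le1: "0 \<le> j \<Longrightarrow> nv (pw j :: 'a::nonarch_local_field) \<le> 1"
  using pw_mono[of 0 j] by simp

lemma pw_mult: "nv (pw i :: 'a::nonarch_local_field) * nv (pw j :: 'a) = nv (pw (i + j) :: 'a)"
  by (simp add: nv_mult[symmetric] power_int_add)

lemma pw_pos: "0 < nv (pw j :: 'a::nonarch_local_field)"
  by simp

lemma nv_pw_mult:
  fixes x y :: "'a::nonarch_local_field"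
  shows "nv x \<le> nv (pw i :: 'a) \<Longrightarrow> nv y \<le> nv (pw j :: 'a) \<Longrightarrow> nv (x * y) \<le> nv (pw (i + j) :: 'a)"
  unfolding nv_mult pw_mult[symmetric] by (rule mult_mono) auto

subsection \<open>The stabilisers\<close>

lemma stab_odd: "odd k \<Longrightarrow> A \<in> stab k \<longleftrightarrow> invertible A \<and> mact A (apt_vertex 0) = apt_vertex 0"
  unfolding stab_def K_parity_def K0_def s0_apt using proj_closed by auto

lemma stab_even: "even k \<Longrightarrow> A \<in> stab k \<longleftrightarrow>
    invertible A \<and> {mact A (apt_vertex 0), mact A (apt_vertex 1)} = {apt_vertex 0, apt_vertex 1}"
  unfolding stab_def K_parity_def K1_def s0_apt s1_apt using proj_closed by auto

lemma stab_invertible: "A \<in> stab k \<Longrightarrow> invertible A"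
  by (simp add: stab_def)

lemma stab_mult:
  assumes "A \<in> stab k" "B \<in> stab k"
  shows "A ** B \<in> stab k"
proof (cases "even k")
  case True
  have "mact (A ** B) x = mact A (mact B x)" if "x \<in> {apt_vertex 0, apt_vertex 1}" for x
    using that by (auto simp: mact_mult)
  then show ?thesis using assms True unfolding stab_even[OF True] by (simp add: invertible_mult) (metis doubleton_eq_iff)
next
  case False
  then show ?thesis using assms by (simp add: stab_odd invertible_mult mact_mult[symmetric])
qed

lemma stab_inv:
  assumes "A \<in> stab k"
  shows "matrix_inv A \<in> stab k"
proof -
  have A: "invertible A" using assms stab_invertible by blast
  have i: "mact (matrix_inv A) (mact A (apt_vertex j)) = apt_vertex j" for j using mact_inv[OF A] by simp
  show ?thesis
  proof (cases "even k")
    case True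
    have "{mact A (apt_vertex 0), mact A (apt_vertex 1)} = {apt_vertex 0, apt_vertex 1}"
      using assms stab_even[OF True] by blast
    then have "{mact (matrix_inv A) (apt_vertex 0), mact (matrix_inv A) (apt_vertex 1)} = {apt_vertex 0, apt_vertex 1}"
      using i[of 0] i[of 1] unfolding doubleton_eq_iff by metis
    then show ?thesis using invertible_inv(1)[OF A] unfolding stab_even[OF True] by blast
  next
    case False
    have "mact A (apt_vertex 0) = apt_vertex 0" using assms False by (simp add: stab_odd)
    then have "mact (matrix_inv A) (apt_vertex 0) = apt_vertex 0" using i[of 0] by metis
    then show ?thesis using invertible_inv(1)[OF A] False by (simp add: stab_odd)
  qed
qed

lemma stab_fix:
  assumes "invertible A" "mact A (apt_vertex 0) = apt_vertex 0" "even k \<Longrightarrow> mact A (apt_vertex 1) = apt_vertex 1"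
  shows "A \<in> stab k"
  using assms by (cases "even k") (auto simp: stab_odd stab_even)

lemma K_parity_stab: "g \<in> K_parity k \<longleftrightarrow> (\<exists>A\<in>stab k. g = proj A)"
proof -
  have "K_parity k \<subseteq> carrier (PGL2 :: 'a pgl monoid)" unfolding K_parity_def K0_def K1_def by auto
  then show ?thesis unfolding stab_def carrier_PGL2 by blast
qed

definition flip :: "nat \<Rightarrow> 'a::nonarch_local_field^2^2" where
  "flip k = M2 0 1 (pw (parity_shift k)) 0"

lemma invertible_flip: "invertible (flip k)"
  by (simp add: flip_def invertible_M2)

lemma mact_flip: "mact (flip k) (apt_vertex j) = apt_vertex (parity_shift k - j)"
  unfolding flip_def by (rule mact_antidiag)

lemma flip_stab: "flip k \<in> stab k"
  by (cases "even k") (auto simp: stab_even stab_odd mact_flip invertible_flip parity_shift_def)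

lemma flip_flip: "set x \<subseteq> vertices \<Longrightarrow> lact (flip k) (lact (flip k) x) = x"
proof -
  assume x: "set x \<subseteq> vertices"
  have "flip k ** flip k = (mat (pw (parity_shift k)) ** mat 1 :: 'a^2^2)" by (simp add: flip_def mat_M2)
  then have "proj (flip k ** flip k) = (proj (mat 1) :: 'a pgl)" using proj_scalar[of "pw (parity_shift k)" "mat 1"] by simp
  then show ?thesis unfolding lact_mult[OF x] using lact_one[OF x] by simp
qed

lemma rbase_apt: "rev_base_arc k = map (\<lambda>i. apt_vertex (ahead k - int i)) [0..<k + 2]"
  unfolding rev_base_arc_def base_arc_def apt_path_def
proof (rule nth_equalityI, simp)
  fix i assume "i < length (rev (map (\<lambda>i. apt_vertex (- behind k + int i)) [0..<k + 2]))"
  then show "rev (map (\<lambda>i. apt_vertex (- behind k + int i)) [0..<k + 2]) ! i = map (\<lambda>i. apt_vertex (ahead k - int i)) [0..<k + 2] ! i"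
    using behind_ahead(2)[of k] by (auto simp: rev_nth simp del: upt_Suc intro!: arg_cong[of _ _ apt_vertex])
qed

lemma lact_flip_base: "lact (flip k) (base_arc k) = rev_base_arc k" "lact (flip k) (rev_base_arc k) = base_arc k"
proof -
  show *: "lact (flip k) (base_arc k) = rev_base_arc k"
    unfolding rbase_apt base_arc_def apt_path_def using behind_ahead(1)[of k]
    by (simp add: mact_flip del: upt_Suc) (auto intro!: arg_cong[of _ _ apt_vertex])
  show "lact (flip k) (rev_base_arc k) = base_arc k" unfolding *[symmetric] by (rule flip_flip[OF base_vertices(1)])
qed

lemma base_fix:
  fixes a b c d :: "'a::nonarch_local_field"
  assumes "nv a \<le> 1" "nv d \<le> 1" "nv b \<le> nv (pw (behind k) :: 'a)" "nv c \<le> nv (pw (ahead k) :: 'a)" "nv (a * d - b * c) = 1"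
  shows "lact (M2 a b c d) (base_arc k) = base_arc k" "lact (M2 a b c d) (rev_base_arc k) = rev_base_arc k"
proof -
  have "mact (M2 a b c d) (apt_vertex j) = apt_vertex j" if "j \<in> {- behind k..ahead k}" for j
  proof (rule mact_apt_fix)
    show "nv (b * pw j) \<le> 1"
      using order_trans[OF nv_pw_mult[OF assms(3) order_refl[of "nv (pw j :: 'a)"]] pw_le1] that by simp
    show "nv (c * pw (- j)) \<le> 1"
      using order_trans[OF nv_pw_mult[OF assms(4) order_refl[of "nv (pw (- j) :: 'a)"]] pw_le1] that by simp
  qed (use assms in auto)
  then show "lact (M2 a b c d) (base_arc k) = base_arc k" "lact (M2 a b c d) (rev_base_arc k) = rev_base_arc k"
    by (intro map_idI; auto simp: set_base_arc)+
qed

text \<open>The product of the inverse of one matrix with the other one has its off-diagonal entries in the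
  ideals of \<open>base_fix\<close>.\<close>

lemma base_congruent:
  fixes a1 b1 c1 d1 a2 b2 c2 d2 :: "'a::nonarch_local_field"
  assumes 1: "nv a1 \<le> 1" "nv b1 \<le> 1" "nv c1 \<le> 1" "nv d1 \<le> 1" "nv (a1 * d1 - b1 * c1) = 1"
    and 2: "nv a2 \<le> 1" "nv b2 \<le> 1" "nv c2 \<le> 1" "nv d2 \<le> 1" "nv (a2 * d2 - b2 * c2) = 1"
    and b: "nv (d1 * b2 - b1 * d2) \<le> nv (pw (behind k) :: 'a)"
    and c: "nv (a1 * c2 - c1 * a2) \<le> nv (pw (ahead k) :: 'a)"
  shows "lact (M2 a2 b2 c2 d2) (base_arc k) = lact (M2 a1 b1 c1 d1) (base_arc k)"
    "lact (M2 a2 b2 c2 d2) (rev_base_arc k) = lact (M2 a1 b1 c1 d1) (rev_base_arc k)"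
proof -
  define D where "D = a1 * d1 - b1 * c1"
  have D: "D \<noteq> 0" "nv D = 1" using 1 unfolding D_def by auto
  define N where "N = M2 ((d1 * a2 - b1 * c2) / D) ((d1 * b2 - b1 * d2) / D) ((a1 * c2 - c1 * a2) / D) ((a1 * d2 - c1 * b2) / D)"
  have "M2 a1 b1 c1 d1 ** N = M2 a2 b2 c2 d2"
  proof -
    have "a1 * (d1 * a2 - b1 * c2) + b1 * (a1 * c2 - c1 * a2) = a2 * D"
      "a1 * (d1 * b2 - b1 * d2) + b1 * (a1 * d2 - c1 * b2) = b2 * D"
      "c1 * (d1 * a2 - b1 * c2) + d1 * (a1 * c2 - c1 * a2) = c2 * D"
      "c1 * (d1 * b2 - b1 * d2) + d1 * (a1 * d2 - c1 * b2) = d2 * D"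
      unfolding D_def by (simp_all add: algebra_simps)
    then show ?thesis
      unfolding N_def using D(1) by (simp add: add_divide_distrib[symmetric])
  qed
  moreover have "lact N (base_arc k) = base_arc k" "lact N (rev_base_arc k) = rev_base_arc k"
  proof -
    have n: "nv ((d1 * a2 - b1 * c2) / D) \<le> 1" "nv ((a1 * d2 - c1 * b2) / D) \<le> 1"
      unfolding nv_divide D using 1 2 by (auto intro!: nv_diff_le nv_mult_le1)
    have n': "nv ((d1 * b2 - b1 * d2) / D) \<le> nv (pw (behind k) :: 'a)" "nv ((a1 * c2 - c1 * a2) / D) \<le> nv (pw (ahead k) :: 'a)"
      unfolding nv_divide D using b c by auto
    have "(d1 * a2 - b1 * c2) * (a1 * d2 - c1 * b2) - (d1 * b2 - b1 * d2) * (a1 * c2 - c1 * a2) = D * (a2 * d2 - b2 * c2)"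
      unfolding D_def by (simp add: algebra_simps)
    then have "(d1 * a2 - b1 * c2) / D * ((a1 * d2 - c1 * b2) / D) - (d1 * b2 - b1 * d2) / D * ((a1 * c2 - c1 * a2) / D)
        = (a2 * d2 - b2 * c2) / D"
      using D(1) by (simp add: diff_divide_distrib[symmetric])
    then have "nv ((d1 * a2 - b1 * c2) / D * ((a1 * d2 - c1 * b2) / D) - (d1 * b2 - b1 * d2) / D * ((a1 * c2 - c1 * a2) / D)) = 1"
      using D 2 by (simp add: nv_divide)
    from base_fix[OF n n' this] show "lact N (base_arc k) = base_arc k" "lact N (rev_base_arc k) = rev_base_arc k"
      unfolding N_def by auto
  qed
  ultimately show "lact (M2 a2 b2 c2 d2) (base_arc k) = lact (M2 a1 b1 c1 d1) (base_arc k)"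
    "lact (M2 a2 b2 c2 d2) (rev_base_arc k) = lact (M2 a1 b1 c1 d1) (rev_base_arc k)"
    using lact_mult[OF base_vertices(1), of "M2 a1 b1 c1 d1" N k] lact_mult[OF base_vertices(2), of "M2 a1 b1 c1 d1" N k]
    by simp_all
qed

subsection \<open>Arcs as translates of the base arc\<close>

abbreviation Arcs :: "nat \<Rightarrow> 'a::nonarch_local_field vertex list set" where
  "Arcs k \<equiv> arcs (Sigma_graph k)"

lemma Arcs_iff: "x \<in> Arcs k \<longleftrightarrow> x \<in> paths (Suc k) \<and>
    (if even k then {x ! nat (behind k), x ! Suc (nat (behind k))} \<subseteq> {apt_vertex 0, apt_vertex 1} else x ! nat (behind k) = apt_vertex 0)"
proof -
  have "middle x = (if even k then {x ! nat (behind k), x ! Suc (nat (behind k))} else {x ! nat (behind k)})" if "length x = Suc (Suc k)"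
    proof -
    have "nat (behind k) = (k + 1) div 2" "length x - 1 = k + 1" using that by (simp_all add: behind_def nat_int del: of_nat_Suc)
    then show ?thesis unfolding middle_def Let_def by (cases "even k") simp_all
  qed
  moreover have "x \<in> paths (Suc k) \<Longrightarrow> length x = Suc (Suc k)" unfolding paths_def by simp
  ultimately have m: "x \<in> paths (Suc k) \<Longrightarrow> middle x = (if even k then {x ! nat (behind k), x ! Suc (nat (behind k))} else {x ! nat (behind k)})"
    by blast
  have "x \<in> Arcs k \<longleftrightarrow> x \<in> paths (Suc k) \<and> (if even k then middle x \<subseteq> {apt_vertex 0, apt_vertex 1} else apt_vertex 0 \<in> middle x)"
    unfolding Sigma_graph_def Let_def s0_apt s1_apt by simp
  then show ?thesis using m by (cases "x \<in> paths (Suc k)") (simp_all add: eq_commute[of _ "x ! nat (behind k)"])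
qed

lemma base_nth: "base_arc k ! nat (behind k) = apt_vertex 0" "even k \<Longrightarrow> base_arc k ! Suc (nat (behind k)) = apt_vertex 1"
  "nat (behind k) < k + 2" "Suc (nat (behind k)) < k + 2"
proof -
  show l: "nat (behind k) < k + 2" "Suc (nat (behind k)) < k + 2" using behind_ahead[of k] by auto
  then show "base_arc k ! nat (behind k) = apt_vertex 0" "even k \<Longrightarrow> base_arc k ! Suc (nat (behind k)) = apt_vertex 1"
    unfolding base_arc_def using behind_ahead(3)[of k] by auto
qed

lemma length_base_arc [simp]: "length (base_arc k) = k + 2" "length (rev_base_arc k) = k + 2"
  by (simp_all add: base_arc_def rev_base_arc_def)

lemma Arcs_vertices: "x \<in> Arcs k \<Longrightarrow> set x \<subseteq> vertices"
  unfolding Arcs_iff paths_def by auto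

lemma Arcs_lact:
  assumes "A \<in> stab k" "x \<in> Arcs k"
  shows "lact A x \<in> Arcs k"
proof -
  have p: "x \<in> paths (Suc k)" "length x = k + 2" using assms(2) unfolding Arcs_iff paths_def by auto
  have q: "lact A x \<in> paths (Suc k)" using paths_lact[OF stab_invertible[OF assms(1)] p(1)] .
  have n: "lact A x ! nat (behind k) = mact A (x ! nat (behind k))" "lact A x ! Suc (nat (behind k)) = mact A (x ! Suc (nat (behind k)))"
    using base_nth(3,4)[of k] p(2) by simp_all
  show ?thesis
  proof (cases "even k")
    case True
    have "{mact A (apt_vertex 0), mact A (apt_vertex 1)} = {apt_vertex 0, apt_vertex 1}"
      using assms(1) stab_even[OF True] by blast
    then have "mact A v \<in> {apt_vertex 0, apt_vertex 1}" if "v \<in> {apt_vertex 0, apt_vertex 1}" for v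
      using that by blast
    moreover have "{x ! nat (behind k), x ! Suc (nat (behind k))} \<subseteq> {apt_vertex 0, apt_vertex 1}"
      using assms(2) True unfolding Arcs_iff by simp
    ultimately show ?thesis using q n True unfolding Arcs_iff by simp
  next
    case False
    have "mact A (apt_vertex 0) = apt_vertex 0" using assms(1) False by (simp add: stab_odd)
    then show ?thesis using assms(2) q n False unfolding Arcs_iff by simp
  qed
qed

lemma Arcs_transitive:
  fixes x :: "'a::nonarch_local_field vertex list"
  assumes "x \<in> Arcs k"
  obtains A where "A \<in> stab k" "x = lact A (base_arc k)"
proof -
  have p: "x \<in> paths (Suc k)" using assms unfolding Arcs_iff by auto
  obtain A where A: "invertible A" "x = lact A (apt_path 0 (k + 2))" using paths_transitive[OF p] by auto
  define B where "B = A ** dg (behind k)"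
  have B: "invertible B" unfolding B_def using A(1) invertible_mult invertible_dg by blast
  have "apt_path 0 (k + 2) = (lact (dg (behind k)) (base_arc k) :: 'a vertex list)" unfolding base_arc_def lact_dg by simp
  then have x: "x = lact B (base_arc k)" unfolding A(2) B_def by (simp only: lact_mult[OF base_vertices(1)])
  have n: "x ! nat (behind k) = mact B (apt_vertex 0)" "even k \<Longrightarrow> x ! Suc (nat (behind k)) = mact B (apt_vertex 1)"
    unfolding x using base_nth(3,4)[of k] by (simp_all add: base_nth(1,2))
  have "B \<in> stab k"
  proof (cases "even k")
    case True
    have "mact B (apt_vertex 0) \<noteq> mact B (apt_vertex 1)" by (simp add: mact_inj[OF B] apt_vertex_inj)
    then show ?thesis using assms n B True unfolding Arcs_iff stab_even[OF True] by auto
  next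
    case False
    then show ?thesis using assms n B unfolding Arcs_iff by (simp add: stab_odd)
  qed
  then show thesis using that x by blast
qed

lemma base_Arcs: "(x :: 'a::nonarch_local_field vertex list) \<in> Arcs k \<Longrightarrow> base_arc k \<in> (Arcs k :: 'a vertex list set)"
proof -
  assume x: "x \<in> (Arcs k :: 'a vertex list set)"
  then obtain A where A: "A \<in> stab k" "x = lact A (base_arc k)" by (rule Arcs_transitive)
  have "lact (matrix_inv A) x = base_arc k"
    unfolding A(2) using invertible_inv[OF stab_invertible[OF A(1)]]
    by (simp only: lact_mult[OF base_vertices(1)] lact_one[OF base_vertices(1)])
  then show ?thesis using Arcs_lact[OF stab_inv[OF A(1)] x] by simp
qed

text \<open>Coordinates on the two cells of arcs. For even \<open>k\<close> the entry \<open>s\<close> lies in the maximal ideal, as the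
  Iwahori subgroup requires.\<close>

definition in_chart :: "nat \<Rightarrow> 'a::nonarch_local_field \<Rightarrow> 'a \<Rightarrow> bool" where
  "in_chart k s t \<longleftrightarrow> nv t \<le> 1 \<and> nv s \<le> nv (pw (parity_shift k) :: 'a) \<and> nv (1 - s * t) = 1"

abbreviation chart :: "'a::nonarch_local_field \<Rightarrow> 'a \<Rightarrow> 'a^2^2" where
  "chart s t \<equiv> M2 1 t s 1"

lemma in_chartD:
  fixes s t :: "'a::nonarch_local_field"
  assumes "in_chart k s t"
  shows "nv t \<le> 1" "nv s \<le> 1" "nv (1 - s * t) = 1" "nv (1 - t * s) = 1" "1 - s * t \<noteq> 0" "nv s \<le> nv (pw (parity_shift k) :: 'a)"
  using assms pw_le1[OF behind_ahead(5), where ?'a = 'a] unfolding in_chart_def by (auto simp: mult.commute intro: order_trans)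

lemma chart_stab:
  fixes s t :: "'a::nonarch_local_field"
  assumes "in_chart k s t"
  shows "chart s t \<in> stab k"
proof (rule stab_fix)
  note d = in_chartD[OF assms]
  show "invertible (chart s t)" using d(5) by (simp add: invertible_M2 mult.commute)
  show "mact (chart s t) (apt_vertex 0) = apt_vertex 0" by (rule mact_apt_fix) (use d in auto)
  show "mact (chart s t) (apt_vertex 1) = apt_vertex 1" if "even k"
  proof (rule mact_apt_fix)
    show "nv (t * pw 1) \<le> 1" using d(1) pw_le1[of 1] by (intro nv_mult_le1) auto
    show "nv (s * pw (- 1)) \<le> 1"
      using nv_pw_mult[OF d(6) order_refl[of "nv (pw (- 1) :: 'a)"]] that by (simp add: parity_shift_def)
  qed (use d in auto)
qed

lemma diag_stab:
  assumes "nv a = 1" "nv d = 1"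
  shows "M2 a 0 0 d \<in> stab k"
  proof (rule stab_fix)
  show "invertible (M2 a 0 0 d)" using assms by (auto simp: invertible_M2)
qed (rule mact_apt_fix; use assms in \<open>simp add: nv_mult\<close>)+

lemma diag_base:
  assumes "nv a = 1" "nv d = 1"
  shows "lact (M2 a 0 0 d) (base_arc k) = base_arc k" "lact (M2 a 0 0 d) (rev_base_arc k) = rev_base_arc k"
  by (rule base_fix; use assms in \<open>simp add: nv_mult\<close>)+

lemma chart_diag:
  fixes a b c d :: "'a::nonarch_local_field"
  assumes "nv a = 1" "nv d = 1" "nv b \<le> 1" "nv c \<le> nv (pw (parity_shift k) :: 'a)" "nv (a * d - b * c) = 1"
  shows "in_chart k (c / a) (b / d)" "M2 a b c d = chart (c / a) (b / d) ** M2 a 0 0 d"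
proof -
  have nz: "a \<noteq> 0" "d \<noteq> 0" using assms by auto
  then have "1 - c / a * (b / d) = (a * d - b * c) / (a * d)" by (simp add: field_simps)
  then show "in_chart k (c / a) (b / d)" using assms unfolding in_chart_def by (simp add: nv_divide nv_mult)
  show "M2 a b c d = chart (c / a) (b / d) ** M2 a 0 0 d" using nz by simp
qed

text \<open>An element of \<open>GL(2,o)\<close> has a diagonal or an antidiagonal consisting of units, and in the Iwahori
  subgroup it is always the diagonal. This is the Bruhat decomposition into two cells.\<close>

lemma stab_decomposition:
  assumes "A \<in> stab k"
  obtains s t where "in_chart k s t"
    "lact A (base_arc k) = lact (chart s t) (base_arc k) \<or> lact A (base_arc k) = lact (chart s t) (rev_base_arc k)"
proof (cases "even k")
  case False
  have A: "invertible A" "mact A (apt_vertex 0) = apt_vertex 0" using assms False by (auto simp: stab_odd)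
  obtain a b c d where M: "M2 a b c d \<in> integral_GL2" "proj A = proj (M2 a b c d)" using stabilizer_s0[OF A] by blast
  have e: "nv a \<le> 1" "nv b \<le> 1" "nv c \<le> 1" "nv d \<le> 1" "nv (a * d - b * c) = 1"
    using M(1) unfolding M2_integral by auto
  have parity_shift: "parity_shift k = 0" using False by (simp add: parity_shift_def)
  show thesis
  proof (cases "nv a = 1 \<and> nv d = 1")
    case True
    then have ad: "nv a = 1" "nv d = 1" by blast+
    have C: "in_chart k (c / a) (b / d)" "M2 a b c d = chart (c / a) (b / d) ** M2 a 0 0 d"
      using chart_diag[OF ad e(2) _ e(5), of k] e(3) by (simp_all add: parity_shift)
    have "lact A (base_arc k) = lact (chart (c / a) (b / d) ** M2 a 0 0 d) (base_arc k)" using M(2) C(2) by simp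
    also have "\<dots> = lact (chart (c / a) (b / d)) (lact (M2 a 0 0 d) (base_arc k))" by (simp only: lact_mult[OF base_vertices(1)])
    also have "\<dots> = lact (chart (c / a) (b / d)) (base_arc k)" by (simp only: diag_base[OF ad])
    finally have "lact A (base_arc k) = lact (chart (c / a) (b / d)) (base_arc k)" .
    then show thesis using that C(1) by blast
  next
    case False
    have "nv (a * d) \<noteq> 1" using False nv_mult_eq_1[OF e(1,4)] by blast
    then have ad: "nv (a * d) < 1" using nv_mult_le1[OF e(1,4)] by linarith
    have "nv (b * c) = 1"
      using e(5) nv_diff_le[of "a * d" "max (nv (a * d)) (nv (b * c))" "b * c"] ad nv_mult_le1[OF e(2,3)] by auto
    then have bc: "nv b = 1" "nv c = 1" using nv_mult_eq_1[OF e(2,3)] by blast+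
    have "nv (b * c - a * d) = 1" using e(5) nv_diff_commute by metis
    then have C: "in_chart k (d / b) (a / c)" "M2 b a d c = chart (d / b) (a / c) ** M2 b 0 0 c"
      using chart_diag[of b c a d k] bc e parity_shift by auto
    have "M2 a b c d = M2 b a d c ** flip k" by (simp add: flip_def parity_shift)
    then have "lact A (base_arc k) = lact (M2 b a d c ** flip k) (base_arc k)" using M(2) by simp
    also have "\<dots> = lact (M2 b a d c) (lact (flip k) (base_arc k))" by (simp only: lact_mult[OF base_vertices(1)])
    also have "\<dots> = lact (M2 b a d c) (rev_base_arc k)" by (simp only: lact_flip_base)
    also have "\<dots> = lact (chart (d / b) (a / c)) (rev_base_arc k)"
      unfolding C(2) using lact_mult[OF base_vertices(2), of "chart (d / b) (a / c)" "M2 b 0 0 c" k] diag_base(2)[OF bc] by simp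
    finally have "lact A (base_arc k) = lact (chart (d / b) (a / c)) (rev_base_arc k)" .
    then show thesis using that C(1) by blast
  qed
next
  case True
  have parity_shift: "parity_shift k = 1" using True by (simp add: parity_shift_def)
  have fixing: "\<exists>s t u v. in_chart k s t \<and> nv u = 1 \<and> nv v = 1 \<and> proj B = proj (chart s t ** M2 u 0 0 v)"
    if B: "invertible B" "mact B (apt_vertex 0) = apt_vertex 0" "mact B (apt_vertex 1) = apt_vertex 1" for B :: "'a^2^2"
  proof -
    obtain a b c d where M: "M2 a b c d \<in> integral_GL2" "proj B = proj (M2 a b c d)" "nv c < 1" using stabilizer_s0_s1[OF B] by blast
    have e: "nv a \<le> 1" "nv b \<le> 1" "nv c \<le> 1" "nv d \<le> 1" "nv (a * d - b * c) = 1"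
      using M(1) unfolding M2_integral by auto
    have bc: "nv (b * c) < 1" using M(3) nv_mult_le1[OF e(2,3)] nv_mult_eq_1[OF e(2,3)] by linarith
    have "nv (a * d) = 1"
      using e(5) nv_diff_le[of "a * d" "max (nv (a * d)) (nv (b * c))" "b * c"] bc nv_mult_le1[OF e(1,4)] by auto
    then have ad: "nv a = 1" "nv d = 1" using nv_mult_eq_1[OF e(1,4)] by blast+
    have "nv c \<le> nv (pw (parity_shift k) :: 'a)" using uniformizer(3)[OF M(3)] by (simp add: parity_shift)
    then have "in_chart k (c / a) (b / d)" "M2 a b c d = chart (c / a) (b / d) ** M2 a 0 0 d"
      using chart_diag[OF ad e(2) _ e(5)] by blast+
    then show ?thesis using ad M(2) by metis
  qed
  have A: "invertible A" "{mact A (apt_vertex 0), mact A (apt_vertex 1)} = {apt_vertex 0, apt_vertex 1}"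
    using assms True by (auto simp: stab_even)
  show thesis
  proof (cases "mact A (apt_vertex 0) = apt_vertex 0")
    case True
    then have "mact A (apt_vertex 1) = apt_vertex 1" using A(2) by (auto simp: doubleton_eq_iff apt_vertex_inj)
    then obtain s t u v where st: "in_chart k s t" "nv u = 1" "nv v = 1" "proj A = proj (chart s t ** M2 u 0 0 v)"
      using fixing[OF A(1) True] by blast
    then have "lact A (base_arc k) = lact (chart s t) (base_arc k)"
      using lact_mult[OF base_vertices(1), of "chart s t" "M2 u 0 0 v" k] diag_base(1)[OF st(2,3), of k] by simp
    then show thesis using that st(1) by blast
  next
    case False
    then have sw: "mact A (apt_vertex 0) = apt_vertex 1" "mact A (apt_vertex 1) = apt_vertex 0"
      using A(2) by (auto simp: doubleton_eq_iff)
    have "mact (A ** flip k) (apt_vertex 0) = apt_vertex 0" "mact (A ** flip k) (apt_vertex 1) = apt_vertex 1"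
      by (simp_all add: mact_mult[symmetric] mact_flip parity_shift sw)
    then obtain s t u v where st: "in_chart k s t" "nv u = 1" "nv v = 1" "proj (A ** flip k) = proj (chart s t ** M2 u 0 0 v)"
      using fixing[of "A ** flip k"] A(1) invertible_flip invertible_mult by blast
    have "lact A (base_arc k) = lact A (lact (flip k) (rev_base_arc k))" by (simp only: lact_flip_base)
    also have "\<dots> = lact (A ** flip k) (rev_base_arc k)" by (simp only: lact_mult[OF base_vertices(2)])
    also have "\<dots> = lact (chart s t) (rev_base_arc k)"
      using st(4) lact_mult[OF base_vertices(2), of "chart s t" "M2 u 0 0 v" k] diag_base(2)[OF st(2,3), of k] by simp
    finally have "lact A (base_arc k) = lact (chart s t) (rev_base_arc k)" .
    then show thesis using that st(1) by blast
  qed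
qed

lemma Arcs_cases:
  assumes "x \<in> Arcs k"
  obtains s t where "in_chart k s t" "x = lact (chart s t) (base_arc k) \<or> x = lact (chart s t) (rev_base_arc k)"
  using assms Arcs_transitive stab_decomposition by metis

lemma finite_Arcs: "finite (Arcs k :: 'a::nonarch_local_field vertex list set)"
proof -
  obtain R :: "'a set" where R: "finite R" "R \<subseteq> valuation_ring"
    "\<And>x. x \<in> valuation_ring \<Longrightarrow> \<exists>y\<in>R. nv (x - y) \<le> nv (pw (ahead k) :: 'a)"
    using finite_residues[OF pw_pos[of "ahead k"]] by blast
  let ?F = "\<lambda>(s, t). {lact (chart s t) (base_arc k), lact (chart s t) (rev_base_arc k)}"
  have "Arcs k \<subseteq> \<Union> (?F ` (R \<times> R))"
  proof
    fix x :: "'a vertex list" assume "x \<in> Arcs k"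
    then obtain s t where st: "in_chart k s t" "x = lact (chart s t) (base_arc k) \<or> x = lact (chart s t) (rev_base_arc k)"
      by (rule Arcs_cases)
    note d = in_chartD[OF st(1)]
    obtain s' t' where R': "s' \<in> R" "t' \<in> R" "nv (s - s') \<le> nv (pw (ahead k) :: 'a)" "nv (t - t') \<le> nv (pw (ahead k) :: 'a)"
      using R(3)[of s] R(3)[of t] d(1,2) unfolding valuation_ring_def by blast
    have e: "nv s' \<le> 1" "nv t' \<le> 1" using R(2) R'(1,2) by (auto simp: valuation_ring_def)
    have "nv (s * t - s' * t') \<le> nv (pw (ahead k) :: 'a)"
    proof -
      have "s * t - s' * t' = (s - s') * t + s' * (t - t')" by (simp add: algebra_simps)
      then show ?thesis using nv_add_le[OF nv_mult_le_right[OF R'(3) d(1)] nv_mult_le_left[OF e(1) R'(4)]] by simp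
    qed
    also have "\<dots> < 1" using pw_mono[OF behind_ahead(4)[of k], where ?'a = 'a] nv_unif[where ?'a = 'a] by simp
    finally have "nv (1 - s * t + (s * t - s' * t')) = 1" using nv_add_eq[of "s * t - s' * t'" "1 - s * t"] d(3) by simp
    then have u: "nv (1 - t' * s') = 1" by (simp add: mult.commute)
    have "nv (t - t') \<le> nv (pw (behind k) :: 'a)"
      using order_trans[OF R'(4) pw_mono[of "behind k" "ahead k"]] behind_ahead[of k] by simp
    then have tt: "nv (1 * t - t' * 1) \<le> nv (pw (behind k) :: 'a)" by simp
    have ss: "nv (1 * s - s' * 1) \<le> nv (pw (ahead k) :: 'a)" using R'(3) by simp
    have det: "nv (1 * 1 - t' * s') = 1" "nv (1 * 1 - t * s) = 1" using u d(4) by simp_all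
    have "lact (chart s t) (base_arc k) = lact (chart s' t') (base_arc k)" "lact (chart s t) (rev_base_arc k) = lact (chart s' t') (rev_base_arc k)"
      by (rule base_congruent[OF _ e(2,1) _ det(1) _ d(1,2) _ det(2) tt ss]; simp)+
    then have "x = lact (chart s' t') (base_arc k) \<or> x = lact (chart s' t') (rev_base_arc k)"
      using st(2) by (simp only:)
    then have "x \<in> ?F (s', t')" unfolding case_prod_conv by blast
    moreover have "(s', t') \<in> R \<times> R" using R'(1,2) by simp
    ultimately show "x \<in> \<Union> (?F ` (R \<times> R))" by (rule UN_I[rotated])
  qed
  moreover have "finite (\<Union> (?F ` (R \<times> R)))" using R(1) by auto
  ultimately show ?thesis by (rule finite_subset)
qed

subsection \<open>Fibres of the tail map and the reversal involution\<close>

text \<open>Arcs with the same tail differ in their last vertex only. The extensions of a segment of the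
  apartment by a vertex form one orbit of lower unipotent matrices fixing the segment, by
  \<open>neighbour\<close>; the segment must have an edge, which excludes \<open>k = 0\<close>.\<close>

lemma tail_fibre:
  fixes y :: "'a::nonarch_local_field vertex list"
  assumes A: "A \<in> stab k" and y: "y \<in> Arcs k" "butlast y = butlast (lact A (base_arc k))" and k: "k \<ge> 1"
  obtains \<gamma> where "nv \<gamma> \<le> nv (pw (ahead k - 1) :: 'a)" "y = lact (A ** M2 1 0 \<gamma> 1) (base_arc k)"
proof -
  have Ai: "invertible A" using A stab_invertible by blast
  define x where "x = lact (matrix_inv A) y"
  have yx: "y = lact A x"
    unfolding x_def using invertible_inv[OF Ai] by (simp only: lact_mult[OF Arcs_vertices[OF y(1)]] lact_one[OF Arcs_vertices[OF y(1)]])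
  have xA: "x \<in> Arcs k" unfolding x_def by (rule Arcs_lact[OF stab_inv[OF A] y(1)])
  have Ab: "lact (matrix_inv A) (lact A (base_arc k)) = base_arc k"
    using invertible_inv[OF Ai] by (simp only: lact_mult[OF base_vertices(1)] lact_one[OF base_vertices(1)])
  have "butlast x = lact (matrix_inv A) (butlast (lact A (base_arc k)))"
    unfolding x_def y(2)[symmetric] by (simp only: map_butlast)
  also have "\<dots> = butlast (base_arc k)" by (simp only: map_butlast Ab)
  also have b: "base_arc k = apt_path (- behind k) (Suc k) @ [apt_vertex (ahead k)]"
    using behind_ahead(2)[of k] by (simp add: base_arc_def apt_path_Suc algebra_simps del: apt_path_length)
      (auto intro!: arg_cong[of _ _ apt_vertex] simp: apt_path_Suc[symmetric])
  finally have bx: "butlast x = apt_path (- behind k) (Suc k)" by simp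
  have xp: "x \<in> paths (Suc k)" using xA Arcs_iff by blast
  then have "x \<noteq> []" unfolding paths_def by auto
  then have x: "x = apt_path (- behind k) (Suc k) @ [last x]" using append_butlast_last_id[of x] bx by simp
  have "apt_path (- behind k) (Suc k) @ [last x] \<in> paths (Suc k)" using xp x by simp
  note px = paths_snoc[OF this]
  have h: "- behind k + int k = ahead k - 1" using behind_ahead(2)[of k] by simp
  have adj: "adjacent (apt_vertex (ahead k - 1)) (last x)" using px(2) h by simp
  have "last x \<noteq> apt_vertex (ahead k - 1 - 1)"
  proof
    assume "last x = apt_vertex (ahead k - 1 - 1)"
    moreover have "ahead k - 1 - 1 \<in> {- behind k..< - behind k + int (Suc k)}" using behind_ahead(2)[of k] k by auto
    ultimately show False using px(3) unfolding set_apt_path by blast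
  qed
  then obtain \<gamma> where g: "nv \<gamma> \<le> nv (pw (ahead k - 1) :: 'a)" "last x = mact (M2 1 0 \<gamma> 1) (apt_vertex (ahead k))"
    using neighbour[OF adj] by (metis diff_add_cancel)
  have "mact (M2 1 0 \<gamma> 1) (apt_vertex j) = apt_vertex j" if "j \<in> {- behind k..< - behind k + int (Suc k)}" for j
  proof (rule mact_apt_fix)
    have "nv (\<gamma> * pw (- j)) \<le> nv (pw (ahead k - 1 + (- j)) :: 'a)" by (rule nv_pw_mult[OF g(1) order_refl])
    also have "\<dots> \<le> 1" using that h by (intro pw_le1) auto
    finally show "nv (\<gamma> * pw (- j)) \<le> 1" .
  qed auto
  then have "lact (M2 1 0 \<gamma> 1) (apt_path (- behind k) (Suc k)) = apt_path (- behind k) (Suc k)"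
    by (intro map_idI) (auto simp: set_apt_path)
  then have "x = lact (M2 1 0 \<gamma> 1) (base_arc k)" using x g(2) unfolding b by simp
  then have "y = lact (A ** M2 1 0 \<gamma> 1) (base_arc k)" unfolding yx by (simp only: lact_mult[OF base_vertices(1)])
  then show thesis using that g(1) by blast
qed

text \<open>Conjugation by the reflection turns lower unipotent matrices into upper unipotent ones.\<close>

lemma tail_fibre_rbase:
  fixes y :: "'a::nonarch_local_field vertex list"
  assumes A: "A \<in> stab k" and y: "y \<in> Arcs k" "butlast y = butlast (lact A (rev_base_arc k))" and k: "k \<ge> 1"
  obtains u where "nv u \<le> nv (pw (behind k - 1) :: 'a)" "y = lact (A ** M2 1 u 0 1) (rev_base_arc k)"
proof -
  have "lact A (rev_base_arc k) = lact (A ** flip k) (base_arc k)"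
    by (simp only: lact_mult[OF base_vertices(1), symmetric] lact_flip_base)
  then obtain \<gamma> where g: "nv \<gamma> \<le> nv (pw (ahead k - 1) :: 'a)" "y = lact (A ** flip k ** M2 1 0 \<gamma> 1) (base_arc k)"
    using tail_fibre[OF stab_mult[OF A flip_stab] y(1) _ k] y(2) by metis
  define u where "u = \<gamma> / pw (parity_shift k)"
  have "flip k ** M2 1 0 \<gamma> 1 = M2 1 u 0 1 ** flip k" by (simp add: flip_def u_def)
  then have "y = lact (A ** M2 1 u 0 1 ** flip k) (base_arc k)" unfolding g(2) by (simp only: matrix_mul_assoc[symmetric])
  also have "\<dots> = lact (A ** M2 1 u 0 1) (rev_base_arc k)"
    by (simp only: lact_mult[OF base_vertices(1), symmetric] lact_flip_base)
  finally have "y = lact (A ** M2 1 u 0 1) (rev_base_arc k)" .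
  moreover have "nv u \<le> nv (pw (behind k - 1) :: 'a)"
  proof -
    have "ahead k - 1 + - parity_shift k = behind k - 1" using behind_ahead(1)[of k] by simp
    moreover have "u = \<gamma> * pw (- parity_shift k)" by (simp add: u_def power_int_minus divide_inverse)
    ultimately show ?thesis using nv_pw_mult[OF g(1) order_refl[of "nv (pw (- parity_shift k) :: 'a)"]] by (simp only:)
  qed
  ultimately show thesis using that by blast
qed

text \<open>The involution \<open>\<iota>\<close>: traverse the path backwards and reflect it. It preserves the base arc and
  interchanges tails and heads, hence the two harmonicity conditions.\<close>

definition invol :: "nat \<Rightarrow> 'a::nonarch_local_field vertex list \<Rightarrow> 'a vertex list" where
  "invol k x = lact (flip k) (rev x)"

lemma invol_base: "invol k (base_arc k) = base_arc k" "invol k (rev_base_arc k) = rev_base_arc k"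
proof -
  show "invol k (base_arc k) = base_arc k" unfolding invol_def rev_base_arc_def[symmetric] by (rule lact_flip_base)
  show "invol k (rev_base_arc k) = rev_base_arc k" unfolding invol_def rev_base_arc_def rev_rev_ident unfolding rev_base_arc_def[symmetric]
    by (rule lact_flip_base)
qed

lemma invol_invol: "set x \<subseteq> vertices \<Longrightarrow> invol k (invol k x) = x"
  unfolding invol_def by (simp only: rev_map[symmetric] rev_rev_ident flip_flip)

lemma invol_lact:
  assumes "set x \<subseteq> vertices"
  shows "invol k (lact A x) = lact (flip k ** A ** flip k) (invol k x)"
proof -
  have r: "set (rev x) \<subseteq> vertices" using assms by simp
  have "rev x = lact (flip k) (invol k x)" unfolding invol_def by (simp only: flip_flip[OF r])
  moreover have "set (invol k x) \<subseteq> vertices" unfolding invol_def by (rule lact_vertices[OF invertible_flip r])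
  moreover have "invol k (lact A x) = lact (flip k ** A) (rev x)"
    unfolding invol_def by (simp only: rev_map lact_mult[OF r])
  ultimately show ?thesis by (simp only: lact_mult)
qed

lemma invol_Arcs: "x \<in> Arcs k \<Longrightarrow> invol k x \<in> Arcs k"
proof -
  assume x: "x \<in> Arcs k"
  then obtain A where A: "A \<in> stab k" "x = lact A (base_arc k)" by (rule Arcs_transitive)
  show ?thesis
    unfolding A(2) invol_lact[OF base_vertices(1)] invol_base
    by (intro Arcs_lact stab_mult flip_stab A base_Arcs[OF x])
qed

lemma invol_tl: "tl (invol k x) = lact (flip k) (rev (butlast x))"
  unfolding invol_def by (simp add: map_tl[symmetric] butlast_rev[symmetric]) (metis butlast_rev rev_rev_ident)

lemma invol_fibre:
  fixes x y :: "'a::nonarch_local_field vertex list"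
  assumes "x \<in> Arcs k" "y \<in> Arcs k"
  shows "tl (invol k x) = tl (invol k y) \<longleftrightarrow> butlast x = butlast y"
proof
  assume "tl (invol k x) = tl (invol k y)"
  then have "lact (flip k) (lact (flip k) (rev (butlast x))) = lact (flip k) (lact (flip k) (rev (butlast y)))"
    unfolding invol_tl by simp
  moreover have v: "set (rev (butlast z)) \<subseteq> vertices" if "z \<in> Arcs k" for z :: "'a vertex list"
    using Arcs_vertices[OF that] by (auto dest: in_set_butlastD)
  ultimately have "rev (butlast x) = rev (butlast y)" by (simp only: flip_flip[OF v[OF assms(1)]] flip_flip[OF v[OF assms(2)]])
  then show "butlast x = butlast y" by simp
qed (simp add: invol_tl)

lemma chart_rbase_invol:
  fixes s t :: "'a::nonarch_local_field"
  shows "invol k (lact (chart s t) (rev_base_arc k)) = lact (chart (t * pw (parity_shift k)) (s / pw (parity_shift k))) (rev_base_arc k)"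
proof -
  have "flip k ** chart s t ** flip k = mat (pw (parity_shift k)) ** chart (t * pw (parity_shift k)) (s / pw (parity_shift k))"
    by (simp add: flip_def mat_M2)
  then have "proj (flip k ** chart s t ** flip k) = proj (chart (t * pw (parity_shift k)) (s / pw (parity_shift k)))"
    using proj_scalar[of "pw (parity_shift k)"] by simp
  then show ?thesis unfolding invol_lact[OF base_vertices(2)] invol_base by simp
qed

lemma diag_conj_flip:
  fixes a d :: "'a::nonarch_local_field"
  shows "proj (flip k ** M2 a 0 0 d ** flip k) = proj (M2 d 0 0 a)"
proof -
  have "flip k ** M2 a 0 0 d ** flip k = mat (pw (parity_shift k)) ** M2 d 0 0 a"
    by (simp add: flip_def mat_M2)
  then show ?thesis using proj_scalar[of "pw (parity_shift k)"] by simp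
qed

section \<open>Symmetry of harmonic kernels\<close>

text \<open>At level \<open>0\<close> an arc \<open>[s, t]\<close> and its opposite share their vertices, and orthogonality to the
  coboundaries gives no condition at a single tail or head.\<close>

definition harmonic :: "nat \<Rightarrow> ('a::nonarch_local_field vertex list \<Rightarrow> complex) \<Rightarrow> bool" where
  "harmonic k f \<longleftrightarrow> (k \<ge> 1 \<longrightarrow> (\<forall>x\<in>Arcs k. (\<Sum>y\<in>{y\<in>Arcs k. butlast y = butlast x}. f y) = 0 \<and>
     (\<Sum>y\<in>{y\<in>Arcs k. tl y = tl x}. f y) = 0))"

lemma harmonic_invol:
  fixes f :: "'a::nonarch_local_field vertex list \<Rightarrow> complex"
  assumes "harmonic k f" "k \<ge> 1" "x \<in> Arcs k"
  shows "(\<Sum>y\<in>{y\<in>Arcs k. butlast y = butlast x}. f (invol k y)) = 0"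
proof -
  have inv: "invol k (invol k y) = y" if "y \<in> Arcs k" for y :: "'a vertex list"
    by (rule invol_invol[OF Arcs_vertices[OF that]])
  have "(\<Sum>y\<in>{y\<in>Arcs k. butlast y = butlast x}. f (invol k y)) = (\<Sum>y\<in>{y\<in>Arcs k. tl y = tl (invol k x)}. f y)"
  proof (rule sum.reindex_bij_witness[of _ "invol k" "invol k"])
    fix y assume "y \<in> {y\<in>Arcs k. tl y = tl (invol k x)}"
    then have y: "y \<in> Arcs k" "tl y = tl (invol k x)" by auto
    then have "tl (invol k (invol k y)) = tl (invol k x)" by (simp only: inv[OF y(1)])
    then show "invol k y \<in> {y\<in>Arcs k. butlast y = butlast x}"
      using invol_fibre[OF invol_Arcs[OF y(1)] assms(3)] invol_Arcs[OF y(1)] by blast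
    show "invol k (invol k y) = y" by (rule inv[OF y(1)])
  next
    fix y assume "y \<in> {y\<in>Arcs k. butlast y = butlast x}"
    then have y: "y \<in> Arcs k" "butlast y = butlast x" by auto
    then show "invol k y \<in> {y\<in>Arcs k. tl y = tl (invol k x)}"
      using invol_fibre[OF y(1) assms(3)] invol_Arcs[OF y(1)] by blast
    show "invol k (invol k y) = y" by (rule inv[OF y(1)])
  qed (rule refl)
  then show ?thesis using assms(1,2) invol_Arcs[OF assms(3)] unfolding harmonic_def by simp
qed

text \<open>The torus can rescale \<open>t + u\<close> to \<open>t\<close> if the two have the same absolute value. Otherwise \<open>t\<close> only
  just fails the bound of \<open>base_fix\<close>, so that \<open>s\<close> and \<open>t + u\<close> satisfy theirs.\<close>

lemma tail_fibre_torus: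
  fixes s t u :: "'a::nonarch_local_field"
  assumes st: "in_chart k s t" and less: "nv s < nv (t * pw (parity_shift k))"
    and t: "nv (pw (behind k) :: 'a) < nv t" and u: "nv u \<le> nv (pw (behind k - 1) :: 'a)"
  shows "lact (chart s t ** M2 1 u 0 1) (rev_base_arc k) = rev_base_arc k \<or>
    (\<exists>v. nv v = 1 \<and> lact (M2 v 0 0 1) (lact (chart s t ** M2 1 u 0 1) (rev_base_arc k)) = lact (chart s t) (rev_base_arc k))"
proof -
  note d = in_chartD[OF st]
  have t0: "0 < nv t" using t by (meson order.strict_trans1 zero_le_dist)
  have s: "nv s \<le> nv (uniformizer :: 'a) * nv (t * pw (parity_shift k))" by (rule nv_gap[OF less])
  have s': "nv s \<le> nv t * nv (pw (parity_shift k + 1) :: 'a)"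
  proof -
    have "nv (uniformizer :: 'a) * nv (t * pw (parity_shift k)) = nv t * (nv (pw (parity_shift k) :: 'a) * nv (pw 1 :: 'a))"
      by (simp add: nv_mult)
    then show ?thesis using s unfolding pw_mult by simp
  qed
  have lo1: "1 \<le> behind k"
  proof (rule ccontr)
    assume "\<not> 1 \<le> behind k"
    then have "behind k = 0" using behind_ahead(3)[of k] by simp
    then show False using t d(1) by simp
  qed
  have u1: "nv u \<le> 1" using u pw_le1[of "behind k - 1", where ?'a = 'a] lo1 by linarith
  define z where "z = M2 1 (t + u) s (1 + s * u)"
  have z: "chart s t ** M2 1 u 0 1 = z" by (simp add: z_def add.commute)
  have zd: "1 * (1 + s * u) - (t + u) * s = 1 - s * t" by (simp add: algebra_simps)
  have e: "nv (t + u) \<le> 1" "nv (1 + s * u) \<le> 1"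
    using d u1 by (auto intro!: nv_add_le nv_mult_le1)
  have su: "nv (s * u) \<le> nv t * nv (pw (ahead k) :: 'a)"
  proof -
    have "nv (s * u) \<le> (nv t * nv (pw (parity_shift k + 1) :: 'a)) * nv (pw (behind k - 1) :: 'a)"
      unfolding nv_mult by (rule mult_mono[OF s' u]) auto
    also have "\<dots> = nv t * nv (pw (ahead k) :: 'a)" using behind_ahead(1)[of k] by (simp add: mult.assoc pw_mult add.commute)
    finally show ?thesis .
  qed
  show ?thesis
  proof (cases "nv (t + u) = nv t")
    case True
    define v where "v = t / (t + u)"
    have tu: "t + u \<noteq> 0" using True t0 by auto
    have v: "nv v = 1" "v \<noteq> 0" "v * (t + u) = t" using True t0 tu unfolding v_def by (auto simp: nv_divide)
    have sv: "nv (s / v) \<le> 1" using d v by (simp add: nv_divide)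
    have "lact (M2 1 t (s / v) (1 + s * u)) (rev_base_arc k) = lact (chart s t) (rev_base_arc k)"
    proof (rule base_congruent(2))
      have "(1 + s * u) - t * (s / v) = 1 - s * t"
      proof -
        have "t * (s / v) = v * (t + u) * (s / v)" by (simp only: v(3))
        then have "t * (s / v) = (t + u) * s" using v(2) by simp
        then show ?thesis by (simp add: algebra_simps)
      qed
      then show "nv (1 * (1 + s * u) - t * (s / v)) = 1" by (simp only: mult_1_left d(3))
      have "nv (t * (s * u)) \<le> nv (pw (behind k) :: 'a)"
      proof -
        have "nv (s * u) \<le> nv (pw (ahead k) :: 'a)"
          using d(1) by (intro order_trans[OF su] mult_left_le_one_le) auto
        also have "\<dots> \<le> nv (pw (behind k) :: 'a)" using behind_ahead[of k] by (intro pw_mono) simp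
        finally show ?thesis by (rule nv_mult_le_left[OF d(1)])
      qed
      moreover have "1 * t - t * (1 + s * u) = - (t * (s * u))" by (simp add: algebra_simps)
      ultimately show "nv (1 * t - t * (1 + s * u)) \<le> nv (pw (behind k) :: 'a)" by (simp only: nv_minus)
      have "s / v - s = s * u / t" unfolding v_def using t0 tu by (auto simp: field_simps)
      moreover have "nv (s * u / t) \<le> nv (pw (ahead k) :: 'a)"
        unfolding nv_divide using su t0 by (simp add: pos_divide_le_eq mult.commute)
      ultimately show "nv (1 * (s / v) - s * 1) \<le> nv (pw (ahead k) :: 'a)" by (simp only: mult_1_left mult_1_right)
    qed (simp_all only: mult_1_left d(1,2,4) e sv nv_1 order_refl)
    moreover have "lact (M2 v 0 0 1) (lact z (rev_base_arc k)) = lact (M2 1 t (s / v) (1 + s * u)) (rev_base_arc k)"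
    proof -
      have "M2 v 0 0 1 ** z = M2 1 t (s / v) (1 + s * u) ** M2 v 0 0 1"
        using v by (simp add: z_def)
      then have "lact (M2 v 0 0 1) (lact z (rev_base_arc k)) = lact (M2 1 t (s / v) (1 + s * u)) (lact (M2 v 0 0 1) (rev_base_arc k))"
        by (simp only: lact_mult[OF base_vertices(2)])
      also have "lact (M2 v 0 0 1) (rev_base_arc k) = rev_base_arc k" using v(1) by (intro diag_base(2)) auto
      finally show ?thesis .
    qed
    ultimately show ?thesis unfolding z using v(1) by auto
  next
    case False
    have "nv t \<le> nv u" using False nv_add_eq[of u t] by force
    then have tle: "nv t \<le> nv (pw (behind k - 1) :: 'a)" using u by simp
    have tu_less: "nv (t + u) < nv t"
    proof -
      have "nv (pw (behind k) :: 'a) \<le> nv (uniformizer :: 'a) * nv t" by (rule nv_gap[OF t])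
      moreover have "nv (pw (behind k) :: 'a) = nv (uniformizer :: 'a) * nv (pw (behind k - 1) :: 'a)"
        using pw_mult[of 1 "behind k - 1", where ?'a = 'a] by simp
      ultimately have "nv (pw (behind k - 1) :: 'a) \<le> nv t" using nv_unif[where ?'a = 'a] by (simp add: mult_le_cancel_left)
      then have "nv (t + u) \<le> nv t" using u by (intro nv_add_le) auto
      then show ?thesis using False by simp
    qed
    have "lact z (rev_base_arc k) = rev_base_arc k"
      unfolding z_def
    proof (rule base_fix(2))
      have "nv (t + u) \<le> nv (uniformizer :: 'a) * nv t" by (rule nv_gap[OF tu_less])
      also have "\<dots> \<le> nv (pw 1 :: 'a) * nv (pw (behind k - 1) :: 'a)" using tle by (simp add: mult_left_mono)
      also have "\<dots> = nv (pw (behind k) :: 'a)" unfolding pw_mult by simp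
      finally show "nv (t + u) \<le> nv (pw (behind k) :: 'a)" .
      have "nv s \<le> nv (pw (behind k - 1) :: 'a) * nv (pw (parity_shift k + 1) :: 'a)"
        by (rule order_trans[OF s' mult_right_mono[OF tle zero_le_dist]])
      also have "\<dots> = nv (pw (ahead k) :: 'a)" unfolding pw_mult using behind_ahead(1)[of k] by (simp add: add.commute)
      finally show "nv s \<le> nv (pw (ahead k) :: 'a)" .
      show "nv (1 * (1 + s * u) - (t + u) * s) = 1" unfolding zd by (rule d(3))
    qed (simp_all only: nv_1 order_refl e)
    then show ?thesis unfolding z by blast
  qed
qed

text \<open>If the two sides of the bound on \<open>s\<close> are equal, the torus carries the arc to its image under \<open>\<iota>\<close>.
  Otherwise the function \<open>D z = f z - f (\<iota> z)\<close> vanishes at the centre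
  \<open>rev_base_arc k\<close> and is constant on the rest of the tail fibre by \<open>tail_fibre_torus\<close>; as it sums
  to zero over the fibre, it vanishes at the arc too.\<close>

lemma kernel_rbase_symmetric:
  fixes f :: "'a::nonarch_local_field vertex list \<Rightarrow> complex" and s t :: 'a
  assumes torus: "\<And>u v y. nv u = 1 \<Longrightarrow> nv v = 1 \<Longrightarrow> y \<in> Arcs k \<Longrightarrow> f (lact (M2 u 0 0 v) y) = f y"
    and harm: "harmonic k f" and st: "in_chart k s t" and le: "nv s \<le> nv (t * pw (parity_shift k))"
    and yA: "lact (chart s t) (rev_base_arc k) \<in> Arcs k"
  shows "f (lact (chart s t) (rev_base_arc k)) = f (invol k (lact (chart s t) (rev_base_arc k)))"
proof -
  note d = in_chartD[OF st]
  define y where "y = lact (chart s t) (rev_base_arc k)"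
  have yA': "y \<in> Arcs k" using yA y_def by simp
  have bA: "rev_base_arc k \<in> (Arcs k :: 'a vertex list set)"
    using Arcs_lact[OF flip_stab base_Arcs[OF yA]] lact_flip_base(1) by metis
  define D where "D z = f z - f (invol k z)" for z
  have D0: "D (rev_base_arc k) = 0" by (simp add: D_def invol_base)
  have DT: "D (lact (M2 u 0 0 v) z) = D z" if "nv u = 1" "nv v = 1" "z \<in> Arcs k" for u v z
  proof -
    have "invol k (lact (M2 u 0 0 v) z) = lact (M2 v 0 0 u) (invol k z)"
      unfolding invol_lact[OF Arcs_vertices[OF that(3)]] diag_conj_flip ..
    then show ?thesis unfolding D_def using torus[OF that] torus[OF that(2,1) invol_Arcs[OF that(3)]] by simp
  qed
  have "D y = 0"
  proof (cases "nv t \<le> nv (pw (behind k) :: 'a)")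
    case True
    have "nv s \<le> nv (pw (ahead k) :: 'a)"
      using le nv_pw_mult[OF True order_refl[of "nv (pw (parity_shift k) :: 'a)"]] behind_ahead(1)[of k] by simp
    then have "y = rev_base_arc k" unfolding y_def using d True by (intro base_fix(2)) (auto simp: mult.commute)
    then show ?thesis using D0 by simp
  next
    case False
    then have t: "nv (pw (behind k) :: 'a) < nv t" by simp
    then have t0: "t \<noteq> 0" by auto
    show ?thesis
    proof (cases "nv s = nv (t * pw (parity_shift k))")
      case True
      define v where "v = s / (t * pw (parity_shift k))"
      have v: "nv v = 1" "v \<noteq> 0" using True t0 by (auto simp: v_def nv_divide)
      have st': "v * t = s / pw (parity_shift k)" "s / v = t * pw (parity_shift k)" using t0 v(2) by (auto simp: v_def)
      have "M2 v 0 0 1 ** chart s t = chart (s / v) (v * t) ** M2 v 0 0 1" using v by simp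
      then have "lact (M2 v 0 0 1) y = lact (chart (s / v) (v * t)) (lact (M2 v 0 0 1) (rev_base_arc k))"
        unfolding y_def by (simp only: lact_mult[OF base_vertices(2)])
      also have "lact (M2 v 0 0 1) (rev_base_arc k) = rev_base_arc k" using v(1) by (intro diag_base(2)) auto
      also have "lact (chart (s / v) (v * t)) (rev_base_arc k) = invol k y"
        unfolding y_def chart_rbase_invol st' ..
      finally have "lact (M2 v 0 0 1) y = invol k y" .
      then have "f (invol k y) = f y" using torus[OF v(1) _ yA', of 1] by simp
      then show ?thesis by (simp add: D_def)
    next
      case False
      then have less: "nv s < nv (t * pw (parity_shift k))" using le by simp
      have "1 \<le> k"
      proof (rule ccontr)
        assume "\<not> 1 \<le> k"
        then have "behind k = 0" by (simp add: behind_def)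
        then show False using t d(1) by simp
      qed
      define F where "F = {z \<in> Arcs k. butlast z = butlast y}"
      have finF: "finite F" unfolding F_def by (rule finite_subset[OF _ finite_Arcs]) auto
      have yF: "y \<in> F" unfolding F_def using yA' by simp
      have F: "z = rev_base_arc k \<or> D z = D y" if "z \<in> F" for z
      proof -
        have z: "z \<in> Arcs k" "butlast z = butlast (lact (chart s t) (rev_base_arc k))" using that unfolding F_def y_def by auto
        obtain u where u: "nv u \<le> nv (pw (behind k - 1) :: 'a)" "z = lact (chart s t ** M2 1 u 0 1) (rev_base_arc k)"
          using tail_fibre_rbase[OF chart_stab[OF st] z \<open>1 \<le> k\<close>] by blast
        show ?thesis
          using tail_fibre_torus[OF st less t u(1)] DT[OF _ _ z(1), of _ 1] unfolding u(2)[symmetric] y_def[symmetric]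
          by (metis nv_1)
      qed
      have "(\<Sum>z\<in>F. D z) = 0"
        using harm \<open>1 \<le> k\<close> yA' harmonic_invol[OF harm \<open>1 \<le> k\<close> yA']
        unfolding F_def D_def harmonic_def by (simp add: sum_subtractf)
      moreover have "(\<Sum>z\<in>F. D z) = (\<Sum>z\<in>F - {rev_base_arc k}. D z)"
        using finF D0 by (intro sum.mono_neutral_right) auto
      moreover have "(\<Sum>z\<in>F - {rev_base_arc k}. D z) = (\<Sum>z\<in>F - {rev_base_arc k}. D y)"
        using F by (intro sum.cong) auto
      ultimately have "of_nat (card (F - {rev_base_arc k})) * D y = 0" by simp
      moreover have "y = rev_base_arc k \<or> card (F - {rev_base_arc k}) \<noteq> 0" using finF yF by auto
      ultimately show ?thesis using D0 by auto
    qed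
  qed
  then show ?thesis unfolding D_def y_def by simp
qed

lemma conj_sign: "M2 1 0 0 (-1) ** chart s t ** M2 1 0 0 (-1) = chart (- s) (- t)"
  by simp

lemma in_chart_neg: "in_chart k s t \<Longrightarrow> in_chart k (- s) (- t)"
  by (simp add: in_chart_def)

text \<open>For the arcs \<open>h (base_arc k)\<close> the two pairs are exchanged by the group itself.
  For the arcs \<open>h (rev_base_arc k)\<close> the group identifies the transposed pair
  with the image under \<open>\<iota>\<close>, and the preceding lemma applies to the arc or to its image under \<open>\<iota>\<close>.\<close>

lemma harmonic_kernel_symmetric:
  fixes f :: "'a::nonarch_local_field vertex list \<Rightarrow> 'a vertex list \<Rightarrow> complex"
  assumes inv: "\<And>A x y. A \<in> stab k \<Longrightarrow> x \<in> Arcs k \<Longrightarrow> y \<in> Arcs k \<Longrightarrow> f (lact A x) (lact A y) = f x y"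
    and harm: "\<And>x. x \<in> Arcs k \<Longrightarrow> harmonic k (f x)"
    and x: "x \<in> Arcs k" and y: "y \<in> Arcs k"
  shows "f x y = f y x"
proof -
  have bA: "base_arc k \<in> (Arcs k :: 'a vertex list set)" by (rule base_Arcs[OF x])
  have rA: "rev_base_arc k \<in> (Arcs k :: 'a vertex list set)"
    using Arcs_lact[OF flip_stab bA] by (simp only: lact_flip_base)
  \<comment> \<open>By transitivity one of the two arcs may be taken to be the base arc.\<close>
  have main: "f (base_arc k) z = f z (base_arc k)" if z: "z \<in> Arcs k" for z
  proof -
    obtain s t where st: "in_chart k s t" "z = lact (chart s t) (base_arc k) \<or> z = lact (chart s t) (rev_base_arc k)"
      by (rule Arcs_cases[OF z])
    define h where "h = chart s t"
    define h' where "h' = chart (- s) (- t)"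
    define e where "e = M2 1 0 0 (-1 :: 'a)"
    have hs: "h \<in> stab k" "h' \<in> stab k" "e \<in> stab k" "flip k \<in> (stab k :: ('a^2^2) set)"
      unfolding h_def h'_def e_def by (intro chart_stab st in_chart_neg diag_stab flip_stab; simp)+
    have eb: "lact e (base_arc k) = base_arc k" "lact e (rev_base_arc k) = rev_base_arc k"
      unfolding e_def by (intro diag_base; simp)+
    have h'e: "h' = e ** h ** e" unfolding h_def h'_def e_def by (rule conj_sign[symmetric])
    have hh': "lact h' (lact h w) = w" if "set w \<subseteq> vertices" for w
    proof -
      have "h' ** h = mat (1 - s * t) ** mat 1" unfolding h_def h'_def by (simp add: mat_M2 algebra_simps)
      then have "proj (h' ** h) = proj (mat 1)" using proj_scalar[of "1 - s * t" "mat 1"] in_chartD(5)[OF st(1)] by simp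
      then show ?thesis unfolding lact_mult[OF that] using lact_one[OF that] by simp
    qed
    from st(2) show ?thesis
    proof
      assume z: "z = lact (chart s t) (base_arc k)"
      have "f z (base_arc k) = f (lact h' z) (lact h' (base_arc k))"
        unfolding z h_def[symmetric] by (rule inv[OF hs(2) Arcs_lact[OF hs(1) bA] bA, symmetric])
      also have "lact h' z = base_arc k" unfolding z h_def[symmetric] by (rule hh'[OF base_vertices(1)])
      also have "lact h' (base_arc k) = lact e (lact h (base_arc k))"
        unfolding h'e by (simp only: lact_mult[OF base_vertices(1), symmetric] eb)
      also have "f (base_arc k) (lact e (lact h (base_arc k))) = f (lact e (base_arc k)) (lact e (lact h (base_arc k)))"
        by (simp only: eb)
      also have "\<dots> = f (base_arc k) (lact h (base_arc k))" by (rule inv[OF hs(3) bA Arcs_lact[OF hs(1) bA]])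
      finally show ?thesis unfolding z h_def by simp
    next
      assume z: "z = lact (chart s t) (rev_base_arc k)"
      have zA: "lact h (rev_base_arc k) \<in> Arcs k" by (rule Arcs_lact[OF hs(1) rA])
      have iz: "invol k z = lact (flip k) (lact h (base_arc k))"
      proof -
        have "rev z = lact h (base_arc k)" unfolding z h_def rev_base_arc_def by (simp add: rev_map)
        then show ?thesis unfolding invol_def by simp
      qed
      have 1: "f z (base_arc k) = f (base_arc k) (invol k z)"
      proof -
        have "f z (base_arc k) = f (lact h' z) (lact h' (base_arc k))"
          unfolding z h_def[symmetric] by (rule inv[OF hs(2) zA bA, symmetric])
        also have "lact h' z = rev_base_arc k" unfolding z h_def[symmetric] by (rule hh'[OF base_vertices(2)])
        also have "f (rev_base_arc k) (lact h' (base_arc k)) = f (lact (flip k) (rev_base_arc k)) (lact (flip k) (lact h' (base_arc k)))"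
          by (rule inv[OF hs(4) rA Arcs_lact[OF hs(2) bA], symmetric])
        also have "\<dots> = f (lact e (base_arc k)) (lact e (lact (flip k) (lact h (base_arc k))))"
        proof -
          have "proj (flip k ** h') = proj (e ** (flip k ** (h ** e)))"
          proof -
            have "flip k ** h' = mat (-1) ** (e ** (flip k ** (h ** e)))"
              unfolding h'_def h_def e_def flip_def by (simp add: mat_M2)
            then show ?thesis using proj_scalar[of "-1"] by simp
          qed
          then have "lact (flip k ** h') (base_arc k) = lact (e ** (flip k ** (h ** e))) (base_arc k)" by simp
          also have "\<dots> = lact (e ** (flip k ** h)) (lact e (base_arc k))"
            by (simp only: lact_mult[OF base_vertices(1)] matrix_mul_assoc)
          also have "\<dots> = lact (e ** (flip k ** h)) (base_arc k)" by (simp only: eb)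
          finally have "lact (flip k) (lact h' (base_arc k)) = lact e (lact (flip k) (lact h (base_arc k)))"
            by (simp only: lact_mult[OF base_vertices(1)] lact_mult[OF lact_vertices[OF stab_invertible[OF hs(1)] base_vertices(1)]] matrix_mul_assoc)
          then show ?thesis by (simp only: lact_flip_base eb)
        qed
        also have "\<dots> = f (base_arc k) (lact (flip k) (lact h (base_arc k)))"
          by (rule inv[OF hs(3) bA Arcs_lact[OF hs(4) Arcs_lact[OF hs(1) bA]]])
        finally show ?thesis unfolding iz .
      qed
      have tor: "f (base_arc k) (lact (M2 u 0 0 v) y) = f (base_arc k) y" if "nv u = 1" "nv v = 1" "y \<in> Arcs k" for u v y
        using inv[OF diag_stab[OF that(1,2)] bA that(3)] diag_base(1)[OF that(1,2), of k] by simp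
      have 2: "f (base_arc k) z = f (base_arc k) (invol k z)"
      proof (cases "nv s \<le> nv (t * pw (parity_shift k))")
        case True
        then show ?thesis using kernel_rbase_symmetric[OF tor harm[OF bA] st(1)] zA unfolding z h_def by blast
      next
        case False
        have c: "in_chart k (t * pw (parity_shift k)) (s / pw (parity_shift k))"
        proof -
          have "nv (t * pw (parity_shift k)) \<le> nv (pw (parity_shift k) :: 'a)" using in_chartD[OF st(1)] by (intro nv_mult_le_left) auto
          then show ?thesis using in_chartD[OF st(1)] by (simp add: in_chart_def nv_divide mult.commute)
        qed
        have i: "invol k z = lact (chart (t * pw (parity_shift k)) (s / pw (parity_shift k))) (rev_base_arc k)"
          unfolding z by (rule chart_rbase_invol)
        have "f (base_arc k) (invol k z) = f (base_arc k) (invol k (invol k z))"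
          unfolding i
        proof (rule kernel_rbase_symmetric[OF tor harm[OF bA] c])
          show "nv (t * pw (parity_shift k)) \<le> nv (s / pw (parity_shift k) * pw (parity_shift k))" using False by simp
          show "lact (chart (t * pw (parity_shift k)) (s / pw (parity_shift k))) (rev_base_arc k) \<in> Arcs k"
            unfolding i[symmetric] by (rule invol_Arcs) (use zA z h_def in simp)
        qed
        then show ?thesis using invol_invol[of z k] Arcs_vertices[OF that] by simp
      qed
      show ?thesis using 1 2 by simp
    qed
  qed
  obtain A where A: "A \<in> stab k" "x = lact A (base_arc k)" by (rule Arcs_transitive[OF x])
  have i: "invertible A" using stab_invertible[OF A(1)] .
  define z where "z = lact (matrix_inv A) y"
  have zA: "z \<in> Arcs k" unfolding z_def by (rule Arcs_lact[OF stab_inv[OF A(1)] y])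
  have yz: "y = lact A z"
    unfolding z_def using invertible_inv[OF i] by (simp only: lact_mult[OF Arcs_vertices[OF y]] lact_one[OF Arcs_vertices[OF y]])
  show ?thesis unfolding A(2) yz inv[OF A(1) bA zA] inv[OF A(1) zA bA] by (rule main[OF zA])
qed

section \<open>Separation of levels\<close>

text \<open>Conjugating by \<open>chart s t\<close> multiplies the entry \<open>\<gamma>\<close> by integral elements only, so the conjugate still
  fixes the base arc.\<close>

lemma lower_unipotent_trivial:
  fixes \<gamma> :: "'a::nonarch_local_field"
  assumes g: "nv \<gamma> \<le> nv (pw (ahead k) :: 'a)" and x: "x \<in> Arcs k"
  shows "lact (M2 1 0 \<gamma> 1) x = x"
proof -
  obtain s t where st: "in_chart k s t" "x = lact (chart s t) (base_arc k) \<or> x = lact (chart s t) (rev_base_arc k)"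
    by (rule Arcs_cases[OF x])
  note d = in_chartD[OF st(1)]
  have g1: "nv \<gamma> \<le> 1" using g pw_le1[of "ahead k", where ?'a = 'a] behind_ahead(4)[of k] by linarith
  have m: "M2 1 0 \<gamma> 1 ** chart s t = M2 1 t (\<gamma> + s) (\<gamma> * t + 1)" by simp
  have c: "nv (1 * 1 - t * s) = 1" "nv (1 * (\<gamma> * t + 1) - t * (\<gamma> + s)) = 1"
    using d by (simp_all add: algebra_simps)
  have "nv (- (t * (\<gamma> * t))) \<le> nv (pw (behind k) :: 'a)"
    unfolding nv_minus using pw_mono[of "behind k" "ahead k", where ?'a = 'a] behind_ahead[of k] g d
    by (intro nv_mult_le_left nv_mult_le_right) auto
  moreover have "1 * t - t * (\<gamma> * t + 1) = - (t * (\<gamma> * t))" by (simp add: algebra_simps)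
  ultimately have b: "nv (1 * t - t * (\<gamma> * t + 1)) \<le> nv (pw (behind k) :: 'a)" by simp
  have e: "nv (\<gamma> + s) \<le> 1" "nv (\<gamma> * t + 1) \<le> 1" using d g1 by (auto intro!: nv_add_le nv_mult_le1)
  have cc: "nv (1 * (\<gamma> + s) - s * 1) \<le> nv (pw (ahead k) :: 'a)" using g by simp
  have "lact (M2 1 t (\<gamma> + s) (\<gamma> * t + 1)) (base_arc k) = lact (chart s t) (base_arc k)"
    by (rule base_congruent(1)[OF _ _ _ _ c(1) _ _ _ _ c(2) b cc]) (use d e in simp_all)
  moreover have "lact (M2 1 t (\<gamma> + s) (\<gamma> * t + 1)) (rev_base_arc k) = lact (chart s t) (rev_base_arc k)"
    by (rule base_congruent(2)[OF _ _ _ _ c(1) _ _ _ _ c(2) b cc]) (use d e in simp_all)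
  ultimately show ?thesis
    using st(2) unfolding m[symmetric] lact_mult[OF base_vertices(1), symmetric] lact_mult[OF base_vertices(2), symmetric]
    by metis
qed

lemma lower_unipotent_stab:
  fixes \<gamma> :: "'a::nonarch_local_field"
  assumes "nv \<gamma> \<le> nv (pw 1 :: 'a)"
  shows "M2 1 0 \<gamma> 1 \<in> stab k"
proof -
  have "nv (pw 1 :: 'a) \<le> nv (pw (parity_shift k) :: 'a)" by (rule pw_mono) (simp add: parity_shift_def)
  then show ?thesis using assms by (intro chart_stab) (simp add: in_chart_def)
qed

text \<open>The reflection of the apartment at \<open>s0\<close> moves \<open>s1\<close> to a third vertex, so the group determines the parity
  of the level.\<close>

lemma K_parity_eq: "(K_parity k :: 'a::nonarch_local_field pgl set) = K_parity l \<longleftrightarrow> even k = even l"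
proof -
  define w where "w = M2 0 1 1 (0::'a)"
  have w: "invertible w" "mact w (apt_vertex j) = apt_vertex (- j)" for j
    using mact_antidiag[of 0 j, where ?'a = 'a] by (simp_all add: w_def invertible_M2)
  have "w \<in> stab 1" by (simp add: stab_odd w)
  moreover have "w \<notin> stab 0" by (simp add: stab_even w doubleton_eq_iff apt_vertex_inj)
  ultimately have "(K_parity 0 :: 'a pgl set) \<noteq> K_parity 1" unfolding stab_def by auto
  then have "K0 \<noteq> (K1 :: 'a pgl set)" unfolding K_parity_def by auto
  then show ?thesis unfolding K_parity_def by auto
qed

section \<open>Equivariant maps to harmonic cochains\<close>

text \<open>The orthogonal complement of the coboundaries, as functions vanishing outside the arcs.\<close>

definition harm_space :: "nat \<Rightarrow> ('a::nonarch_local_field vertex list \<Rightarrow> complex) set" where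
  "harm_space k = {f. (\<forall>x. x \<notin> Arcs k \<longrightarrow> f x = 0) \<and>
     (\<forall>g. (\<Sum>x\<in>Arcs k. f x * cnj (g (tl x) - g (butlast x))) = 0)}"

lemma function_space_harm_space: "function_space (Arcs k) (harm_space k)"
  unfolding function_space_def harm_space_def
  by (auto simp: distrib_right sum.distrib mult.assoc sum_distrib_left[symmetric])

text \<open>Within \<open>\<Sigma>\<^sub>k\<close> a vertex is the tail of arcs or the head of arcs but not both, as the centre of the path
  would be met twice. Therefore orthogonality to the coboundaries separates into a condition for
  tails and one for heads.\<close>

lemma tl_neq_butlast:
  fixes x y :: "'a::nonarch_local_field vertex list"
  assumes "x \<in> Arcs k" "y \<in> Arcs k" "k \<ge> 1"
  shows "tl x \<noteq> butlast y"
proof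
  assume eq: "tl x = butlast y"
  have l: "length x = k + 2" "length y = k + 2" "distinct x" "distinct y"
    using assms(1,2) unfolding Arcs_iff paths_def by auto
  have n: "y ! i = x ! Suc i" if "i \<le> k" for i
  proof -
    have "tl x ! i = x ! Suc i" "butlast y ! i = y ! i" using that l by (auto simp: nth_tl nth_butlast)
    then show ?thesis using eq by simp
  qed
  define p where "p = nat (behind k)"
  have p: "p \<le> k" "even k \<Longrightarrow> p + 1 \<le> k" using assms(3) unfolding p_def behind_def by (auto elim!: evenE)
  show False
  proof (cases "even k")
    case False
    then have "x ! p = x ! Suc p" using assms(1,2) n[OF p(1)] unfolding Arcs_iff p_def by simp
    then show False using l p(1) nth_eq_iff_index_eq[OF l(3), of p "Suc p"] by simp
  next
    case True
    have "{x ! p, x ! Suc p} \<subseteq> {apt_vertex 0, apt_vertex 1}" "{y ! p, y ! Suc p} \<subseteq> {apt_vertex 0, apt_vertex 1}"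
      using assms(1,2) True unfolding Arcs_iff p_def by simp_all
    then have "{x ! p, x ! Suc p, x ! Suc (Suc p)} \<subseteq> {apt_vertex 0, apt_vertex 1}"
      using n[of "Suc p"] p(2)[OF True] by simp
    moreover have "x ! p \<noteq> x ! Suc p" "x ! p \<noteq> x ! Suc (Suc p)" "x ! Suc p \<noteq> x ! Suc (Suc p)"
      using l p(2)[OF True] by (simp_all add: nth_eq_iff_index_eq[OF l(3)])
    ultimately show False by auto
  qed
qed

lemma harm_space_harmonic:
  fixes f :: "'a::nonarch_local_field vertex list \<Rightarrow> complex"
  assumes f: "f \<in> harm_space k"
  shows "harmonic k f"
  unfolding harmonic_def
proof (intro impI ballI conjI)
  fix x :: "'a vertex list" assume k: "1 \<le> k" and x: "x \<in> Arcs k"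
  have eq: "(\<Sum>y\<in>{y \<in> Arcs k. Q y}. f y) = (\<Sum>y\<in>Arcs k. f y * (if Q y then 1 else 0))" for Q
    by (rule sum.mono_neutral_cong_left) (auto simp: finite_Arcs)
  have z: "(\<Sum>y\<in>Arcs k. f y * cnj (g (tl y) - g (butlast y))) = 0" for g
    using f unfolding harm_space_def by blast
  have "(\<Sum>y\<in>Arcs k. f y * (if butlast y = butlast x then 1 else 0)) =
      - (\<Sum>y\<in>Arcs k. f y * cnj ((if tl y = butlast x then 1 else 0) - (if butlast y = butlast x then 1 else 0)))"
    unfolding sum_negf[symmetric] by (rule sum.cong[OF refl]) (use tl_neq_butlast[OF _ x k] in auto)
  then show "(\<Sum>y\<in>{y \<in> Arcs k. butlast y = butlast x}. f y) = 0"
    unfolding eq using z[of "\<lambda>v. if v = butlast x then 1 else 0"] by simp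
  have "(\<Sum>y\<in>Arcs k. f y * (if tl y = tl x then 1 else 0)) =
      (\<Sum>y\<in>Arcs k. f y * cnj ((if tl y = tl x then 1 else 0) - (if butlast y = tl x then 1 else 0)))"
    by (rule sum.cong[OF refl]) (use tl_neq_butlast[OF x _ k, THEN not_sym] in auto)
  then show "(\<Sum>y\<in>{y \<in> Arcs k. tl y = tl x}. f y) = 0"
    unfolding eq using z[of "\<lambda>v. if v = tl x then 1 else 0"] by simp
qed

text \<open>The value \<open>0\<close> outside the arcs keeps \<open>harm_space\<close> stable.\<close>

definition shift :: "nat \<Rightarrow> 'a::nonarch_local_field^2^2 \<Rightarrow> ('a vertex list \<Rightarrow> complex) \<Rightarrow> 'a vertex list \<Rightarrow> complex" where
  "shift k A f x = (if x \<in> Arcs k then f (lact (matrix_inv A) x) else 0)"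

lemma lact_inv_Arcs:
  assumes "A \<in> stab k" "x \<in> Arcs k"
  shows "lact (matrix_inv A) (lact A x) = x" "lact A (lact (matrix_inv A) x) = x"
proof -
  note i = invertible_inv[OF stab_invertible[OF assms(1)]]
  show "lact (matrix_inv A) (lact A x) = x" "lact A (lact (matrix_inv A) x) = x"
    by (simp_all only: lact_mult[OF Arcs_vertices[OF assms(2)]] i lact_one[OF Arcs_vertices[OF assms(2)]])
qed

lemma sum_Arcs_lact:
  assumes "A \<in> stab k"
  shows "(\<Sum>x\<in>Arcs k. F (lact A x)) = (\<Sum>x\<in>Arcs k. F x)"
  by (rule sum.reindex_bij_witness[of _ "lact (matrix_inv A)" "lact A"])
    (simp_all only: lact_inv_Arcs[OF assms] Arcs_lact[OF assms] Arcs_lact[OF stab_inv[OF assms]])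

lemma shift_lact: "A \<in> stab k \<Longrightarrow> x \<in> Arcs k \<Longrightarrow> shift k A f (lact A x) = f x"
  unfolding shift_def by (simp only: Arcs_lact lact_inv_Arcs if_True)

lemma shift_eqI:
  assumes "A \<in> stab k" "\<And>x. x \<in> Arcs k \<Longrightarrow> h (lact A x) = f x" "\<And>x. x \<notin> Arcs k \<Longrightarrow> h x = 0"
  shows "h = shift k A f"
proof
  fix x
  show "h x = shift k A f x"
  proof (cases "x \<in> Arcs k")
    case True
    then show ?thesis
      using assms(2)[OF Arcs_lact[OF stab_inv[OF assms(1)] True]] unfolding shift_def
      by (simp only: lact_inv_Arcs(2)[OF assms(1) True] if_True)
  qed (simp add: assms(3) shift_def)
qed

lemma shift_harm_space:
  assumes A: "A \<in> stab k" and f: "f \<in> harm_space k"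
  shows "shift k A f \<in> harm_space k"
proof -
  have "(\<Sum>x\<in>Arcs k. shift k A f x * cnj (g (tl x) - g (butlast x))) = 0" for g
  proof -
    have "(\<Sum>x\<in>Arcs k. shift k A f x * cnj (g (tl x) - g (butlast x))) =
        (\<Sum>x\<in>Arcs k. shift k A f (lact A x) * cnj (g (tl (lact A x)) - g (butlast (lact A x))))"
      by (rule sum_Arcs_lact[OF A, symmetric])
    also have "\<dots> = (\<Sum>x\<in>Arcs k. f x * cnj (g (lact A (tl x)) - g (lact A (butlast x))))"
      by (rule sum.cong[OF refl]) (simp add: shift_lact[OF A] map_tl map_butlast)
    also have "\<dots> = 0"
    proof -
      have "\<forall>g. (\<Sum>x\<in>Arcs k. f x * cnj (g (tl x) - g (butlast x))) = 0" using f unfolding harm_space_def by simp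
      from this[rule_format, of "\<lambda>v. g (lact A v)"] show ?thesis .
    qed
    finally show ?thesis .
  qed
  then show ?thesis unfolding harm_space_def by (simp add: shift_def)
qed

lemma inner_shift:
  assumes "A \<in> stab k"
  shows "inner_on (Arcs k) (shift k A f) (shift k A g) = inner_on (Arcs k) f g"
  unfolding inner_on_def sum_Arcs_lact[OF assms, symmetric, of "\<lambda>x. shift k A f x * cnj (shift k A g x)"]
  by (rule sum.cong[OF refl]) (simp only: shift_lact[OF assms])

abbreviation Kgrp :: "nat \<Rightarrow> 'a::nonarch_local_field pgl monoid" where
  "Kgrp k \<equiv> PGL2\<lparr>carrier := K_parity k\<rparr>"

lemma complex_field_simps [simp]:
  "carrier complex_field = UNIV" "x \<otimes>\<^bsub>complex_field\<^esub> y = x * y" "x \<oplus>\<^bsub>complex_field\<^esub> y = x + y"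
  "\<one>\<^bsub>complex_field\<^esub> = 1" "\<zero>\<^bsub>complex_field\<^esub> = 0"
  by (simp_all add: ring_of_type_algebra_def)

lemma proj_K_parity: "A \<in> stab k \<Longrightarrow> proj A \<in> K_parity k"
  by (simp add: stab_def)

text \<open>Equivariance is stated at the translated arcs, which avoids inverses.\<close>

definition harm_map :: "nat \<Rightarrow> ('a::nonarch_local_field pgl, 'v) rep \<Rightarrow> ('v \<Rightarrow> 'a vertex list \<Rightarrow> complex) \<Rightarrow> bool" where
  "harm_map k \<tau> \<psi> \<longleftrightarrow> (\<forall>v\<in>carrier \<tau>. \<psi> v \<in> harm_space k) \<and>
     (\<forall>v\<in>carrier \<tau>. \<forall>w\<in>carrier \<tau>. \<psi> (v \<oplus>\<^bsub>\<tau>\<^esub> w) = (\<lambda>x. \<psi> v x + \<psi> w x)) \<and>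
     (\<forall>c. \<forall>v\<in>carrier \<tau>. \<psi> (c \<odot>\<^bsub>\<tau>\<^esub> v) = (\<lambda>x. c * \<psi> v x)) \<and>
     (\<forall>A\<in>stab k. \<forall>v\<in>carrier \<tau>. \<forall>x\<in>Arcs k. \<psi> (act \<tau> (proj A) v) (lact A x) = \<psi> v x)"

lemma harm_mapD:
  assumes "harm_map k \<tau> \<psi>"
  shows "v \<in> carrier \<tau> \<Longrightarrow> \<psi> v \<in> harm_space k"
    "v \<in> carrier \<tau> \<Longrightarrow> w \<in> carrier \<tau> \<Longrightarrow> \<psi> (v \<oplus>\<^bsub>\<tau>\<^esub> w) = (\<lambda>x. \<psi> v x + \<psi> w x)"
    "v \<in> carrier \<tau> \<Longrightarrow> \<psi> (c \<odot>\<^bsub>\<tau>\<^esub> v) = (\<lambda>x. c * \<psi> v x)"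
    "A \<in> stab k \<Longrightarrow> v \<in> carrier \<tau> \<Longrightarrow> x \<in> Arcs k \<Longrightarrow> \<psi> (act \<tau> (proj A) v) (lact A x) = \<psi> v x"
  using assms unfolding harm_map_def by blast+

lemma harm_map_off:
  assumes "harm_map k \<tau> \<psi>" "v \<in> carrier \<tau>" "x \<notin> Arcs k"
  shows "\<psi> v x = 0"
  using function_spaceD(4)[OF function_space_harm_space harm_mapD(1)[OF assms(1,2)] assms(3)] .

lemma irreducible_repD:
  fixes \<tau> :: "('a::nonarch_local_field pgl, 'v) rep"
  assumes "irreducible_smooth T (Kgrp k) \<tau>"
  shows "vectorspace complex_field \<tau>" "module complex_field \<tau>" "abelian_group \<tau>"
    "A \<in> stab k \<Longrightarrow> v \<in> carrier \<tau> \<Longrightarrow> act \<tau> (proj A) v \<in> carrier \<tau>"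
    "A \<in> stab k \<Longrightarrow> v \<in> carrier \<tau> \<Longrightarrow> w \<in> carrier \<tau> \<Longrightarrow>
       act \<tau> (proj A) (v \<oplus>\<^bsub>\<tau>\<^esub> w) = act \<tau> (proj A) v \<oplus>\<^bsub>\<tau>\<^esub> act \<tau> (proj A) w"
    "A \<in> stab k \<Longrightarrow> v \<in> carrier \<tau> \<Longrightarrow> act \<tau> (proj A) (c \<odot>\<^bsub>\<tau>\<^esub> v) = c \<odot>\<^bsub>\<tau>\<^esub> act \<tau> (proj A) v"
    "A \<in> stab k \<Longrightarrow> v \<in> carrier \<tau> \<Longrightarrow> act \<tau> (proj A) (act \<tau> (proj (matrix_inv A)) v) = v"
    "carrier \<tau> \<noteq> {\<zero>\<^bsub>\<tau>\<^esub>}"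
proof -
  have rep: "representation (Kgrp k) \<tau>" using assms unfolding irreducible_smooth_def smooth_rep_def by blast
  show vs: "vectorspace complex_field \<tau>" using rep unfolding representation_def by blast
  then show m: "module complex_field \<tau>" by (simp add: vectorspace_def)
  then show "abelian_group \<tau>" by (simp add: module_def)
  have hom: "act \<tau> (proj A) \<in> LinearCombinations.module_hom complex_field \<tau> \<tau>" if "A \<in> stab k" for A
    using rep proj_K_parity[OF that] unfolding representation_def by simp
  show "act \<tau> (proj A) v \<in> carrier \<tau>" if "A \<in> stab k" "v \<in> carrier \<tau>"
    using module_hom_closed[OF hom[OF that(1)]] that(2) by blast
  show "act \<tau> (proj A) (v \<oplus>\<^bsub>\<tau>\<^esub> w) = act \<tau> (proj A) v \<oplus>\<^bsub>\<tau>\<^esub> act \<tau> (proj A) w"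
    if "A \<in> stab k" "v \<in> carrier \<tau>" "w \<in> carrier \<tau>"
    using module_hom_add[OF hom[OF that(1)] that(2,3)] .
  show "act \<tau> (proj A) (c \<odot>\<^bsub>\<tau>\<^esub> v) = c \<odot>\<^bsub>\<tau>\<^esub> act \<tau> (proj A) v" if "A \<in> stab k" "v \<in> carrier \<tau>"
    using module_hom_smult[OF hom[OF that(1)], of c] that(2) by simp
  show "act \<tau> (proj A) (act \<tau> (proj (matrix_inv A)) v) = v" if A: "A \<in> stab k" and v: "v \<in> carrier \<tau>"
  proof -
    note i = invertible_inv[OF stab_invertible[OF A]]
    have "proj A \<otimes>\<^bsub>PGL2\<^esub> proj (matrix_inv A) = \<one>\<^bsub>PGL2\<^esub>"
      by (simp only: proj_mult[OF stab_invertible[OF A] i(1)] i proj_one)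
    moreover have "act \<tau> (proj A \<otimes>\<^bsub>PGL2\<^esub> proj (matrix_inv A)) v = act \<tau> (proj A) (act \<tau> (proj (matrix_inv A)) v)"
      using rep proj_K_parity[OF A] proj_K_parity[OF stab_inv[OF A]] v unfolding representation_def by simp
    moreover have "act \<tau> \<one>\<^bsub>PGL2\<^esub> v = v" using rep v unfolding representation_def by simp
    ultimately show ?thesis by simp
  qed
  show "carrier \<tau> \<noteq> {\<zero>\<^bsub>\<tau>\<^esub>}" using assms unfolding irreducible_smooth_def by blast
qed

lemma irreducible_invariant:
  fixes \<tau> :: "('a::nonarch_local_field pgl, 'v) rep"
  assumes irr: "irreducible_smooth T (Kgrp k) \<tau>"
    and W: "W \<subseteq> carrier \<tau>" "\<zero>\<^bsub>\<tau>\<^esub> \<in> W"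
      "\<And>v w. v \<in> W \<Longrightarrow> w \<in> W \<Longrightarrow> v \<oplus>\<^bsub>\<tau>\<^esub> w \<in> W" "\<And>c v. v \<in> W \<Longrightarrow> c \<odot>\<^bsub>\<tau>\<^esub> v \<in> W"
      "\<And>A v. A \<in> stab k \<Longrightarrow> v \<in> W \<Longrightarrow> act \<tau> (proj A) v \<in> W"
  shows "W = {\<zero>\<^bsub>\<tau>\<^esub>} \<or> W = carrier \<tau>"
proof -
  note D = irreducible_repD[OF irr]
  have "submodule complex_field W \<tau>"
    by (rule submodule.intro) (use D(2) W in auto)
  then have "VectorSpace.subspace complex_field W \<tau>" using D(1) by (simp add: VectorSpace.subspace_def)
  then have "invariant_subspace (Kgrp k) W \<tau>"
    unfolding invariant_subspace_def using W(5) by (auto simp: K_parity_stab)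
  then show ?thesis using irr unfolding irreducible_smooth_def by blast
qed

lemma harm_map_zero:
  assumes irr: "irreducible_smooth T (Kgrp k) \<tau>" and h: "harm_map k \<tau> \<psi>"
  shows "\<psi> \<zero>\<^bsub>\<tau>\<^esub> = (\<lambda>_. 0)"
proof -
  interpret module complex_field \<tau> using irreducible_repD(2)[OF irr] .
  have "\<psi> \<zero>\<^bsub>\<tau>\<^esub> = \<psi> (0 \<odot>\<^bsub>\<tau>\<^esub> \<zero>\<^bsub>\<tau>\<^esub>)" using smult_r_null[of 0] by simp
  then show ?thesis using harm_mapD(3)[OF h, of "\<zero>\<^bsub>\<tau>\<^esub>" 0] by simp
qed

text \<open>The subspace on which two equivariant maps are proportional is invariant.\<close>

lemma harm_map_eq_on:
  fixes \<tau> :: "('a::nonarch_local_field pgl, 'v) rep"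
  assumes irr: "irreducible_smooth T (Kgrp k) \<tau>" and h: "harm_map k \<tau> \<psi>" "harm_map k \<tau> \<psi>'"
    and v: "v \<in> carrier \<tau>" "v \<noteq> \<zero>\<^bsub>\<tau>\<^esub>" "\<psi>' v = (\<lambda>x. c * \<psi> v x)" and w: "w \<in> carrier \<tau>"
  shows "\<psi>' w = (\<lambda>x. c * \<psi> w x)"
proof -
  interpret module complex_field \<tau> using irreducible_repD(2)[OF irr] .
  note D = irreducible_repD[OF irr]
  define W where "W = {w \<in> carrier \<tau>. \<psi>' w = (\<lambda>x. c * \<psi> w x)}"
  have "W = {\<zero>\<^bsub>\<tau>\<^esub>} \<or> W = carrier \<tau>"
  proof (rule irreducible_invariant[OF irr])
    show "\<zero>\<^bsub>\<tau>\<^esub> \<in> W" unfolding W_def using harm_map_zero[OF irr h(1)] harm_map_zero[OF irr h(2)] by simp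
    fix A :: "'a^2^2" and u assume A: "A \<in> stab k" and u: "u \<in> W"
    have u': "u \<in> carrier \<tau>" "\<psi>' u = (\<lambda>x. c * \<psi> u x)" using u unfolding W_def by auto
    have g: "act \<tau> (proj A) u \<in> carrier \<tau>" by (rule D(4)[OF A u'(1)])
    have e: "\<psi> (act \<tau> (proj A) u) = shift k A (\<psi> u)" "\<psi>' (act \<tau> (proj A) u) = shift k A (\<psi>' u)"
      using harm_mapD(4)[OF h(1) A u'(1)] harm_map_off[OF h(1) g] harm_mapD(4)[OF h(2) A u'(1)] harm_map_off[OF h(2) g]
      by (auto intro!: shift_eqI[OF A])
    show "act \<tau> (proj A) u \<in> W"
      unfolding W_def using g e u'(2) by (simp add: shift_def fun_eq_iff)
  qed (auto simp: W_def harm_mapD(2,3)[OF h(1)] harm_mapD(2,3)[OF h(2)] distrib_left mult.left_commute)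
  moreover have "v \<in> W" using v by (simp add: W_def)
  ultimately show ?thesis using v(2) w unfolding W_def by blast
qed

lemma harm_map_inj:
  assumes irr: "irreducible_smooth T (Kgrp k) \<tau>" and h: "harm_map k \<tau> \<psi>"
    and nz: "v0 \<in> carrier \<tau>" "\<psi> v0 \<noteq> (\<lambda>_. 0)" and vw: "v \<in> carrier \<tau>" "w \<in> carrier \<tau>" "\<psi> v = \<psi> w"
  shows "v = w"
proof -
  interpret module complex_field \<tau> using irreducible_repD(2)[OF irr] .
  have z: "u = \<zero>\<^bsub>\<tau>\<^esub>" if u: "u \<in> carrier \<tau>" "\<psi> u = (\<lambda>_. 0)" for u
  proof (rule ccontr)
    assume "u \<noteq> \<zero>\<^bsub>\<tau>\<^esub>"
    from harm_map_eq_on[OF irr h h u(1) this _ nz(1), of 0] u(2) have "\<psi> v0 = (\<lambda>_. 0)" by simp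
    then show False using nz(2) by blast
  qed
  have "\<psi> (v \<ominus>\<^bsub>\<tau>\<^esub> w) = (\<lambda>x. \<psi> v x + \<psi> ((-1) \<odot>\<^bsub>\<tau>\<^esub> w) x)"
  proof -
    have "v \<ominus>\<^bsub>\<tau>\<^esub> w = v \<oplus>\<^bsub>\<tau>\<^esub> ((-1) \<odot>\<^bsub>\<tau>\<^esub> w)"
    proof -
      have "\<ominus>\<^bsub>complex_field\<^esub> \<one>\<^bsub>complex_field\<^esub> = -1"
        by (rule R.minus_equality) simp_all
      then show ?thesis using smult_l_minus[of "\<one>\<^bsub>complex_field\<^esub>" w] smult_one[of w] vw by (simp add: a_minus_def)
    qed
    then show ?thesis using harm_mapD(2)[OF h vw(1), of "(-1) \<odot>\<^bsub>\<tau>\<^esub> w"] vw by simp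
  qed
  then have "\<psi> (v \<ominus>\<^bsub>\<tau>\<^esub> w) = (\<lambda>_. 0)" using harm_mapD(3)[OF h vw(2), of "-1"] vw(3) by simp
  then have "v \<ominus>\<^bsub>\<tau>\<^esub> w = \<zero>\<^bsub>\<tau>\<^esub>" using z vw by simp
  then show ?thesis using vw by (simp add: r_right_minus_eq)
qed

text \<open>The lower unipotent matrices that permute the tail fibre of the base arc at level \<open>l\<close> act trivially
  on the arcs of level \<open>k\<close>, hence on \<open>\<tau>\<close>, which embeds into the functions on these. A harmonic
  function in the image of \<open>\<psi>'\<close> is then constant on the fibre and so vanishes there.\<close>

lemma harm_map_separation:
  fixes \<tau> :: "('a::nonarch_local_field pgl, 'v) rep"
  assumes irr: "irreducible_smooth T (Kgrp k) \<tau>" and kl: "k < l" "even k = even l"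
    and h: "harm_map k \<tau> \<psi>" and nz: "v0 \<in> carrier \<tau>" "\<psi> v0 \<noteq> (\<lambda>_. 0)" and h': "harm_map l \<tau> \<psi>'"
    and v: "v \<in> carrier \<tau>"
  shows "\<psi>' v = (\<lambda>_. 0)"
proof -
  note D = irreducible_repD[OF irr]
  have stab: "stab l = (stab k :: ('a^2^2) set)" unfolding stab_def K_parity_def using kl(2) by simp
  have ahead: "ahead k \<le> ahead l - 1"
  proof -
    have "k + 2 \<le> l" using kl by (metis Suc_leI add_2_eq_Suc' even_Suc le_antisym not_less_eq_eq)
    then have "(k + 2) div 2 \<le> l div 2" by (rule div_le_mono)
    then show ?thesis unfolding ahead_def by simp
  qed
  have base0: "\<psi>' u (base_arc l) = 0" if u: "u \<in> carrier \<tau>" and bA: "base_arc l \<in> (Arcs l :: 'a vertex list set)" for u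
  proof -
    define F where "F = {y \<in> Arcs l. butlast y = butlast (base_arc l :: 'a vertex list)}"
    have "\<psi>' u y = \<psi>' u (base_arc l)" if "y \<in> F" for y
    proof -
      have y: "y \<in> Arcs l" "butlast y = butlast (lact (mat 1) (base_arc l))"
        using that unfolding F_def by (simp_all only: lact_one[OF base_vertices(1)] mem_Collect_eq)
      have one: "mat 1 \<in> stab l" using diag_stab[of 1 1 l] by (simp add: mat_M2)
      obtain \<gamma> where g: "nv \<gamma> \<le> nv (pw (ahead l - 1) :: 'a)" "y = lact (mat 1 ** M2 1 0 \<gamma> 1) (base_arc l)"
        using tail_fibre[OF one y] kl(1) by auto
      define n where "n = M2 1 0 \<gamma> 1"
      have yn: "y = lact n (base_arc l)" using g(2) by (simp add: n_def)
      have gk: "nv \<gamma> \<le> nv (pw (ahead k) :: 'a)" using g(1) pw_mono[OF ahead, where ?'a = 'a] by linarith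
      have nk: "n \<in> stab k" unfolding n_def
        using lower_unipotent_stab order_trans[OF gk pw_mono[OF behind_ahead(4)]] by blast
      have "act \<tau> (proj n) u = u"
      proof (rule harm_map_inj[OF irr h nz D(4)[OF nk u] u])
        have "\<psi> (act \<tau> (proj n) u) x = \<psi> u x" for x
        proof (cases "x \<in> Arcs k")
          case True
          then show ?thesis
            using harm_mapD(4)[OF h nk u True] lower_unipotent_trivial[OF gk True] unfolding n_def by simp
        qed (simp add: harm_map_off[OF h] D(4)[OF nk u] u)
        then show "\<psi> (act \<tau> (proj n) u) = \<psi> u" by blast
      qed
      then show ?thesis using harm_mapD(4)[OF h' _ u bA, of n] nk unfolding stab yn by simp
    qed
    then have "(\<Sum>y\<in>F. \<psi>' u y) = of_nat (card F) * \<psi>' u (base_arc l)" by simp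
    moreover have "(\<Sum>y\<in>F. \<psi>' u y) = 0"
      using harm_space_harmonic[OF harm_mapD(1)[OF h' u]] bA kl(1) unfolding harmonic_def F_def by simp
    moreover have "card F \<noteq> 0"
    proof -
      have "finite F" unfolding F_def by (rule finite_subset[OF _ finite_Arcs]) auto
      moreover have "base_arc l \<in> F" using bA unfolding F_def by simp
      ultimately show ?thesis by auto
    qed
    ultimately show ?thesis by simp
  qed
  show ?thesis
  proof
    fix x
    show "\<psi>' v x = 0"
    proof (cases "x \<in> Arcs l")
      case True
      obtain A where A: "A \<in> stab l" "x = lact A (base_arc l)" by (rule Arcs_transitive[OF True])
      have iA: "matrix_inv A \<in> stab k" using stab_inv[OF A(1)] stab by simp
      define u where "u = act \<tau> (proj (matrix_inv A)) v"
      have u: "u \<in> carrier \<tau>" unfolding u_def by (rule D(4)[OF iA v])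
      have "act \<tau> (proj A) u = v" unfolding u_def using A(1) stab v by (intro D(7)) auto
      then have "\<psi>' v x = \<psi>' u (base_arc l)"
        using harm_mapD(4)[OF h' A(1) u base_Arcs[OF True]] A(2) by simp
      then show ?thesis using base0[OF u base_Arcs[OF True]] by simp
    qed (simp add: harm_map_off[OF h' v])
  qed
qed

section \<open>Multiplicity one at each level\<close>

lemma linear_expand:
  fixes L :: "('e \<Rightarrow> complex) \<Rightarrow> 'e \<Rightarrow> complex"
  assumes I: "finite I" and add: "\<And>f g. L (\<lambda>x. f x + g x) = (\<lambda>x. L f x + L g x)"
    and mult: "\<And>c f. L (\<lambda>x. c * f x) = (\<lambda>x. c * L f x)"
  shows "L (\<lambda>x. \<Sum>i\<in>I. c i * u i x) = (\<lambda>x. \<Sum>i\<in>I. c i * L (u i) x)"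
  using I
proof (induction I rule: finite_induct)
  case empty
  then show ?case using mult[of 0] by simp
next
  case (insert i I)
  then show ?case using add[of "\<lambda>x. c i * u i x" "\<lambda>x. \<Sum>i\<in>I. c i * u i x"] mult[of "c i" "u i"] by simp
qed

definition delta :: "'e \<Rightarrow> 'e \<Rightarrow> complex" where
  "delta y x = (if x = y then 1 else 0)"

lemma delta_expand:
  assumes "finite E" "\<And>x. x \<notin> E \<Longrightarrow> f x = 0"
  shows "f = (\<lambda>x. \<Sum>y\<in>E. f y * delta y x)"
proof
  fix x
  show "f x = (\<Sum>y\<in>E. f y * delta y x)"
    unfolding delta_def using assms by (cases "x \<in> E") (auto simp: if_distrib sum.delta cong: if_cong)
qed

text \<open>For two equivariant maps \<open>\<psi>1 \<noteq> 0\<close> and \<open>\<psi>2\<close>, let \<open>P\<close> be the orthogonal projection onto the image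
  of \<open>\<psi>1\<close> and \<open>T = \<psi>2 \<psi>1\<^sup>-\<^sup>1 P\<close>. The matrices of \<open>P\<close> and \<open>T\<close> are symmetric, so transposing \<open>T P = T\<close>
  gives \<open>P T = T\<close>: the image of \<open>\<psi>2\<close> lies in that of \<open>\<psi>1\<close>, and Schur's lemma applies.\<close>

lemma harm_maps_proportional:
  fixes \<tau> :: "('a::nonarch_local_field pgl, 'v) rep"
  assumes irr: "irreducible_smooth TT (Kgrp k) \<tau>" and h1: "harm_map k \<tau> \<psi>1" and h2: "harm_map k \<tau> \<psi>2"
    and nz: "v0 \<in> carrier \<tau>" "\<psi>1 v0 \<noteq> (\<lambda>_. 0)"
  shows "\<exists>c. \<forall>v\<in>carrier \<tau>. \<psi>2 v = (\<lambda>x. c * \<psi>1 v x)"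
proof -
  interpret module complex_field \<tau> using irreducible_repD(2)[OF irr] .
  note Dr = irreducible_repD[OF irr]
  define E where "E = (Arcs k :: 'a vertex list set)"
  have finE: "finite E" unfolding E_def by (rule finite_Arcs)
  define W where "W = \<psi>1 ` carrier \<tau>"
  have WE: "\<exists>v. v \<in> carrier \<tau> \<and> f = \<psi>1 v" if "f \<in> W" for f using that unfolding W_def by (auto elim!: imageE)
  have WI: "\<psi>1 v \<in> W" if "v \<in> carrier \<tau>" for v unfolding W_def using that by (rule imageI)
  have smc: "c \<odot>\<^bsub>\<tau>\<^esub> v \<in> carrier \<tau>" if "v \<in> carrier \<tau>" for c v using smult_closed[of c v] that by simp
  have fsW: "function_space E W"
    unfolding function_space_def
  proof (intro conjI ballI allI impI)
    show "(\<lambda>_. 0) \<in> W" using WI[OF zero_closed] harm_map_zero[OF irr h1] by simp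
  next
    fix f g assume fg: "f \<in> W" "g \<in> W"
    obtain v w where "v \<in> carrier \<tau>" "w \<in> carrier \<tau>" "f = \<psi>1 v" "g = \<psi>1 w" using WE[OF fg(1)] WE[OF fg(2)] by metis
    then show "(\<lambda>x. f x + g x) \<in> W" using WI[of "v \<oplus>\<^bsub>\<tau>\<^esub> w"] by (simp add: harm_mapD(2)[OF h1])
  next
    fix c f assume "f \<in> W"
    then obtain v where "v \<in> carrier \<tau>" "f = \<psi>1 v" using WE by metis
    then show "(\<lambda>x. c * f x) \<in> W" using WI[OF smc[of v c]] by (simp add: harm_mapD(3)[OF h1])
  next
    fix f x assume "f \<in> W" "x \<notin> E"
    then show "f x = 0" unfolding W_def E_def using harm_map_off[OF h1] by auto
  qed
  have WN: "W \<subseteq> harm_space k" unfolding W_def using harm_mapD(1)[OF h1] by auto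
  define pre where "pre = inv_into (carrier \<tau>) \<psi>1"
  have chi: "pre (\<psi>1 v) = v" if "v \<in> carrier \<tau>" for v
    unfolding pre_def by (rule inv_into_f_f[OF inj_onI that]) (rule harm_map_inj[OF irr h1 nz])
  define S where "S w = \<psi>2 (pre w)" for w
  have S: "S (\<psi>1 v) = \<psi>2 v" if "v \<in> carrier \<tau>" for v unfolding S_def chi[OF that] ..
  have S_add: "S (\<lambda>x. f x + g x) = (\<lambda>x. S f x + S g x)" if fg: "f \<in> W" "g \<in> W" for f g
  proof -
    obtain v w where vw: "v \<in> carrier \<tau>" "w \<in> carrier \<tau>" "f = \<psi>1 v" "g = \<psi>1 w"
      using WE[OF fg(1)] WE[OF fg(2)] by metis
    have "S (\<psi>1 (v \<oplus>\<^bsub>\<tau>\<^esub> w)) = \<psi>2 (v \<oplus>\<^bsub>\<tau>\<^esub> w)" using vw by (intro S) simp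
    then show ?thesis using vw by (simp add: harm_mapD(2)[OF h1] harm_mapD(2)[OF h2] S)
  qed
  have S_mult: "S (\<lambda>x. c * f x) = (\<lambda>x. c * S f x)" if fW: "f \<in> W" for c f
  proof -
    obtain v where v: "v \<in> carrier \<tau>" "f = \<psi>1 v" using WE[OF fW] by metis
    have "S (\<psi>1 (c \<odot>\<^bsub>\<tau>\<^esub> v)) = \<psi>2 (c \<odot>\<^bsub>\<tau>\<^esub> v)" using v smc by (intro S)
    then show ?thesis using v by (simp add: harm_mapD(3)[OF h1] harm_mapD(3)[OF h2] S)
  qed
  have psi_shift: "\<psi> (act \<tau> (proj A) v) = shift k A (\<psi> v)"
    if "harm_map k \<tau> \<psi>" "A \<in> stab k" "v \<in> carrier \<tau>" for \<psi> and A :: "'a^2^2" and v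
    by (rule shift_eqI[OF that(2)]) (use harm_mapD(4)[OF that] harm_map_off[OF that(1) Dr(4)[OF that(2,3)]] in auto)
  have S_shift: "S (shift k A f) = shift k A (S f)" "shift k A f \<in> W" if A: "A \<in> stab k" and fW: "f \<in> W" for A f
  proof -
    obtain v where v: "v \<in> carrier \<tau>" "f = \<psi>1 v" using WE[OF fW] by metis
    have e: "shift k A f = \<psi>1 (act \<tau> (proj A) v)" unfolding v(2) by (rule psi_shift[OF h1 A v(1), symmetric])
    then show "shift k A f \<in> W" using WI[OF Dr(4)[OF A v(1)]] by simp
    show "S (shift k A f) = shift k A (S f)"
      unfolding e S[OF Dr(4)[OF A v(1)]] psi_shift[OF h2 A v(1)] unfolding v(2) S[OF v(1)] ..
  qed
  define P where "P = proj_on E W"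
  have PW: "P f \<in> W" for f unfolding P_def by (rule proj_on(1)[OF finE fsW])
  have P_add: "P (\<lambda>x. f x + g x) = (\<lambda>x. P f x + P g x)" for f g unfolding P_def by (rule proj_on_linear(1)[OF finE fsW])
  have P_mult: "P (\<lambda>x. c * f x) = (\<lambda>x. c * P f x)" for c f unfolding P_def by (rule proj_on_linear(2)[OF finE fsW])
  have P_id: "P f = f" if "f \<in> W" for f unfolding P_def by (rule proj_on_id[OF finE fsW that])
  have P_shift: "P (shift k A f) = shift k A (P f)" if A: "A \<in> stab k" for A f
    unfolding P_def
  proof (rule proj_on_unique[OF finE fsW])
    show "shift k A (proj_on E W f) \<in> W" using S_shift(2)[OF A PW] unfolding P_def .
    fix s assume "s \<in> W"
    then obtain v where v: "v \<in> carrier \<tau>" "s = \<psi>1 v" using WE by metis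
    define v' where "v' = act \<tau> (proj (matrix_inv A)) v"
    have v': "v' \<in> carrier \<tau>" "act \<tau> (proj A) v' = v" unfolding v'_def using Dr(4)[OF stab_inv[OF A] v(1)] Dr(7)[OF A v(1)] by auto
    have s: "s = shift k A (\<psi>1 v')" using psi_shift[OF h1 A v'(1)] v'(2) v(2) by simp
    have "(\<lambda>x. shift k A f x - shift k A (proj_on E W f) x) = shift k A (\<lambda>x. f x - proj_on E W f x)"
      by (auto simp: shift_def)
    then have "inner_on E (\<lambda>x. shift k A f x - shift k A (proj_on E W f) x) s = inner_on E (\<lambda>x. f x - proj_on E W f x) (\<psi>1 v')"
      unfolding s E_def by (simp only: inner_shift[OF A])
    also have "\<dots> = 0" by (rule proj_on(2)[OF finE fsW WI[OF v'(1)]])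
    finally show "inner_on E (\<lambda>x. shift k A f x - shift k A (proj_on E W f) x) s = 0" .
  qed
  define T where "T f = S (P f)" for f
  have T_add: "T (\<lambda>x. f x + g x) = (\<lambda>x. T f x + T g x)" for f g unfolding T_def P_add by (rule S_add[OF PW PW])
  have T_mult: "T (\<lambda>x. c * f x) = (\<lambda>x. c * T f x)" for c f unfolding T_def P_mult by (rule S_mult[OF PW])
  have T_shift: "T (shift k A f) = shift k A (T f)" if "A \<in> stab k" for A f
    unfolding T_def P_shift[OF that] by (rule S_shift(1)[OF that PW])
  have TN: "T f \<in> harm_space k" for f
  proof -
    obtain v where "v \<in> carrier \<tau>" "P f = \<psi>1 v" using WE[OF PW[of f]] by metis
    then show ?thesis unfolding T_def using S harm_mapD(1)[OF h2] by simp
  qed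
  have T_off: "T f x = 0" if "x \<notin> E" for f x
    using function_spaceD(4)[OF function_space_harm_space TN] that unfolding E_def by blast
  have P_off: "P f x = 0" if "x \<notin> E" for f x using function_spaceD(4)[OF fsW PW that] .
  have PP: "P (P f) = P f" for f by (rule P_id[OF PW])
  have TP: "T (P f) = T f" for f unfolding T_def PP ..
  have delta_shift: "shift k A (delta y) = delta (lact A y)" if "A \<in> stab k" "y \<in> E" for A y
  proof (rule shift_eqI[OF that(1), symmetric])
    fix x :: "'a vertex list" assume "x \<in> Arcs k"
    then show "delta (lact A y) (lact A x) = delta y x"
      using lact_inv_Arcs(1)[OF that(1), of x] lact_inv_Arcs(1)[OF that(1), of y] that(2) unfolding delta_def E_def by metis
  next
    fix x :: "'a vertex list" assume "x \<notin> Arcs k"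
    then show "delta (lact A y) x = 0" using Arcs_lact[OF that(1), of y] that(2) unfolding delta_def E_def by auto
  qed
  \<comment> \<open>The matrix of an equivariant operator that vanishes wherever \<open>P\<close> does is harmonic in the column
    index, because the indicator functions of fibres are orthogonal to \<open>W\<close>.\<close>
  have sym: "L (delta y) x = L (delta x) y"
    if L_add: "\<And>f g. L (\<lambda>x. f x + g x) = (\<lambda>x. L f x + L g x)" and L_mult: "\<And>c f. L (\<lambda>x. c * f x) = (\<lambda>x. c * L f x)"
      and L_shift: "\<And>A f. A \<in> stab k \<Longrightarrow> L (shift k A f) = shift k A (L f)"
      and L_P: "\<And>f. P f = (\<lambda>_. 0) \<Longrightarrow> L f = (\<lambda>_. 0)" and xy: "x \<in> E" "y \<in> E" for L x y
  proof -
    have "harmonic k (\<lambda>y. L (delta y) x)" for x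
    proof -
      have van: "(\<Sum>y\<in>F. L (delta y) x) = 0" if F: "F \<subseteq> E" "\<And>w. w \<in> W \<Longrightarrow> (\<Sum>y\<in>F. w y) = 0" for F
      proof -
        have finF: "finite F" using finite_subset[OF F(1) finE] .
        define g where "g = (\<lambda>x. \<Sum>y\<in>F. 1 * delta y x)"
        have g: "g z = (if z \<in> F then 1 else 0)" for z
          unfolding g_def delta_def using finF by simp
        have inner_g: "inner_on E g w = cnj (\<Sum>y\<in>F. w y)" for w
        proof -
          have "inner_on E g w = (\<Sum>y\<in>F. cnj (w y))"
            unfolding inner_on_def g by (rule sum.mono_neutral_cong_right) (use finE F(1) in auto)
          then show ?thesis by simp
        qed
        have "P g = (\<lambda>_. 0)" unfolding P_def
          by (rule proj_on_eq_0[OF finE fsW]) (simp only: inner_g F(2) complex_cnj_zero)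
        then have "L g = (\<lambda>_. 0)" by (rule L_P)
        moreover have "L g = (\<lambda>x. \<Sum>y\<in>F. 1 * L (delta y) x)"
          unfolding g_def by (rule linear_expand[OF finF L_add L_mult])
        ultimately show ?thesis by (simp add: fun_eq_iff)
      qed
      show ?thesis
        unfolding harmonic_def
      proof (intro impI ballI conjI)
        fix z :: "'a vertex list" assume k: "1 \<le> k" and z: "z \<in> Arcs k"
        have "harmonic k w" if "w \<in> W" for w using harm_space_harmonic WN that by blast
        then show "(\<Sum>y\<in>{y \<in> Arcs k. butlast y = butlast z}. L (delta y) x) = 0"
          "(\<Sum>y\<in>{y \<in> Arcs k. tl y = tl z}. L (delta y) x) = 0"
          using k z unfolding harmonic_def by (intro van; auto simp: E_def)+
      qed
    qed
    then show ?thesis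
    proof (intro harmonic_kernel_symmetric[of k "\<lambda>x y. L (delta y) x"])
      fix A :: "'a^2^2" and x y :: "'a vertex list" assume A: "A \<in> stab k" "x \<in> Arcs k" "y \<in> Arcs k"
      have "L (delta (lact A y)) = shift k A (L (delta y))"
        using delta_shift[OF A(1), of y] A(3) L_shift[OF A(1)] unfolding E_def by metis
      then show "L (delta (lact A y)) (lact A x) = L (delta y) x" using shift_lact[OF A(1,2)] by simp
    qed (use xy E_def in auto)
  qed
  have T_P0: "T f = (\<lambda>_. 0)" if "P f = (\<lambda>_. 0)" for f
    unfolding T_def that using S[OF zero_closed] harm_map_zero[OF irr h1] harm_map_zero[OF irr h2] by simp
  have symT: "T (delta y) x = T (delta x) y" and symP: "P (delta y) x = P (delta x) y" if "x \<in> E" "y \<in> E" for x y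
    using sym[OF T_add T_mult T_shift T_P0 that] sym[OF P_add P_mult P_shift _ that] by auto
  have exT: "T f x = (\<Sum>z\<in>E. f z * T (delta z) x)" and exP: "P f x = (\<Sum>z\<in>E. f z * P (delta z) x)"
    if "\<And>x. x \<notin> E \<Longrightarrow> f x = 0" for f x
  proof -
    note e = delta_expand[OF finE that]
    have "T f = T (\<lambda>x. \<Sum>y\<in>E. f y * delta y x)" by (rule arg_cong[of f _ T]) (rule e)
    also have "\<dots> = (\<lambda>x. \<Sum>y\<in>E. f y * T (delta y) x)" by (rule linear_expand[where u = delta and c = f, OF finE T_add T_mult])
    finally show "T f x = (\<Sum>z\<in>E. f z * T (delta z) x)" by (rule fun_cong)
    have "P f = P (\<lambda>x. \<Sum>y\<in>E. f y * delta y x)" by (rule arg_cong[of f _ P]) (rule e)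
    also have "\<dots> = (\<lambda>x. \<Sum>y\<in>E. f y * P (delta y) x)" by (rule linear_expand[where u = delta and c = f, OF finE P_add P_mult])
    finally show "P f x = (\<Sum>z\<in>E. f z * P (delta z) x)" by (rule fun_cong)
  qed
  \<comment> \<open>The transpose of the identity \<open>T P = T\<close>.\<close>
  have TdW: "T (delta y) \<in> W" if y: "y \<in> E" for y
  proof -
    have "T (delta y) x = P (T (delta y)) x" for x
    proof (cases "x \<in> E")
      case True
      have "T (delta y) x = T (P (delta x)) y" unfolding TP by (rule symT[OF True y])
      also have "\<dots> = (\<Sum>z\<in>E. P (delta x) z * T (delta z) y)" by (rule exT) (rule P_off)
      also have "\<dots> = (\<Sum>z\<in>E. T (delta y) z * P (delta z) x)"
        by (rule sum.cong[OF refl]) (simp add: symT[OF y] symP[OF _ True])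
      also have "\<dots> = P (T (delta y)) x" by (rule exP[symmetric]) (rule T_off)
      finally show ?thesis .
    next
      case False
      then show ?thesis using T_off P_off by simp
    qed
    then have "T (delta y) = P (T (delta y))" by (rule ext)
    then show ?thesis using PW[of "T (delta y)"] by (simp only: back_subst[of "\<lambda>f. f \<in> W"])
  qed
  have SW: "S w \<in> W" if "w \<in> W" for w
  proof -
    have "T w = (\<lambda>x. \<Sum>z\<in>E. w z * T (delta z) x)" using exT function_spaceD(4)[OF fsW that] by blast
    also have "\<dots> \<in> W" by (intro function_space_sum[OF fsW finE] function_spaceD(3)[OF fsW] TdW)
    finally show ?thesis unfolding T_def P_id[OF that] .
  qed
  have v0W: "\<psi>1 v0 \<in> W" by (rule WI[OF nz(1)])
  obtain c w where cw: "w \<in> W" "w \<noteq> (\<lambda>_. 0)" "S w = (\<lambda>x. c * w x)"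
    using eigenvector_exists[of E W "\<psi>1 v0" S, OF finE fsW v0W nz(2) SW S_add S_mult] by metis
  obtain v where v: "v \<in> carrier \<tau>" "w = \<psi>1 v" using WE[OF cw(1)] by metis
  have "v \<noteq> \<zero>\<^bsub>\<tau>\<^esub>" using cw(2) v(2) harm_map_zero[OF irr h1] by auto
  then have "\<psi>2 u = (\<lambda>x. c * \<psi>1 u x)" if "u \<in> carrier \<tau>" for u
    using harm_map_eq_on[OF irr h1 h2 v(1) _ _ that] cw(3) S[OF v(1)] v(2) by simp
  then show ?thesis by blast
qed

section \<open>The cohomology space and its harmonic representatives\<close>

lemma ring_complex_field: "ring complex_field" "cring complex_field" "Ring.field complex_field"
  by (rule ring_from_type_algebra cring_from_type_algebra field_from_type_algebra)+

lemma C_simps: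
  "carrier (C0 \<Sigma>) = verts \<Sigma> \<rightarrow>\<^sub>E UNIV" "carrier (C1 \<Sigma>) = arcs \<Sigma> \<rightarrow>\<^sub>E UNIV"
  "f \<oplus>\<^bsub>C1 \<Sigma>\<^esub> g = (\<lambda>x\<in>arcs \<Sigma>. f x + g x)" "c \<odot>\<^bsub>C1 \<Sigma>\<^esub> f = (\<lambda>x\<in>arcs \<Sigma>. c * f x)"
  unfolding C0_def C1_def ring.func_space_def[OF ring_complex_field(1)] by simp_all

lemma Sigma_head_tail: "head (Sigma_graph k) = tl" "tail (Sigma_graph k) = butlast"
  unfolding Sigma_graph_def path_graph_def by (simp_all add: Let_def)

lemma Sigma_wf:
  fixes x :: "'a::nonarch_local_field vertex list"
  assumes "x \<in> Arcs k"
  shows "tl x \<in> verts (Sigma_graph k)" "butlast x \<in> verts (Sigma_graph k)"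
proof -
  have p: "x \<in> paths (Suc k)" using assms Arcs_iff by blast
  have l: "length x = Suc (Suc k)" "distinct x" "set x \<subseteq> vertices" and adj: "\<And>i. i < Suc k \<Longrightarrow> adjacent (x ! i) (x ! Suc i)"
    using p unfolding paths_def by auto
  have tp: "tl x \<in> paths k"
    using l adj unfolding paths_def by (auto simp: nth_tl distinct_tl dest: list.set_sel(2)[rotated])
  have bp: "butlast x \<in> paths k"
    using l adj unfolding paths_def by (auto simp: nth_butlast distinct_butlast dest: in_set_butlastD)
  have n: "tl x ! i = x ! Suc i" "butlast x ! i = x ! i" if "i \<le> k" for i
    using that l by (auto simp: nth_tl nth_butlast)
  have kd: "k div 2 \<le> k" by simp
  have verts: "verts (Sigma_graph k) = {y \<in> paths k. if even k then middle y \<subseteq> {apt_vertex 0, apt_vertex 1} else apt_vertex 0 \<in> middle y}"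
    unfolding Sigma_graph_def Let_def s0_apt s1_apt path_graph_def by simp
  have mid: "middle y = (if even k then {y ! (k div 2)} else {y ! (k div 2), y ! Suc (k div 2)})" if "y \<in> paths k" for y :: "'a vertex list"
    using that unfolding middle_def paths_def Let_def by simp
  show "tl x \<in> verts (Sigma_graph k)" "butlast x \<in> verts (Sigma_graph k)"
  proof -
    have "tl x \<in> verts (Sigma_graph k) \<and> butlast x \<in> verts (Sigma_graph k)"
    proof (cases "even k")
      case True
      then have "nat (behind k) = k div 2" unfolding behind_def by (auto elim!: evenE)
      then show ?thesis using assms True tp bp n[OF kd] mid unfolding verts Arcs_iff by simp
    next
      case False
      then have q: "nat (behind k) = Suc (k div 2)" "Suc (k div 2) \<le> k" unfolding behind_def by (auto elim!: oddE)
      then show ?thesis using assms False tp bp n[OF kd] n[OF q(2)] mid unfolding verts Arcs_iff by simp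
    qed
    then show "tl x \<in> verts (Sigma_graph k)" "butlast x \<in> verts (Sigma_graph k)" by auto
  qed
qed

text \<open>The elements of the cohomology space, described pointwise instead of by operations on sets.\<close>

definition coset :: "nat \<Rightarrow> ('a::nonarch_local_field vertex list \<Rightarrow> complex) \<Rightarrow> ('a vertex list \<Rightarrow> complex) set" where
  "coset k f = {h \<in> extensional (Arcs k). \<exists>g. \<forall>x\<in>Arcs k. h x = f x + (g (tl x) - g (butlast x))}"

lemma cosetI:
  assumes "h \<in> extensional (Arcs k)" "\<And>x. x \<in> Arcs k \<Longrightarrow> h x = f x + (g (tl x) - g (butlast x))"
  shows "h \<in> coset k f"
  using assms unfolding coset_def by blast

lemma cosetE:
  assumes "h \<in> coset k f"
  obtains g where "h \<in> extensional (Arcs k)" "\<And>x. x \<in> Arcs k \<Longrightarrow> h x = f x + (g (tl x) - g (butlast x))"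
  using assms unfolding coset_def by blast

lemma coset_refl: "restrict f (Arcs k) \<in> coset k f"
  by (rule cosetI[where g = "\<lambda>_. 0"]) auto

lemma coboundaries_coset: "coboundaries (Sigma_graph k) = coset k (\<lambda>_. 0)"
proof (intro equalityI subsetI)
  fix h :: "'a vertex list \<Rightarrow> complex" assume "h \<in> coboundaries (Sigma_graph k)"
  then obtain g where h: "h = coboundary (Sigma_graph k) g" unfolding coboundaries_def by blast
  show "h \<in> coset k (\<lambda>_. 0)"
    by (rule cosetI[where g = g]) (simp_all add: h coboundary_def Sigma_head_tail)
next
  fix h :: "'a vertex list \<Rightarrow> complex" assume "h \<in> coset k (\<lambda>_. 0)"
  then obtain g where h: "h \<in> extensional (Arcs k)" "\<And>x. x \<in> Arcs k \<Longrightarrow> h x = 0 + (g (tl x) - g (butlast x))"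
    by (rule cosetE) blast
  have "h = coboundary (Sigma_graph k) (restrict g (verts (Sigma_graph k)))"
    unfolding coboundary_def Sigma_head_tail
    by (rule extensionalityI[OF h(1)]) (simp_all add: Sigma_wf h(2))
  then show "h \<in> coboundaries (Sigma_graph k)" unfolding coboundaries_def C_simps by auto
qed

lemma set_add_coset: "set_add (C1 (Sigma_graph k)) (coset k f) (coset k f') = coset k (\<lambda>x. f x + f' x)"
proof (intro equalityI subsetI)
  fix h :: "'a vertex list \<Rightarrow> complex" assume "h \<in> set_add (C1 (Sigma_graph k)) (coset k f) (coset k f')"
  then obtain h1 h2 where h12: "h1 \<in> coset k f" "h2 \<in> coset k f'" and h: "h = (\<lambda>x\<in>Arcs k. h1 x + h2 x)"
    unfolding set_add_def' C_simps by blast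
  obtain g where g: "\<And>x. x \<in> Arcs k \<Longrightarrow> h1 x = f x + (g (tl x) - g (butlast x))" using h12(1) by (rule cosetE) blast
  obtain g' where g': "\<And>x. x \<in> Arcs k \<Longrightarrow> h2 x = f' x + (g' (tl x) - g' (butlast x))" using h12(2) by (rule cosetE) blast
  show "h \<in> coset k (\<lambda>x. f x + f' x)"
    by (rule cosetI[where g = "\<lambda>v. g v + g' v"]) (simp_all add: h g g')
next
  fix h :: "'a vertex list \<Rightarrow> complex" assume "h \<in> coset k (\<lambda>x. f x + f' x)"
  then obtain g where h: "h \<in> extensional (Arcs k)" "\<And>x. x \<in> Arcs k \<Longrightarrow> h x = f x + f' x + (g (tl x) - g (butlast x))"
    by (rule cosetE) blast
  define h1 where "h1 = (\<lambda>x\<in>Arcs k. f x + (g (tl x) - g (butlast x)))"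
  have "h1 \<in> coset k f" by (rule cosetI[where g = g]) (simp_all add: h1_def)
  moreover have "h = h1 \<oplus>\<^bsub>C1 (Sigma_graph k)\<^esub> restrict f' (Arcs k)"
    unfolding C_simps by (rule extensionalityI[OF h(1)]) (simp_all add: h(2) h1_def)
  ultimately show "h \<in> set_add (C1 (Sigma_graph k)) (coset k f) (coset k f')"
    unfolding set_add_def' using coset_refl by blast
qed

lemma H1_carrier: "carrier (H1_Sigma k) = range (coset k)"
proof -
  have *: "a_r_coset (C1 (Sigma_graph k)) (coboundaries (Sigma_graph k)) f = coset k f" for f :: "'a vertex list \<Rightarrow> complex"
    unfolding a_r_coset_def' coboundaries_coset
  proof (intro equalityI subsetI)
    fix h assume "h \<in> (\<Union>h\<in>coset k (\<lambda>_. 0). {h \<oplus>\<^bsub>C1 (Sigma_graph k)\<^esub> f})"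
    then obtain h1 where h1: "h1 \<in> coset k (\<lambda>_. 0)" and h: "h = (\<lambda>x\<in>Arcs k. h1 x + f x)"
      unfolding C_simps by blast
    obtain g where g: "\<And>x. x \<in> Arcs k \<Longrightarrow> h1 x = 0 + (g (tl x) - g (butlast x))" using h1 by (rule cosetE) blast
    show "h \<in> coset k f" by (rule cosetI[where g = g]) (simp_all add: h g)
  next
    fix h assume "h \<in> coset k f"
    then obtain g where h: "h \<in> extensional (Arcs k)" "\<And>x. x \<in> Arcs k \<Longrightarrow> h x = f x + (g (tl x) - g (butlast x))"
      by (rule cosetE) blast
    define h1 where "h1 = (\<lambda>x\<in>Arcs k. g (tl x) - g (butlast x))"
    have "h1 \<in> coset k (\<lambda>_. 0)" by (rule cosetI[where g = g]) (simp_all add: h1_def)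
    moreover have "h = h1 \<oplus>\<^bsub>C1 (Sigma_graph k)\<^esub> f"
      unfolding C_simps by (rule extensionalityI[OF h(1)]) (simp_all add: h(2) h1_def)
    ultimately show "h \<in> (\<Union>h\<in>coset k (\<lambda>_. 0). {h \<oplus>\<^bsub>C1 (Sigma_graph k)\<^esub> f})" by blast
  qed
  have "carrier (H1_Sigma k :: ('a pgl, ('a vertex list \<Rightarrow> complex) set) rep) = coset k ` (Arcs k \<rightarrow>\<^sub>E UNIV)"
    unfolding H1_Sigma_def H1_def A_RCOSETS_def' C_simps by (simp add: * UNION_singleton_eq_range)
  moreover have "coset k f \<in> coset k ` (Arcs k \<rightarrow>\<^sub>E UNIV)" for f :: "'a vertex list \<Rightarrow> complex"
  proof (rule image_eqI)
    show "coset k f = coset k (restrict f (Arcs k))" unfolding coset_def by simp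
  qed simp
  ultimately show ?thesis by auto
qed

lemma H1_zero: "\<zero>\<^bsub>H1_Sigma k\<^esub> = coset k (\<lambda>_. 0)"
  unfolding H1_Sigma_def H1_def by (simp add: coboundaries_coset)

lemma H1_add: "coset k f \<oplus>\<^bsub>H1_Sigma k\<^esub> coset k f' = coset k (\<lambda>x. f x + f' x)"
  unfolding H1_Sigma_def H1_def by (simp add: set_add_coset)

lemma H1_smult: "c \<odot>\<^bsub>H1_Sigma k\<^esub> coset k f = coset k (\<lambda>x. c * f x)"
proof -
  have "set_add (C1 (Sigma_graph k)) (coset k (\<lambda>_. 0)) ((\<lambda>f. c \<odot>\<^bsub>C1 (Sigma_graph k)\<^esub> f) ` coset k f) = coset k (\<lambda>x. c * f x)"
  proof (intro equalityI subsetI)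
    fix h assume "h \<in> set_add (C1 (Sigma_graph k)) (coset k (\<lambda>_. 0)) ((\<lambda>f. c \<odot>\<^bsub>C1 (Sigma_graph k)\<^esub> f) ` coset k f)"
    then obtain h1 h2 where h12: "h1 \<in> coset k (\<lambda>_. 0)" "h2 \<in> coset k f"
      and h: "h = (\<lambda>x\<in>Arcs k. h1 x + (\<lambda>x\<in>Arcs k. c * h2 x) x)"
      unfolding set_add_def' C_simps by blast
    obtain g where g: "\<And>x. x \<in> Arcs k \<Longrightarrow> h1 x = 0 + (g (tl x) - g (butlast x))" using h12(1) by (rule cosetE) blast
    obtain g' where g': "\<And>x. x \<in> Arcs k \<Longrightarrow> h2 x = f x + (g' (tl x) - g' (butlast x))" using h12(2) by (rule cosetE) blast
    show "h \<in> coset k (\<lambda>x. c * f x)"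
      by (rule cosetI[where g = "\<lambda>v. g v + c * g' v"]) (simp_all add: h g g' algebra_simps)
  next
    fix h assume "h \<in> coset k (\<lambda>x. c * f x)"
    then obtain g where h: "h \<in> extensional (Arcs k)" "\<And>x. x \<in> Arcs k \<Longrightarrow> h x = c * f x + (g (tl x) - g (butlast x))"
      by (rule cosetE) blast
    define h1 where "h1 = (\<lambda>x\<in>Arcs k. g (tl x) - g (butlast x))"
    have "h1 \<in> coset k (\<lambda>_. 0)" by (rule cosetI[where g = g]) (simp_all add: h1_def)
    moreover have "h = h1 \<oplus>\<^bsub>C1 (Sigma_graph k)\<^esub> (c \<odot>\<^bsub>C1 (Sigma_graph k)\<^esub> restrict f (Arcs k))"
      unfolding C_simps by (rule extensionalityI[OF h(1)]) (simp_all add: h(2) h1_def)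
    ultimately show "h \<in> set_add (C1 (Sigma_graph k)) (coset k (\<lambda>_. 0)) ((\<lambda>f. c \<odot>\<^bsub>C1 (Sigma_graph k)\<^esub> f) ` coset k f)"
      unfolding set_add_def' using coset_refl by blast
  qed
  then show ?thesis unfolding H1_Sigma_def H1_def by (simp add: coboundaries_coset)
qed

lemma H1_act:
  assumes A: "A \<in> stab k"
  shows "act (H1_Sigma k) (proj A) (coset k f) = coset k (shift k A f)"
proof -
  have Ai: "invertible A" by (rule stab_invertible[OF A])
  note iA = Arcs_lact[OF stab_inv[OF A]]
  have "act (H1_Sigma k) (proj A) (coset k f) = (\<lambda>f. \<lambda>x\<in>Arcs k. f (lact (matrix_inv A) x)) ` coset k f"
    unfolding H1_Sigma_def H1_def by (simp add: proj_inv[OF Ai])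
  also have "\<dots> = coset k (shift k A f)"
  proof (intro equalityI subsetI)
    fix h assume "h \<in> (\<lambda>f. \<lambda>x\<in>Arcs k. f (lact (matrix_inv A) x)) ` coset k f"
    then obtain h1 where h1: "h1 \<in> coset k f" and h: "h = (\<lambda>x\<in>Arcs k. h1 (lact (matrix_inv A) x))" by blast
    obtain g where g: "\<And>x. x \<in> Arcs k \<Longrightarrow> h1 x = f x + (g (tl x) - g (butlast x))" using h1 by (rule cosetE) blast
    show "h \<in> coset k (shift k A f)"
      by (rule cosetI[where g = "\<lambda>v. g (lact (matrix_inv A) v)"]) (simp_all add: h g iA shift_def map_tl map_butlast)
  next
    fix h assume "h \<in> coset k (shift k A f)"
    then obtain g where h: "h \<in> extensional (Arcs k)" "\<And>x. x \<in> Arcs k \<Longrightarrow> h x = shift k A f x + (g (tl x) - g (butlast x))"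
      by (rule cosetE) blast
    define h1 where "h1 = (\<lambda>x\<in>Arcs k. f x + (g (lact A (tl x)) - g (lact A (butlast x))))"
    have "h1 \<in> coset k f" by (rule cosetI[where g = "\<lambda>v. g (lact A v)"]) (simp_all add: h1_def)
    moreover have "h = (\<lambda>x\<in>Arcs k. h1 (lact (matrix_inv A) x))"
    proof (rule extensionalityI[OF h(1)])
      fix x :: "'a vertex list" assume x: "x \<in> Arcs k"
      note i = lact_inv_Arcs(2)[OF A x]
      have "lact A (tl (lact (matrix_inv A) x)) = tl x" "lact A (butlast (lact (matrix_inv A) x)) = butlast x"
        by (simp_all only: map_tl map_butlast i)
      then show "h x = (\<lambda>x\<in>Arcs k. h1 (lact (matrix_inv A) x)) x"
        unfolding h1_def using x iA[OF x] h(2)[OF x] by (simp only: restrict_apply' shift_def if_True)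
    qed simp
    ultimately show "h \<in> (\<lambda>f. \<lambda>x\<in>Arcs k. f (lact (matrix_inv A) x)) ` coset k f" by blast
  qed
  finally show ?thesis .
qed

lemma coset_inj:
  assumes "f \<in> harm_space k" "f' \<in> harm_space k" "coset k f = coset k f'"
  shows "f = f'"
proof -
  define d where "d = (\<lambda>x. f x - f' x)"
  have d: "d \<in> harm_space k" unfolding d_def by (rule function_space_diff[OF function_space_harm_space assms(1,2)])
  have "restrict f (Arcs k) \<in> coset k f'" using coset_refl[of f k] assms(3) by simp
  then obtain g where g': "\<And>x. x \<in> Arcs k \<Longrightarrow> restrict f (Arcs k) x = f' x + (g (tl x) - g (butlast x))"
    by (rule cosetE) blast
  have g: "d x = g (tl x) - g (butlast x)" if "x \<in> Arcs k" for x
    using g'[OF that] that unfolding d_def by simp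
  have "inner_on (Arcs k) d d = (\<Sum>x\<in>Arcs k. d x * cnj (g (tl x) - g (butlast x)))"
    unfolding inner_on_def by (rule sum.cong[OF refl]) (simp only: g)
  also have "\<dots> = 0"
  proof -
    have "\<forall>g. (\<Sum>x\<in>Arcs k. d x * cnj (g (tl x) - g (butlast x))) = 0" using d unfolding harm_space_def by simp
    then show ?thesis ..
  qed
  finally have "inner_on (Arcs k) d d = 0" .
  then have z: "\<forall>x\<in>Arcs k. d x = 0" by (rule iffD1[OF inner_on_self[OF finite_Arcs]])
  show ?thesis
  proof
    fix x
    show "f x = f' x"
      using z function_spaceD(4)[OF function_space_harm_space d, of x] unfolding d_def by (cases "x \<in> Arcs k") auto
  qed
qed

text \<open>Subtract the orthogonal projection onto the coboundaries.\<close>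

lemma coset_harmonic_representative:
  fixes f :: "'a::nonarch_local_field vertex list \<Rightarrow> complex"
  shows "\<exists>n\<in>harm_space k. coset k n = coset k f"
proof -
  define E where "E = (Arcs k :: 'a vertex list set)"
  define d where "d g = (\<lambda>x. if x \<in> E then g (tl x) - g (butlast x) else (0::complex))" for g :: "'a vertex list \<Rightarrow> complex"
  define B where "B = range d"
  have dB: "d g \<in> B" for g unfolding B_def by simp
  have dS: "function_space E B"
    unfolding function_space_def
  proof (intro conjI ballI allI impI)
    have "d (\<lambda>_. 0) = (\<lambda>_. 0)" by (auto simp: d_def)
    then show "(\<lambda>_. 0) \<in> B" using dB[of "\<lambda>_. 0"] by simp
  next
    fix f g assume "f \<in> B" "g \<in> B"
    then obtain a b where "f = d a" "g = d b" unfolding B_def by blast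
    then have "(\<lambda>x. f x + g x) = d (\<lambda>x. a x + b x)" by (auto simp: d_def)
    then show "(\<lambda>x. f x + g x) \<in> B" using dB[of "\<lambda>x. a x + b x"] by simp
  next
    fix c f assume "f \<in> B"
    then obtain a where "f = d a" unfolding B_def by blast
    then have "(\<lambda>x. c * f x) = d (\<lambda>x. c * a x)" by (auto simp: d_def algebra_simps)
    then show "(\<lambda>x. c * f x) \<in> B" using dB[of "\<lambda>x. c * a x"] by simp
  qed (auto simp: d_def B_def)
  have finE: "finite E" unfolding E_def by (rule finite_Arcs)
  define f0 where "f0 = (\<lambda>x. if x \<in> E then f x else 0)"
  define n where "n = (\<lambda>x. f0 x - proj_on E B f0 x)"
  obtain g where g: "proj_on E B f0 = d g" using proj_on(1)[OF finE dS, of f0] unfolding B_def by blast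
  have n: "n x = (if x \<in> Arcs k then f x - (g (tl x) - g (butlast x)) else 0)" for x
    unfolding n_def g by (simp add: f0_def d_def E_def)
  have "inner_on E n (d h) = 0" for h unfolding n_def by (rule proj_on(2)[OF finE dS dB])
  moreover have "inner_on E n (d h) = (\<Sum>x\<in>E. n x * cnj (h (tl x) - h (butlast x)))" for h
    unfolding inner_on_def by (rule sum.cong[OF refl]) (simp only: d_def if_True)
  ultimately have orth: "(\<Sum>x\<in>Arcs k. n x * cnj (h (tl x) - h (butlast x))) = 0" for h unfolding E_def by metis
  have nN: "n \<in> harm_space k" unfolding harm_space_def using orth n by simp
  have "coset k n = coset k f"
  proof (intro equalityI subsetI)
    fix h assume "h \<in> coset k n"
    then obtain a where a: "h \<in> extensional (Arcs k)" "\<And>x. x \<in> Arcs k \<Longrightarrow> h x = n x + (a (tl x) - a (butlast x))"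
      by (rule cosetE) blast
    show "h \<in> coset k f" by (rule cosetI[OF a(1), where g = "\<lambda>v. a v - g v"]) (simp add: a(2) n)
  next
    fix h assume "h \<in> coset k f"
    then obtain a where a: "h \<in> extensional (Arcs k)" "\<And>x. x \<in> Arcs k \<Longrightarrow> h x = f x + (a (tl x) - a (butlast x))"
      by (rule cosetE) blast
    show "h \<in> coset k n" by (rule cosetI[OF a(1), where g = "\<lambda>v. a v + g v"]) (simp add: a(2) n)
  qed
  then show ?thesis using nN by (rule bexI)
qed

lemma H1_elim:
  assumes "Y \<in> carrier (H1_Sigma k)"
  obtains n where "n \<in> harm_space k" "Y = coset k n"
  using assms coset_harmonic_representative unfolding H1_carrier by (metis rangeE)

lemma H1_vectorspace: "vectorspace complex_field (H1_Sigma k :: ('a::nonarch_local_field pgl, ('a vertex list \<Rightarrow> complex) set) rep)"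
proof -
  have "module complex_field (H1_Sigma k :: ('a pgl, ('a vertex list \<Rightarrow> complex) set) rep)"
  proof (rule module_criteria[OF ring_complex_field(2)])
    show "\<forall>v\<in>carrier (H1_Sigma k :: ('a pgl, ('a vertex list \<Rightarrow> complex) set) rep). \<exists>w\<in>carrier (H1_Sigma k). v \<oplus>\<^bsub>H1_Sigma k\<^esub> w = \<zero>\<^bsub>H1_Sigma k\<^esub>"
    proof
      fix v :: "('a vertex list \<Rightarrow> complex) set" assume "v \<in> carrier (H1_Sigma k :: ('a pgl, ('a vertex list \<Rightarrow> complex) set) rep)"
      then obtain f where f: "v = coset k f" unfolding H1_carrier by blast
      show "\<exists>w\<in>carrier (H1_Sigma k). v \<oplus>\<^bsub>H1_Sigma k\<^esub> w = \<zero>\<^bsub>H1_Sigma k\<^esub>"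
        unfolding f H1_carrier by (rule bexI[of _ "coset k (\<lambda>x. - f x)"]) (simp_all add: H1_add H1_zero)
    qed
  qed (auto simp: H1_carrier H1_zero H1_add H1_smult algebra_simps)
  then show ?thesis unfolding vectorspace_def using ring_complex_field(3) by blast
qed

lemma H1_act_hom: "A \<in> stab k \<Longrightarrow> act (H1_Sigma k) (proj A) \<in> LinearCombinations.module_hom complex_field (H1_Sigma k) (H1_Sigma k)"
proof -
  assume A: "A \<in> stab k"
  have a: "shift k A (\<lambda>x. f x + g x) = (\<lambda>x. shift k A f x + shift k A g x)" "shift k A (\<lambda>x. c * f x) = (\<lambda>x. c * shift k A f x)"
    for f g c by (auto simp: shift_def)
  show ?thesis
    unfolding module_hom_def by (auto simp: H1_carrier H1_act[OF A] H1_add H1_smult a)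
qed

section \<open>Spaces of intertwiners\<close>

lemma hom_space_vectorspace:
  assumes V: "vectorspace complex_field \<pi>" and W: "vectorspace complex_field \<sigma>"
    and closed: "\<And>g v. g \<in> carrier H \<Longrightarrow> v \<in> carrier \<pi> \<Longrightarrow> act \<pi> g v \<in> carrier \<pi>"
    and hom: "\<And>g. g \<in> carrier H \<Longrightarrow> act \<sigma> g \<in> LinearCombinations.module_hom complex_field \<sigma> \<sigma>"
  shows "vectorspace complex_field (hom_space H \<pi> \<sigma>)"
proof -
  interpret V: module complex_field \<pi> using V by (simp add: vectorspace_def)
  interpret W: module complex_field \<sigma> using W by (simp add: vectorspace_def)
  have fD: "f v \<in> carrier \<sigma>" "v \<in> carrier \<pi> \<Longrightarrow> w \<in> carrier \<pi> \<Longrightarrow> f (v \<oplus>\<^bsub>\<pi>\<^esub> w) = f v \<oplus>\<^bsub>\<sigma>\<^esub> f w"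
    "v \<in> carrier \<pi> \<Longrightarrow> f (c \<odot>\<^bsub>\<pi>\<^esub> v) = c \<odot>\<^bsub>\<sigma>\<^esub> f v" "g \<in> carrier H \<Longrightarrow> v \<in> carrier \<pi> \<Longrightarrow> f (act \<pi> g v) = act \<sigma> g (f v)"
    if "f \<in> intertwiners H \<pi> \<sigma>" "v \<in> carrier \<pi>" for f v w c g
    using that unfolding intertwiners_def module_hom_def by auto
  have gD: "act \<sigma> g (a \<oplus>\<^bsub>\<sigma>\<^esub> b) = act \<sigma> g a \<oplus>\<^bsub>\<sigma>\<^esub> act \<sigma> g b" "act \<sigma> g (c \<odot>\<^bsub>\<sigma>\<^esub> a) = c \<odot>\<^bsub>\<sigma>\<^esub> act \<sigma> g a"
    if "g \<in> carrier H" "a \<in> carrier \<sigma>" "b \<in> carrier \<sigma>" for g a b c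
    using hom[OF that(1)] that unfolding module_hom_def by auto
  have smc: "c \<odot>\<^bsub>\<sigma>\<^esub> a \<in> carrier \<sigma>" if "a \<in> carrier \<sigma>" for c a using W.smult_closed[of c a] that by simp
  have smv: "c \<odot>\<^bsub>\<pi>\<^esub> a \<in> carrier \<pi>" if "a \<in> carrier \<pi>" for c a using V.smult_closed[of c a] that by simp
  have sm0: "0 \<odot>\<^bsub>\<sigma>\<^esub> a = \<zero>\<^bsub>\<sigma>\<^esub>" if "a \<in> carrier \<sigma>" for a using W.smult_l_null[of a] that by simp
  have smd: "c \<odot>\<^bsub>\<sigma>\<^esub> (a \<oplus>\<^bsub>\<sigma>\<^esub> b) = c \<odot>\<^bsub>\<sigma>\<^esub> a \<oplus>\<^bsub>\<sigma>\<^esub> c \<odot>\<^bsub>\<sigma>\<^esub> b" "(c + d) \<odot>\<^bsub>\<sigma>\<^esub> a = c \<odot>\<^bsub>\<sigma>\<^esub> a \<oplus>\<^bsub>\<sigma>\<^esub> d \<odot>\<^bsub>\<sigma>\<^esub> a"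
      "(c * d) \<odot>\<^bsub>\<sigma>\<^esub> a = c \<odot>\<^bsub>\<sigma>\<^esub> (d \<odot>\<^bsub>\<sigma>\<^esub> a)" "1 \<odot>\<^bsub>\<sigma>\<^esub> a = a"
    if "a \<in> carrier \<sigma>" "b \<in> carrier \<sigma>" for c d a b
    using that W.smult_r_distr[of c a b] W.smult_l_distr[of c d a] W.smult_assoc1[of c d a] W.smult_one[of a] by simp_all
  have inter_smult: "(\<lambda>v\<in>carrier \<pi>. c \<odot>\<^bsub>\<sigma>\<^esub> f v) \<in> intertwiners H \<pi> \<sigma>" if f: "f \<in> intertwiners H \<pi> \<sigma>" for c f
  proof -
    have sc: "c \<odot>\<^bsub>\<sigma>\<^esub> (r \<odot>\<^bsub>\<sigma>\<^esub> a) = r \<odot>\<^bsub>\<sigma>\<^esub> (c \<odot>\<^bsub>\<sigma>\<^esub> a)" if "a \<in> carrier \<sigma>" for r a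
      using smd(3)[OF that that, of c r] smd(3)[OF that that, of r c] by (simp add: mult.commute)
    show ?thesis
      unfolding intertwiners_def module_hom_def
      using fD[OF f] by (auto simp: smc smv closed gD(2)[OF _ _ W.zero_closed] smd sc)
  qed
  have inter_add: "(\<lambda>v\<in>carrier \<pi>. f v \<oplus>\<^bsub>\<sigma>\<^esub> f' v) \<in> intertwiners H \<pi> \<sigma>"
    if f: "f \<in> intertwiners H \<pi> \<sigma>" "f' \<in> intertwiners H \<pi> \<sigma>" for f f'
  proof -
    have ga: "act \<sigma> g (f v \<oplus>\<^bsub>\<sigma>\<^esub> f' v) = act \<sigma> g (f v) \<oplus>\<^bsub>\<sigma>\<^esub> act \<sigma> g (f' v)" if "g \<in> carrier H" "v \<in> carrier \<pi>" for g v
      by (rule gD(1)[OF that(1) fD(1)[OF f(1) that(2)] fD(1)[OF f(2) that(2)]])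
    have ga': "act \<sigma> g (f' v \<oplus>\<^bsub>\<sigma>\<^esub> f v) = act \<sigma> g (f v) \<oplus>\<^bsub>\<sigma>\<^esub> act \<sigma> g (f' v)" if "g \<in> carrier H" "v \<in> carrier \<pi>" for g v
      unfolding W.a_comm[OF fD(1)[OF f(2) that(2)] fD(1)[OF f(1) that(2)]] by (rule ga[OF that])
    show ?thesis
      unfolding intertwiners_def module_hom_def
      using fD[OF f(1)] fD[OF f(2)] by (auto simp: smc smv closed ga ga' smd W.a_ac)
  qed
  have inter_zero: "(\<lambda>v\<in>carrier \<pi>. \<zero>\<^bsub>\<sigma>\<^esub>) \<in> intertwiners H \<pi> \<sigma>"
  proof -
    have "act \<sigma> g \<zero>\<^bsub>\<sigma>\<^esub> = \<zero>\<^bsub>\<sigma>\<^esub>" if "g \<in> carrier H" for g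
      using gD(2)[OF that, of "\<zero>\<^bsub>\<sigma>\<^esub>" "\<zero>\<^bsub>\<sigma>\<^esub>" 0] hom[OF that] sm0 unfolding module_hom_def by (auto simp: Pi_iff)
    then show ?thesis
      unfolding intertwiners_def module_hom_def using W.smult_r_null by (auto simp: smv closed)
  qed
  have "module complex_field (hom_space H \<pi> \<sigma>)"
  proof (rule module_criteria[OF ring_complex_field(2)])
    show "\<forall>f\<in>carrier (hom_space H \<pi> \<sigma>). \<exists>f'\<in>carrier (hom_space H \<pi> \<sigma>). f \<oplus>\<^bsub>hom_space H \<pi> \<sigma>\<^esub> f' = \<zero>\<^bsub>hom_space H \<pi> \<sigma>\<^esub>"
    proof
      fix f assume "f \<in> carrier (hom_space H \<pi> \<sigma>)"
      then have f: "f \<in> intertwiners H \<pi> \<sigma>" by (simp add: hom_space_def)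
      have "f v \<oplus>\<^bsub>\<sigma>\<^esub> (-1) \<odot>\<^bsub>\<sigma>\<^esub> f v = \<zero>\<^bsub>\<sigma>\<^esub>" if "v \<in> carrier \<pi>" for v
        using smd(2)[of "f v" "f v" 1 "-1"] smd(4)[of "f v" "f v"] fD(1)[OF f that] sm0 by simp
      then show "\<exists>f'\<in>carrier (hom_space H \<pi> \<sigma>). f \<oplus>\<^bsub>hom_space H \<pi> \<sigma>\<^esub> f' = \<zero>\<^bsub>hom_space H \<pi> \<sigma>\<^esub>"
        by (intro bexI[of _ "\<lambda>v\<in>carrier \<pi>. (-1) \<odot>\<^bsub>\<sigma>\<^esub> f v"])
          (auto simp: hom_space_def inter_smult[OF f] intro!: restrict_ext)
    qed
  qed (auto simp: hom_space_def inter_add inter_smult inter_zero smc smd(1,2) fD(1) W.a_ac intro!: restrict_ext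
      smd(3,4) dest: fD(1) simp: extensional_restrict extensional_def fun_eq_iff)
  then show ?thesis unfolding vectorspace_def using ring_complex_field(3) by blast
qed

lemma (in vectorspace) dim_0:
  assumes "carrier V = {\<zero>\<^bsub>V\<^esub>}"
  shows "dim = 0"
proof -
  have "span {} = {\<zero>\<^bsub>V\<^esub>}" unfolding span_def lincomb_def by auto
  then have "\<exists>A. finite A \<and> card A = 0 \<and> A \<subseteq> carrier V \<and> gen_set A" using assms by (intro exI[of _ "{}"]) auto
  then show ?thesis unfolding dim_def by (simp add: Least_eq_0)
qed

lemma (in vectorspace) dim_1:
  assumes v: "v \<in> carrier V" "v \<noteq> \<zero>\<^bsub>V\<^esub>" and gen: "\<And>w. w \<in> carrier V \<Longrightarrow> \<exists>c\<in>carrier K. w = c \<odot>\<^bsub>V\<^esub> v"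
  shows "dim = 1"
  unfolding dim_def
proof (rule Least_equality)
  have "w \<in> span {v}" if w: "w \<in> carrier V" for w
  proof -
    obtain c where c: "c \<in> carrier K" "w = c \<odot>\<^bsub>V\<^esub> v" using gen[OF w] by blast
    have "lincomb (\<lambda>_. c) {v} = w" unfolding lincomb_def c(2) using v(1) c(1) by (simp add: M.finsum_insert)
    then show ?thesis unfolding span_def using c(1) by (intro CollectI exI[of _ "\<lambda>_. c"] exI[of _ "{v}"]) auto
  qed
  moreover have "span {v} \<subseteq> carrier V" using v(1) by (intro span_is_subset2) auto
  ultimately have "gen_set {v}" by blast
  then show "\<exists>A. finite A \<and> card A = 1 \<and> A \<subseteq> carrier V \<and> gen_set A" using v(1) by (intro exI[of _ "{v}"]) auto
next
  fix n assume "\<exists>A. finite A \<and> card A = n \<and> A \<subseteq> carrier V \<and> gen_set A"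
  then obtain A where A: "finite A" "card A = n" "gen_set A" by blast
  show "1 \<le> n"
  proof (rule ccontr)
    assume "\<not> 1 \<le> n"
    then have "card A = 0" using A(2) by simp
    then have "A = {}" using A(1) by simp
    moreover have "span {} = {\<zero>\<^bsub>V\<^esub>}" unfolding span_def lincomb_def by auto
    ultimately show False using A(3) v by auto
  qed
qed

section \<open>The multiplicities\<close>

lemma intertwiner_of_harm_map:
  assumes "harm_map k \<tau> \<psi>" and closed: "\<And>A v. A \<in> stab k \<Longrightarrow> v \<in> carrier \<tau> \<Longrightarrow> act \<tau> (proj A) v \<in> carrier \<tau>"
  shows "(\<lambda>v. coset k (\<psi> v)) \<in> intertwiners (Kgrp k) \<tau> (H1_Sigma k)"
proof -
  note D = harm_mapD[OF assms(1)]
  have e: "\<psi> (act \<tau> (proj A) v) = shift k A (\<psi> v)" if "A \<in> stab k" "v \<in> carrier \<tau>" for A v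
    by (rule shift_eqI[OF that(1)]) (use D(4)[OF that] harm_map_off[OF assms(1) closed[OF that]] in auto)
  show ?thesis
    unfolding intertwiners_def module_hom_def
    using D(2,3) by (auto simp: H1_carrier H1_add H1_smult H1_act e K_parity_stab)
qed

lemma harm_map_of_intertwiner:
  fixes \<tau> :: "('a::nonarch_local_field pgl, 'v) rep"
  assumes irr: "irreducible_smooth T (Kgrp k) \<tau>" and f: "f \<in> intertwiners (Kgrp k) \<tau> (H1_Sigma k)"
  obtains \<psi> where "harm_map k \<tau> \<psi>" "\<And>v. v \<in> carrier \<tau> \<Longrightarrow> f v = coset k (\<psi> v)"
proof -
  interpret module complex_field \<tau> using irreducible_repD(2)[OF irr] .
  note Dr = irreducible_repD[OF irr]
  have fD: "v \<in> carrier \<tau> \<Longrightarrow> f v \<in> carrier (H1_Sigma k)"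
    "v \<in> carrier \<tau> \<Longrightarrow> w \<in> carrier \<tau> \<Longrightarrow> f (v \<oplus>\<^bsub>\<tau>\<^esub> w) = f v \<oplus>\<^bsub>H1_Sigma k\<^esub> f w"
    "v \<in> carrier \<tau> \<Longrightarrow> f (c \<odot>\<^bsub>\<tau>\<^esub> v) = c \<odot>\<^bsub>H1_Sigma k\<^esub> f v"
    "A \<in> stab k \<Longrightarrow> v \<in> carrier \<tau> \<Longrightarrow> f (act \<tau> (proj A) v) = act (H1_Sigma k) (proj A) (f v)" for v w c A
    using f proj_K_parity[where ?'a = 'a] unfolding intertwiners_def module_hom_def by auto
  have smc: "c \<odot>\<^bsub>\<tau>\<^esub> v \<in> carrier \<tau>" if "v \<in> carrier \<tau>" for c v using smult_closed[of c v] that by simp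
  have "\<exists>n. n \<in> harm_space k \<and> f v = coset k n" if v: "v \<in> carrier \<tau>" for v
    using H1_elim[OF fD(1)[OF v]] by metis
  then obtain \<psi> where psi: "\<And>v. v \<in> carrier \<tau> \<Longrightarrow> \<psi> v \<in> harm_space k" "\<And>v. v \<in> carrier \<tau> \<Longrightarrow> f v = coset k (\<psi> v)" by metis
  note FN = function_spaceD[OF function_space_harm_space]
  have "harm_map k \<tau> \<psi>"
    unfolding harm_map_def
  proof (intro conjI ballI allI)
    fix v w assume v: "v \<in> carrier \<tau>" and w: "w \<in> carrier \<tau>"
    show "\<psi> (v \<oplus>\<^bsub>\<tau>\<^esub> w) = (\<lambda>x. \<psi> v x + \<psi> w x)"
      by (rule coset_inj[OF psi(1)[OF a_closed[OF v w]] FN(2)[OF psi(1)[OF v] psi(1)[OF w]]])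
        (simp only: psi(2)[OF a_closed[OF v w], symmetric] fD(2)[OF v w] psi(2)[OF v] psi(2)[OF w] H1_add)
  next
    fix c v assume v: "v \<in> carrier \<tau>"
    show "\<psi> (c \<odot>\<^bsub>\<tau>\<^esub> v) = (\<lambda>x. c * \<psi> v x)"
      by (rule coset_inj[OF psi(1)[OF smc[OF v]] FN(3)[OF psi(1)[OF v]]])
        (simp only: psi(2)[OF smc[OF v], symmetric] fD(3)[OF v] psi(2)[OF v] H1_smult)
  next
    fix A :: "'a^2^2" and v and x :: "'a vertex list" assume A: "A \<in> stab k" and v: "v \<in> carrier \<tau>" and x: "x \<in> Arcs k"
    have "\<psi> (act \<tau> (proj A) v) = shift k A (\<psi> v)"
      by (rule coset_inj[OF psi(1)[OF Dr(4)[OF A v]] shift_harm_space[OF A psi(1)[OF v]]])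
        (simp only: psi(2)[OF Dr(4)[OF A v], symmetric] fD(4)[OF A v] psi(2)[OF v] H1_act[OF A])
    then show "\<psi> (act \<tau> (proj A) v) (lact A x) = \<psi> v x" using shift_lact[OF A x] by simp
  qed (rule psi(1))
  then show thesis using that psi(2) by blast
qed

lemma hom_space_H1_vectorspace:
  fixes \<tau> :: "('a::nonarch_local_field pgl, 'v) rep"
  assumes irr: "irreducible_smooth T (Kgrp k) \<tau>"
  shows "vectorspace complex_field (hom_space (Kgrp k) \<tau> (H1_Sigma k))"
  by (rule hom_space_vectorspace[OF irreducible_repD(1)[OF irr] H1_vectorspace])
    (use irreducible_repD(4)[OF irr] H1_act_hom in \<open>auto simp: K_parity_stab\<close>)

lemma multiplicity_0:
  fixes \<tau> :: "('a::nonarch_local_field pgl, 'v) rep"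
  assumes irr: "irreducible_smooth T (Kgrp k) \<tau>"
    and zero: "\<And>\<psi> v. harm_map k \<tau> \<psi> \<Longrightarrow> v \<in> carrier \<tau> \<Longrightarrow> \<psi> v = (\<lambda>_. 0)"
  shows "multiplicity_in (Kgrp k) \<tau> (H1_Sigma k) = 0"
proof -
  let ?V = "hom_space (Kgrp k) \<tau> (H1_Sigma k)"
  interpret V: vectorspace complex_field ?V by (rule hom_space_H1_vectorspace[OF irr])
  have "f = \<zero>\<^bsub>?V\<^esub>" if "f \<in> carrier ?V" for f
  proof -
    have f: "f \<in> intertwiners (Kgrp k) \<tau> (H1_Sigma k)" "f \<in> extensional (carrier \<tau>)" using that by (auto simp: hom_space_def)
    obtain \<psi> where psi: "harm_map k \<tau> \<psi>" "\<And>v. v \<in> carrier \<tau> \<Longrightarrow> f v = coset k (\<psi> v)"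
      using harm_map_of_intertwiner[OF irr f(1)] by blast
    have "f = (\<lambda>v\<in>carrier \<tau>. \<zero>\<^bsub>H1_Sigma k\<^esub>)"
      by (rule extensionalityI[OF f(2)]) (simp_all add: psi(2) zero[OF psi(1)] H1_zero)
    then show ?thesis by (simp add: hom_space_def)
  qed
  then have "carrier ?V = {\<zero>\<^bsub>?V\<^esub>}" using V.zero_closed by blast
  then show ?thesis unfolding multiplicity_in_def by (rule V.dim_0)
qed

lemma multiplicity_1:
  fixes \<tau> :: "('a::nonarch_local_field pgl, 'v) rep"
  assumes irr: "irreducible_smooth T (Kgrp k) \<tau>"
    and psi: "harm_map k \<tau> \<psi>" and nz: "v0 \<in> carrier \<tau>" "\<psi> v0 \<noteq> (\<lambda>_. 0)"
  shows "multiplicity_in (Kgrp k) \<tau> (H1_Sigma k) = 1"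
proof -
  let ?V = "hom_space (Kgrp k) \<tau> (H1_Sigma k)"
  interpret T: module complex_field \<tau> using irreducible_repD(2)[OF irr] .
  interpret V: vectorspace complex_field ?V by (rule hom_space_H1_vectorspace[OF irr])
  note Dr = irreducible_repD[OF irr]
  define f0 where "f0 = (\<lambda>v\<in>carrier \<tau>. coset k (\<psi> v))"
  have smc: "c \<odot>\<^bsub>\<tau>\<^esub> v \<in> carrier \<tau>" if "v \<in> carrier \<tau>" for c v using T.smult_closed[of c v] that by simp
  have "f0 \<in> intertwiners (Kgrp k) \<tau> (H1_Sigma k)"
  proof -
    have "(\<lambda>v. coset k (\<psi> v)) \<in> intertwiners (Kgrp k) \<tau> (H1_Sigma k)" by (rule intertwiner_of_harm_map[OF psi Dr(4)])
    then show ?thesis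
      unfolding intertwiners_def module_hom_def f0_def using smc Dr(4) by (auto simp: K_parity_stab)
  qed
  then have f0: "f0 \<in> carrier ?V" by (simp add: hom_space_def f0_def)
  have "f0 \<noteq> \<zero>\<^bsub>?V\<^esub>"
  proof
    assume "f0 = \<zero>\<^bsub>?V\<^esub>"
    then have "f0 v0 = coset k (\<lambda>_. 0)" using nz(1) by (simp add: hom_space_def H1_zero)
    then have "coset k (\<psi> v0) = coset k (\<lambda>_. 0)" using nz(1) by (simp add: f0_def)
    then have "\<psi> v0 = (\<lambda>_. 0)"
      by (rule coset_inj[OF harm_mapD(1)[OF psi nz(1)] function_spaceD(1)[OF function_space_harm_space]])
    then show False using nz(2) by simp
  qed
  moreover have "\<exists>c\<in>carrier complex_field. f = c \<odot>\<^bsub>?V\<^esub> f0" if "f \<in> carrier ?V" for f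
  proof -
    have f: "f \<in> intertwiners (Kgrp k) \<tau> (H1_Sigma k)" "f \<in> extensional (carrier \<tau>)" using that by (auto simp: hom_space_def)
    obtain \<psi>' where psi': "harm_map k \<tau> \<psi>'" "\<And>v. v \<in> carrier \<tau> \<Longrightarrow> f v = coset k (\<psi>' v)"
      using harm_map_of_intertwiner[OF irr f(1)] by blast
    obtain c where c: "\<And>v. v \<in> carrier \<tau> \<Longrightarrow> \<psi>' v = (\<lambda>x. c * \<psi> v x)"
      using harm_maps_proportional[OF irr psi psi'(1) nz] by blast
    have "f = (\<lambda>v\<in>carrier \<tau>. c \<odot>\<^bsub>H1_Sigma k\<^esub> f0 v)"
      by (rule extensionalityI[OF f(2)]) (simp_all add: psi'(2) c f0_def H1_smult)
    then show ?thesis by (intro bexI[of _ c]) (simp_all add: hom_space_def)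
  qed
  ultimately show ?thesis unfolding multiplicity_in_def using f0 by (intro V.dim_1)
qed

text \<open>The orthogonal complement of the kernel of a map from an
  invariant subspace onto \<open>\<tau>\<close> is invariant and isomorphic to \<open>\<tau>\<close>.\<close>

lemma harm_map_of_subquotient:
  fixes \<tau> :: "('a::nonarch_local_field pgl, 'v) rep"
  assumes irr: "irreducible_smooth T (Kgrp k) \<tau>" and sq: "subquotient_of (Kgrp k) \<tau> (H1_Sigma k)"
  obtains \<psi> v where "harm_map k \<tau> \<psi>" "v \<in> carrier \<tau>" "\<psi> v \<noteq> (\<lambda>_. 0)"
proof -
  interpret module complex_field \<tau> using irreducible_repD(2)[OF irr] .
  note Dr = irreducible_repD[OF irr]
  obtain W f where W: "invariant_subspace (Kgrp k) W (H1_Sigma k)"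
    and f: "f \<in> intertwiners (Kgrp k) (H1_Sigma k\<lparr>carrier := W\<rparr>) \<tau>" "f ` W = carrier \<tau>"
    using sq unfolding subquotient_of_def by blast
  have sub: "submodule complex_field W (H1_Sigma k)"
    using W unfolding invariant_subspace_def VectorSpace.subspace_def by blast
  have WD: "W \<subseteq> carrier (H1_Sigma k)" "\<zero>\<^bsub>H1_Sigma k\<^esub> \<in> W"
    "Y \<in> W \<Longrightarrow> Z \<in> W \<Longrightarrow> Y \<oplus>\<^bsub>H1_Sigma k\<^esub> Z \<in> W" "Y \<in> W \<Longrightarrow> c \<odot>\<^bsub>H1_Sigma k\<^esub> Y \<in> W"
    "A \<in> stab k \<Longrightarrow> Y \<in> W \<Longrightarrow> act (H1_Sigma k) (proj A) Y \<in> W" for Y Z c A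
    using submodule.subset[OF sub] submodule.zero_closed[OF sub] submodule.m_closed[OF sub]
      submodule.smult_closed[OF sub, of c Y] W proj_K_parity[where ?'a = 'a] unfolding invariant_subspace_def by auto
  have fD: "Y \<in> W \<Longrightarrow> f Y \<in> carrier \<tau>" "Y \<in> W \<Longrightarrow> Z \<in> W \<Longrightarrow> f (Y \<oplus>\<^bsub>H1_Sigma k\<^esub> Z) = f Y \<oplus>\<^bsub>\<tau>\<^esub> f Z"
    "Y \<in> W \<Longrightarrow> f (c \<odot>\<^bsub>H1_Sigma k\<^esub> Y) = c \<odot>\<^bsub>\<tau>\<^esub> f Y"
    "A \<in> stab k \<Longrightarrow> Y \<in> W \<Longrightarrow> f (act (H1_Sigma k) (proj A) Y) = act \<tau> (proj A) (f Y)" for Y Z c A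
    using f(1) proj_K_parity[where ?'a = 'a] unfolding intertwiners_def module_hom_def by auto
  define E where "E = (Arcs k :: 'a vertex list set)"
  have finE: "finite E" unfolding E_def by (rule finite_Arcs)
  note FN = function_spaceD[OF function_space_harm_space]
  have smc: "c \<odot>\<^bsub>\<tau>\<^esub> v \<in> carrier \<tau>" if "v \<in> carrier \<tau>" for c v using smult_closed[of c v] that by simp
  have sm0: "0 \<odot>\<^bsub>\<tau>\<^esub> v = \<zero>\<^bsub>\<tau>\<^esub>" if "v \<in> carrier \<tau>" for v using smult_l_null[of v] that by simp
  have smr0: "c \<odot>\<^bsub>\<tau>\<^esub> \<zero>\<^bsub>\<tau>\<^esub> = \<zero>\<^bsub>\<tau>\<^esub>" for c using smult_r_null[of c] by simp
  define M where "M = {n \<in> harm_space k. coset k n \<in> W}"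
  define F where "F n = f (coset k n)" for n
  have MN: "n \<in> harm_space k" "coset k n \<in> W" if "n \<in> M" for n using that unfolding M_def by auto
  have MI: "n \<in> M" if "n \<in> harm_space k" "coset k n \<in> W" for n using that unfolding M_def by auto
  have M_add: "(\<lambda>x. n x + m x) \<in> M" if "n \<in> M" "m \<in> M" for n m
    using WD(3)[OF MN(2)[OF that(1)] MN(2)[OF that(2)]] unfolding H1_add
    by (rule MI[OF FN(2)[OF MN(1)[OF that(1)] MN(1)[OF that(2)]]])
  have M_smult: "(\<lambda>x. c * n x) \<in> M" if "n \<in> M" for c n
    using WD(4)[OF MN(2)[OF that], of c] unfolding H1_smult by (rule MI[OF FN(3)[OF MN(1)[OF that]]])
  have M0: "(\<lambda>_. 0) \<in> M" using WD(2) unfolding H1_zero by (rule MI[OF FN(1)])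
  have M_shift: "shift k A n \<in> M" if "A \<in> stab k" "n \<in> M" for A n
    using WD(5)[OF that(1) MN(2)[OF that(2)]] unfolding H1_act[OF that(1)]
    by (rule MI[OF shift_harm_space[OF that(1) MN(1)[OF that(2)]]])
  have fsM: "function_space E M"
    unfolding function_space_def using M0 M_add M_smult FN(4)[OF MN(1)] unfolding E_def by simp
  have F_closed: "F n \<in> carrier \<tau>" if "n \<in> M" for n unfolding F_def by (rule fD(1)[OF MN(2)[OF that]])
  have F_add: "F (\<lambda>x. n x + m x) = F n \<oplus>\<^bsub>\<tau>\<^esub> F m" if "n \<in> M" "m \<in> M" for n m
    unfolding F_def H1_add[symmetric] by (rule fD(2)[OF MN(2)[OF that(1)] MN(2)[OF that(2)]])
  have F_smult: "F (\<lambda>x. c * n x) = c \<odot>\<^bsub>\<tau>\<^esub> F n" if "n \<in> M" for c n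
    unfolding F_def H1_smult[symmetric] by (rule fD(3)[OF MN(2)[OF that]])
  have F_shift: "F (shift k A n) = act \<tau> (proj A) (F n)" if "A \<in> stab k" "n \<in> M" for A n
    unfolding F_def H1_act[OF that(1), symmetric] by (rule fD(4)[OF that(1) MN(2)[OF that(2)]])
  have F0: "F (\<lambda>_. 0) = \<zero>\<^bsub>\<tau>\<^esub>" using F_smult[OF M0, of 0] sm0[OF F_closed[OF M0]] by simp
  define Z where "Z = {n \<in> M. F n = \<zero>\<^bsub>\<tau>\<^esub>}"
  have ZM: "n \<in> M" "F n = \<zero>\<^bsub>\<tau>\<^esub>" if "n \<in> Z" for n using that unfolding Z_def by auto
  have ZI: "n \<in> Z" if "n \<in> M" "F n = \<zero>\<^bsub>\<tau>\<^esub>" for n using that unfolding Z_def by auto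
  have fsZ: "function_space E Z"
    unfolding function_space_def
  proof (intro conjI ballI allI impI)
    show "(\<lambda>_. 0) \<in> Z" by (rule ZI[OF M0 F0])
    show "(\<lambda>x. n x + m x) \<in> Z" if "n \<in> Z" "m \<in> Z" for n m
      by (rule ZI[OF M_add[OF ZM(1)[OF that(1)] ZM(1)[OF that(2)]]])
        (simp add: F_add[OF ZM(1)[OF that(1)] ZM(1)[OF that(2)]] ZM(2)[OF that(1)] ZM(2)[OF that(2)])
    show "(\<lambda>x. c * n x) \<in> Z" if "n \<in> Z" for c n
      by (rule ZI[OF M_smult[OF ZM(1)[OF that]]]) (simp add: F_smult[OF ZM(1)[OF that]] ZM(2)[OF that] smr0)
    show "n x = 0" if "n \<in> Z" "x \<notin> E" for n x by (rule function_spaceD(4)[OF fsM ZM(1)[OF that(1)] that(2)])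
  qed
  have Z_shift: "shift k A n \<in> Z" if "A \<in> stab k" "n \<in> Z" for A n
  proof (rule ZI[OF M_shift[OF that(1) ZM(1)[OF that(2)]]])
    have "act \<tau> (proj A) (0 \<odot>\<^bsub>\<tau>\<^esub> \<zero>\<^bsub>\<tau>\<^esub>) = 0 \<odot>\<^bsub>\<tau>\<^esub> act \<tau> (proj A) \<zero>\<^bsub>\<tau>\<^esub>" by (rule Dr(6)[OF that(1) zero_closed])
    then show "F (shift k A n) = \<zero>\<^bsub>\<tau>\<^esub>"
      using F_shift[OF that(1) ZM(1)[OF that(2)]] ZM(2)[OF that(2)] sm0[OF Dr(4)[OF that(1) zero_closed]] sm0[OF zero_closed] by simp
  qed
  define U where "U = {n \<in> M. \<forall>z\<in>Z. inner_on E n z = 0}"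
  have UM: "n \<in> M" "z \<in> Z \<Longrightarrow> inner_on E n z = 0" if "n \<in> U" for n z using that unfolding U_def by auto
  have UI: "n \<in> U" if "n \<in> M" "\<And>z. z \<in> Z \<Longrightarrow> inner_on E n z = 0" for n using that unfolding U_def by auto
  have ex: "\<exists>n. n \<in> U \<and> F n = v" if v: "v \<in> carrier \<tau>" for v
  proof -
    obtain Y where Y: "Y \<in> W" "v = f Y" using v f(2) by blast
    obtain n where n: "n \<in> harm_space k" "Y = coset k n" using H1_elim[of Y k] WD(1) Y(1) by blast
    have nM: "n \<in> M" using MI n Y(1) by simp
    define p where "p = proj_on E Z n"
    have p: "p \<in> Z" unfolding p_def by (rule proj_on(1)[OF finE fsZ])
    define m where "m = (\<lambda>x. n x - p x)"
    have mM: "m \<in> M" unfolding m_def by (rule function_space_diff[OF fsM nM ZM(1)[OF p]])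
    have "m \<in> U" by (rule UI[OF mM]) (unfold m_def p_def, rule proj_on(2)[OF finE fsZ])
    moreover have "F m = v"
    proof -
      have "n = (\<lambda>x. m x + p x)" by (simp add: m_def)
      then have "F n = F m \<oplus>\<^bsub>\<tau>\<^esub> F p" using F_add[OF mM ZM(1)[OF p]] by simp
      then show ?thesis using ZM(2)[OF p] F_closed[OF mM] Y(2) n(2) by (simp add: F_def)
    qed
    ultimately show ?thesis by blast
  qed
  have uniq: "n = m" if n: "n \<in> U" and m: "m \<in> U" and eq: "F n = F m" for n m
  proof -
    define d where "d = (\<lambda>x. n x - m x)"
    have dM: "d \<in> M" unfolding d_def by (rule function_space_diff[OF fsM UM(1)[OF n] UM(1)[OF m]])
    have "n = (\<lambda>x. d x + m x)" by (simp add: d_def)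
    then have "F m = F d \<oplus>\<^bsub>\<tau>\<^esub> F m" using F_add[OF dM UM(1)[OF m]] eq by simp
    then have "F d = \<zero>\<^bsub>\<tau>\<^esub>" using F_closed[OF dM] F_closed[OF UM(1)[OF m]] by (metis M.add.r_cancel_one')
    then have dZ: "d \<in> Z" by (rule ZI[OF dM])
    have "inner_on E d d = inner_on E n d - inner_on E m d" unfolding d_def by (rule inner_on_linear(2))
    also have "\<dots> = 0" using UM(2)[OF n dZ] UM(2)[OF m dZ] by simp
    finally have "inner_on E d d = 0" .
    then have z: "\<forall>x\<in>E. d x = 0" by (rule iffD1[OF inner_on_self[OF finE]])
    show ?thesis
    proof
      fix x
      show "n x = m x" using z function_spaceD(4)[OF fsM dM, of x] unfolding d_def by (cases "x \<in> E") auto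
    qed
  qed
  have U_shift: "shift k A n \<in> U" if A: "A \<in> stab k" and n: "n \<in> U" for A n
  proof (rule UI[OF M_shift[OF A UM(1)[OF n]]])
    fix z assume z: "z \<in> Z"
    define z' where "z' = shift k (matrix_inv A) z"
    have z'Z: "z' \<in> Z" unfolding z'_def by (rule Z_shift[OF stab_inv[OF A] z])
    have "z = shift k A z'"
    proof (rule shift_eqI[OF A])
      fix x :: "'a vertex list" assume x: "x \<in> Arcs k"
      show "z (lact A x) = z' x"
        using shift_lact[OF stab_inv[OF A] Arcs_lact[OF A x], of z] lact_inv_Arcs(1)[OF A x] unfolding z'_def by metis
    qed (use function_spaceD(4)[OF fsZ z] E_def in blast)
    then have "inner_on E (shift k A n) z = inner_on E n z'" unfolding E_def using inner_shift[OF A] by metis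
    then show "inner_on E (shift k A n) z = 0" using UM(2)[OF n z'Z] by simp
  qed
  obtain \<psi> where psi: "\<And>v. v \<in> carrier \<tau> \<Longrightarrow> \<psi> v \<in> U" "\<And>v. v \<in> carrier \<tau> \<Longrightarrow> F (\<psi> v) = v"
    using ex by metis
  have U_add: "(\<lambda>x. n x + m x) \<in> U" if "n \<in> U" "m \<in> U" for n m
    by (rule UI[OF M_add[OF UM(1)[OF that(1)] UM(1)[OF that(2)]]]) (simp add: inner_on_linear(1) UM(2)[OF that(1)] UM(2)[OF that(2)])
  have U_smult: "(\<lambda>x. c * n x) \<in> U" if "n \<in> U" for c n
    by (rule UI[OF M_smult[OF UM(1)[OF that]]]) (simp add: inner_on_linear(3) UM(2)[OF that])
  have "harm_map k \<tau> \<psi>"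
    unfolding harm_map_def
  proof (intro conjI ballI allI)
    fix v assume v: "v \<in> carrier \<tau>"
    note uv = UM(1)[OF psi(1)[OF v]]
    show "\<psi> v \<in> harm_space k" by (rule MN(1)[OF uv])
    show "\<psi> (v \<oplus>\<^bsub>\<tau>\<^esub> w) = (\<lambda>x. \<psi> v x + \<psi> w x)" if w: "w \<in> carrier \<tau>" for w
      by (rule uniq[OF psi(1)[OF a_closed[OF v w]] U_add[OF psi(1)[OF v] psi(1)[OF w]]])
        (simp only: psi(2)[OF a_closed[OF v w]] F_add[OF uv UM(1)[OF psi(1)[OF w]]] psi(2)[OF v] psi(2)[OF w])
    show "\<psi> (c \<odot>\<^bsub>\<tau>\<^esub> v) = (\<lambda>x. c * \<psi> v x)" for c
      by (rule uniq[OF psi(1)[OF smc[OF v]] U_smult[OF psi(1)[OF v]]])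
        (simp only: psi(2)[OF smc[OF v]] F_smult[OF uv] psi(2)[OF v])
    fix A :: "'a^2^2" and x :: "'a vertex list" assume A: "A \<in> stab k" and x: "x \<in> Arcs k"
    have "\<psi> (act \<tau> (proj A) v) = shift k A (\<psi> v)"
      by (rule uniq[OF psi(1)[OF Dr(4)[OF A v]] U_shift[OF A psi(1)[OF v]]])
        (simp only: psi(2)[OF Dr(4)[OF A v]] F_shift[OF A uv] psi(2)[OF v])
    then show "\<psi> (act \<tau> (proj A) v) (lact A x) = \<psi> v x" using shift_lact[OF A x] by simp
  qed
  moreover obtain v where v: "v \<in> carrier \<tau>" "v \<noteq> \<zero>\<^bsub>\<tau>\<^esub>" using Dr(8) zero_closed by blast
  moreover have "\<psi> v \<noteq> (\<lambda>_. 0)"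
  proof
    assume "\<psi> v = (\<lambda>_. 0)"
    then have "v = \<zero>\<^bsub>\<tau>\<^esub>" using psi(2)[OF v(1)] F0 by simp
    then show False using v(2) by simp
  qed
  ultimately show thesis using that by blast
qed

theorem corollaryC:
  fixes n :: nat
    and K :: "'a::nonarch_local_field pgl set"
    and \<tau> :: "('a pgl, 'v) rep"
  assumes "odd (residue_char TYPE('a))"
    and "in_P n K \<tau>"
    and "cuspidal_type K \<tau>"
  shows "mult_total n K \<tau> = 1"
proof -
  have irr: "irreducible_smooth PGL2_top (PGL2\<lparr>carrier := K\<rparr>) \<tau>" using assms(2) unfolding in_P_def by blast
  obtain k where k: "k \<le> n" "K = K_parity k" "subquotient_of (PGL2\<lparr>carrier := K\<rparr>) \<tau> (H1_Sigma k)"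
    using assms(2) unfolding in_P_def by blast
  have irr_l: "irreducible_smooth PGL2_top (Kgrp l) \<tau>" if "K = K_parity l" for l using irr that by simp
  obtain \<psi> v where psi: "harm_map k \<tau> \<psi>" "v \<in> carrier \<tau>" "\<psi> v \<noteq> (\<lambda>_. 0)"
    using harm_map_of_subquotient[OF irr_l[OF k(2)]] k by blast
  have "mult_level l K \<tau> = (if l = k then 1 else 0)" for l
  proof (cases "K = K_parity l")
    case True
    then have parity_shift: "even k = even l" using k(2) K_parity_eq[of k l, where ?'a = 'a] by simp
    show ?thesis
    proof (cases "l = k")
      case True
      then show ?thesis
        using multiplicity_1[OF irr_l[OF k(2)] psi] k(2) unfolding mult_level_def by simp
    next
      case False
      have "\<psi>' w = (\<lambda>_. 0)" if h: "harm_map l \<tau> \<psi>'" and w: "w \<in> carrier \<tau>" for \<psi>' w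
      proof (rule ccontr)
        assume nz: "\<psi>' w \<noteq> (\<lambda>_. 0)"
        show False
        proof (cases "k < l")
          case True
          show False using harm_map_separation[OF irr_l[OF k(2)] True parity_shift psi h w] nz by blast
        next
          case F2: False
          then have "l < k" using False by simp
          then show False
            using harm_map_separation[OF irr_l[OF \<open>K = K_parity l\<close>] _ parity_shift[symmetric] h w nz psi(1,2)] psi(3) by blast
        qed
      qed
      then have "multiplicity_in (Kgrp l) \<tau> (H1_Sigma l) = 0" using multiplicity_0[OF irr_l[OF True]] by blast
      then show ?thesis using True False unfolding mult_level_def by simp
    qed
  next
    case False
    then have "l \<noteq> k" using k(2) by blast
    then show ?thesis using False unfolding mult_level_def by simp
  qed
  then show ?thesis unfolding mult_total_def using k(1) by simp
qed

end
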